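(* Let $K$ be an algebraically closed field of characteristic different from $2$, let $\Phi$ be the root system of type $B_n$ ($n>1$), and let $G$ be a semisimple algebraic $K$-group with root system $\Phi$ (so $G$ is the universal group $G_u$ or the adjoint group $G_a$). Let $w\in W=W(B_n)$ be elliptic of order $d$, with Carter diagram $\Gamma=B_{n_1}\times\cdots\times B_{n_r}$, $n_1+\cdots+n_r=n$, and let $g_0\in N_0$ represent $w$. Let $f$ be the number of relevant components $B_{n_i}$ of $\Gamma$ such that $n_i\equiv 1$ or $2 \pmod 4$. Set $e:=f$ if $d\equiv 0\pmod 4$ or $r\equiv 0,1\pmod 4$, and set $e:=f+1$ if $d\equiv 2\pmod 4$ and $r\equiv 2,3\pmod 4$ (these are the only possibilities, since $d$ is even). Then $g_0^d=h_n^e$. In particular, all elliptic $w\in W(B_n)$ have adjoint spin $1$.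
   Context: Chevalley setup: $G$ is a semisimple algebraic group over $K$ with root system $\Phi$ and Weyl group $W$, with standard Chevalley generators $x_\alpha(\lambda)$ ($\alpha\in\Phi$, $\lambda\in K$). For $\lambda\in K^*$ put $m_\alpha(\lambda)=x_\alpha(\lambda)x_{-\alpha}(-\lambda^{-1})x_\alpha(\lambda)$ and $h_\alpha(\lambda)=m_\alpha(\lambda)m_\alpha(-1)$. Let $N=\langle m_\alpha(\lambda)\rangle$, $T=\langle h_\alpha(\lambda)\rangle$ (a maximal torus), $N_0=\langle m_\alpha(1)\mid\alpha\in\Phi\rangle$, $T_0=\langle h_\alpha(-1)\mid \alpha\in\Phi\rangle$; then $N/T\cong N_0/T_0\cong W$ with $m_\alpha(\lambda)\mapsto s_\alpha$. A representative of $w\in W$ is an element of $N$ mapping to $w$. The simple roots of $B_n$ are $\alpha_1,\dots,\alpha_n$, with $\alpha_n$ the short simple root, and $h_i:=h_{\alpha_i}(-1)$. $w\in W$ is elliptic if it has no eigenvalue $1$ in the reflection representation. It is known that if $w$ is elliptic of order $d$ then all its representatives in $N$ have the same order, which is $d$ or $2d$, and $g^d$ is the same element of $T_0$ for all representatives $g$. Say $w$ has spin $1$ (in $G$) if all representatives have order $d$, and spin $-1$ if all have order $2d$; adjoint spin means spin in $G_a$, the adjoint group. Carter diagrams in type $B_n$: every elliptic $w\in W(B_n)$ is a product $w=w_1\cdots w_r$ of commuting elements, where $w_i$ is a Coxeter element of a subsystem of type $B_{n_i}$, the $r$ subsystems are mutually orthogonal, and $n_1+\cdots+n_r=n$ ($B_1$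 meaning a single short root up to sign); equivalently, $w$ has characteristic polynomial $(t^{n_1}+1)\cdots(t^{n_r}+1)$. The Carter diagram of $w$ is then $B_{n_1}\times\cdots\times B_{n_r}$. The order of $w_i$ is $d_i=2n_i$ and $d=\mathrm{lcm}(d_1,\dots,d_r)$. The component $B_{n_i}$ is relevant if the exact power of $2$ dividing $d_i$ equals the exact power of $2$ dividing $d$. *)

theory Defs
  imports
    "HOL-Algebra.Solvable_Groups"
    "HOL-Algebra.Multiplicative_Group"
    "Jordan_Normal_Form.Char_Poly"
begin

section \<open>Linear algebraic groups\<close>

text \<open>
  A linear algebraic group over an algebraically closed field is a Zariski-closed subgroup of
  some \<open>GL\<^sub>m\<close>, given by its set of rational points.
\<close>

definition GL :: "nat \<Rightarrow> 'a::field mat monoid" where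
  "GL m = units_of (ring_mat TYPE('a) m ())"

inductive_set poly_fun :: "nat \<Rightarrow> ('a::field mat \<Rightarrow> 'a) set" for m where
  const: "(\<lambda>A. c) \<in> poly_fun m"
| entry: "i < m \<Longrightarrow> j < m \<Longrightarrow> (\<lambda>A. A $$ (i, j)) \<in> poly_fun m"
| add: "f \<in> poly_fun m \<Longrightarrow> g \<in> poly_fun m \<Longrightarrow> (\<lambda>A. f A + g A) \<in> poly_fun m"
| mult: "f \<in> poly_fun m \<Longrightarrow> g \<in> poly_fun m \<Longrightarrow> (\<lambda>A. f A * g A) \<in> poly_fun m"

text \<open>Closed means closed in \<open>GL\<^sub>m\<close>; powers of \<open>1/det\<close> can be cleared from the equations.\<close>

definition zariski_closed :: "nat \<Rightarrow> 'a::field mat set \<Rightarrow> bool" where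
  "zariski_closed m S \<longleftrightarrow>
     (\<exists>P \<subseteq> poly_fun m. S = {A \<in> carrier (GL m). \<forall>f\<in>P. f A = 0})"

definition zariski_connected :: "nat \<Rightarrow> 'a::field mat set \<Rightarrow> bool" where
  "zariski_connected m S \<longleftrightarrow>
     \<not> (\<exists>A B. zariski_closed m A \<and> zariski_closed m B \<and> S \<subseteq> A \<union> B \<and>
            A \<inter> B \<inter> S = {} \<and> A \<inter> S \<noteq> {} \<and> B \<inter> S \<noteq> {})"

definition algebraic_group :: "nat \<Rightarrow> 'a::field mat set \<Rightarrow> bool" where
  "algebraic_group m G \<longleftrightarrow> subgroup G (GL m) \<and> zariski_closed m G"

definition semisimple_group :: "nat \<Rightarrow> 'a::field mat set \<Rightarrow> bool" where
  "semisimple_group m G \<longleftrightarrow> algebraic_group m G \<and> zariski_connected m G \<and>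
     (\<forall>R. algebraic_group m R \<and> zariski_connected m R \<and>
          R \<lhd> (GL m \<lparr>carrier := G\<rparr>) \<and> solvable (GL m \<lparr>carrier := R\<rparr>) \<longrightarrow> R = {1\<^sub>m m})"

definition torus :: "nat \<Rightarrow> 'a::field mat set \<Rightarrow> bool" where
  "torus m T \<longleftrightarrow> algebraic_group m T \<and> zariski_connected m T \<and>
     (\<exists>P \<in> carrier (GL m). \<forall>t\<in>T. diagonal_mat (P * t * inv\<^bsub>GL m\<^esub> P))"

definition maximal_torus :: "nat \<Rightarrow> 'a::field mat set \<Rightarrow> 'a mat set \<Rightarrow> bool" where
  "maximal_torus m G T \<longleftrightarrow> torus m T \<and> T \<subseteq> G \<and>
     (\<forall>T'. torus m T' \<and> T \<subseteq> T' \<and> T' \<subseteq> G \<longrightarrow> T' = T)"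

text \<open>
  The character group of \<open>T\<close>: homomorphisms \<open>T \<rightarrow> K\<^sup>*\<close> that are regular functions.
  They are made extensional so that equality of characters is equality on \<open>T\<close>.
\<close>

definition characters :: "nat \<Rightarrow> 'a::field mat set \<Rightarrow> ('a mat \<Rightarrow> 'a) set" where
  "characters m T = {\<chi> \<in> extensional T.
     (\<forall>t\<in>T. \<chi> t \<noteq> 0) \<and> (\<forall>s\<in>T. \<forall>t\<in>T. \<chi> (s * t) = \<chi> s * \<chi> t) \<and>
     (\<exists>f \<in> poly_fun m. \<exists>k::nat. \<forall>t\<in>T. \<chi> t = f t / det t ^ k)}"

text \<open>
  The Lie algebra as the tangent space at the identity: the linear coefficient of
  \<open>f (1 + c X)\<close> in \<open>c\<close> vanishes for every equation \<open>f\<close> of \<open>G\<close>.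
\<close>

definition lie_algebra :: "nat \<Rightarrow> 'a::field mat set \<Rightarrow> 'a mat set" where
  "lie_algebra m G = {X \<in> carrier_mat m m.
     \<forall>f \<in> poly_fun m. (\<forall>g\<in>G. f g = 0) \<longrightarrow>
       (\<forall>p. (\<forall>c. poly p c = f (1\<^sub>m m + c \<cdot>\<^sub>m X)) \<longrightarrow> Polynomial.coeff p 1 = 0)}"

definition roots_of :: "nat \<Rightarrow> 'a::field mat set \<Rightarrow> 'a mat set \<Rightarrow> ('a mat \<Rightarrow> 'a) set" where
  "roots_of m G T = {\<chi> \<in> characters m T. (\<exists>t\<in>T. \<chi> t \<noteq> 1) \<and>
     (\<exists>X \<in> lie_algebra m G. X \<noteq> 0\<^sub>m m m \<and>
        (\<forall>t\<in>T. t * X * inv\<^bsub>GL m\<^esub> t = \<chi> t \<cdot>\<^sub>m X))}"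


section \<open>The root system of type B and its Weyl group\<close>

text \<open>The vectors \<open>\<plusminus>e\<^sub>i\<close> and \<open>\<plusminus>e\<^sub>i \<plusminus> e\<^sub>j\<close> (\<open>i \<noteq> j\<close>) of \<open>\<int>\<^sup>n\<close>.\<close>

definition B_roots :: "nat \<Rightarrow> int vec set" where
  "B_roots n = {v \<in> carrier_vec n. v \<bullet> v = 1 \<or> v \<bullet> v = 2}"

text \<open>Indices start at 0: the simple root \<open>\<alpha>\<^sub>i\<close> of the usual numbering is \<open>simple_root n (i - 1)\<close>.\<close>

definition simple_root :: "nat \<Rightarrow> nat \<Rightarrow> int vec" where
  "simple_root n i =
     (if Suc i < n then unit_vec n i - unit_vec n (Suc i) else unit_vec n i)"

text \<open>The Cartan integer \<open>\<langle>\<beta>, \<alpha>\<^sup>\<or>\<rangle>\<close>; for roots \<open>\<alpha>\<close> the division is exact.\<close>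

definition cartan :: "int vec \<Rightarrow> int vec \<Rightarrow> int" where
  "cartan \<beta> \<alpha> = 2 * (\<beta> \<bullet> \<alpha>) div (\<alpha> \<bullet> \<alpha>)"

definition reflect :: "int vec \<Rightarrow> int vec \<Rightarrow> int vec" where
  "reflect \<alpha> \<beta> = \<beta> - cartan \<beta> \<alpha> \<cdot>\<^sub>v \<alpha>"

text \<open>The matrix of the reflection \<open>s\<^sub>\<alpha>\<close> in the reflection representation \<open>\<real>\<^sup>n\<close>.\<close>

definition reflection :: "nat \<Rightarrow> int vec \<Rightarrow> real mat" where
  "reflection n \<alpha> = mat n n (\<lambda>(i, j). (if i = j then 1 else 0) -
     2 * of_int (\<alpha> $ i) * of_int (\<alpha> $ j) / of_int (\<alpha> \<bullet> \<alpha>))"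

definition weyl_group :: "nat \<Rightarrow> real mat set" where
  "weyl_group n = generate (GL n) (reflection n ` B_roots n)"

definition elliptic :: "real mat \<Rightarrow> bool" where
  "elliptic w \<longleftrightarrow> \<not> eigenvalue w 1"

definition mat_product :: "nat \<Rightarrow> real mat list \<Rightarrow> real mat" where
  "mat_product n ws = foldr (*) ws (1\<^sub>m n)"

text \<open>
  A base of a subsystem of type \<open>B\<^sub>k\<close>, \<open>k\<close> being the length of the list: roots with the same
  Gram matrix as the standard base. In particular the last one is short, so \<open>B\<^sub>1\<close> means a
  single short root.
\<close>

definition B_base :: "nat \<Rightarrow> int vec list \<Rightarrow> bool" where
  "B_base n bs \<longleftrightarrow> set bs \<subseteq> B_roots n \<and>
     (\<forall>i < length bs. \<forall>j < length bs.
        bs ! i \<bullet> bs ! j = simple_root (length bs) i \<bullet> simple_root (length bs) j)"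

text \<open>A Coxeter element: the product of the simple reflections in some order.\<close>

definition coxeter_element :: "nat \<Rightarrow> int vec list \<Rightarrow> real mat \<Rightarrow> bool" where
  "coxeter_element n bs v \<longleftrightarrow>
     (\<exists>cs. mset cs = mset bs \<and> v = mat_product n (map (reflection n) cs))"

definition carter_diagram :: "nat \<Rightarrow> real mat \<Rightarrow> nat list \<Rightarrow> bool" where
  "carter_diagram n w ns \<longleftrightarrow> sum_list ns = n \<and> (\<forall>k \<in> set ns. 0 < k) \<and>
     (\<exists>bss ws. length bss = length ns \<and> length ws = length ns \<and>
        (\<forall>i < length ns. B_base n (bss ! i) \<and> length (bss ! i) = ns ! i \<and>
           coxeter_element n (bss ! i) (ws ! i)) \<and>
        (\<forall>i < length ns. \<forall>j < length ns. i \<noteq> j \<longrightarrow>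
           (\<forall>\<beta> \<in> set (bss ! i). \<forall>\<gamma> \<in> set (bss ! j). \<beta> \<bullet> \<gamma> = 0)) \<and>
        w = mat_product n ws)"

definition weyl_order :: "nat \<Rightarrow> real mat \<Rightarrow> nat" where
  "weyl_order n w = group.ord (GL n) w"

text \<open>Relevance of a component \<open>B\<^sub>k\<close>, whose Coxeter elements have order \<open>2 k\<close>.\<close>

definition relevant :: "nat \<Rightarrow> nat \<Rightarrow> bool" where
  "relevant d k \<longleftrightarrow> multiplicity 2 (2 * k) = multiplicity 2 d"

definition num_relevant_12 :: "nat \<Rightarrow> nat list \<Rightarrow> nat" where
  "num_relevant_12 d ns =
     card {i. i < length ns \<and> relevant d (ns ! i) \<and> (ns ! i) mod 4 \<in> {1, 2}}"

definition h_exponent :: "nat \<Rightarrow> nat list \<Rightarrow> nat" where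
  "h_exponent d ns =
     (if d mod 4 = 0 \<or> length ns mod 4 \<in> {0, 1}
      then num_relevant_12 d ns else num_relevant_12 d ns + 1)"


section \<open>Chevalley generators\<close>

text \<open>
  A family \<open>x\<close> of one-parameter subgroups indexed by roots; \<open>m\<close>, \<open>h\<close>, \<open>T\<close>, \<open>N\<^sub>0\<close> are built
  from \<open>x\<close> as in Steinberg's lectures on Chevalley groups.
\<close>

type_synonym 'a root_maps = "int vec \<Rightarrow> 'a \<Rightarrow> 'a mat"

definition m_elt :: "'a::field root_maps \<Rightarrow> int vec \<Rightarrow> 'a \<Rightarrow> 'a mat" where
  "m_elt x \<alpha> c = x \<alpha> c * x (- \<alpha>) (- inverse c) * x \<alpha> c"

definition h_elt :: "'a::field root_maps \<Rightarrow> int vec \<Rightarrow> 'a \<Rightarrow> 'a mat" where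
  "h_elt x \<alpha> c = m_elt x \<alpha> c * m_elt x \<alpha> (- 1)"

definition chev_T :: "nat \<Rightarrow> nat \<Rightarrow> 'a::field root_maps \<Rightarrow> 'a mat set" where
  "chev_T n m x = generate (GL m) {h_elt x \<alpha> c |\<alpha> c. \<alpha> \<in> B_roots n \<and> c \<noteq> 0}"

definition chev_N0 :: "nat \<Rightarrow> nat \<Rightarrow> 'a::field root_maps \<Rightarrow> 'a mat set" where
  "chev_N0 n m x = generate (GL m) {m_elt x \<alpha> 1 |\<alpha>. \<alpha> \<in> B_roots n}"

text \<open>
  The roots of \<open>G\<close> with respect to \<open>T\<close> form a root system of type \<open>B\<^sub>n\<close>: \<open>\<phi>\<close> is an injective
  homomorphism of the root lattice of \<open>B\<^sub>n\<close>, which is \<open>\<int>\<^sup>n\<close>, into the character group, and it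
  maps \<open>B_roots n\<close> onto the set of roots.
\<close>

definition root_system_iso ::
  "nat \<Rightarrow> nat \<Rightarrow> 'a::field mat set \<Rightarrow> 'a mat set \<Rightarrow> (int vec \<Rightarrow> 'a mat \<Rightarrow> 'a) \<Rightarrow> bool" where
  "root_system_iso n m G T \<phi> \<longleftrightarrow>
     \<phi> ` carrier_vec n \<subseteq> characters m T \<and> inj_on \<phi> (carrier_vec n) \<and>
     (\<forall>u \<in> carrier_vec n. \<forall>v \<in> carrier_vec n. \<forall>t\<in>T. \<phi> (u + v) t = \<phi> u t * \<phi> v t) \<and>
     \<phi> ` B_roots n = roots_of m G T"

text \<open>\<open>G\<close> is adjoint if its roots generate the whole character group of \<open>T\<close>.\<close>

definition adjoint_type ::
  "nat \<Rightarrow> nat \<Rightarrow> 'a::field mat set \<Rightarrow> (int vec \<Rightarrow> 'a mat \<Rightarrow> 'a) \<Rightarrow> bool" where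
  "adjoint_type n m T \<phi> \<longleftrightarrow> \<phi> ` carrier_vec n = characters m T"

text \<open>
  An isomorphism of algebraic groups from the additive group onto a subgroup of \<open>G\<close> on which
  \<open>T\<close> acts through \<open>\<chi>\<close>. The determinant is 1 on such a subgroup, so it need not be inverted
  in the formula for the inverse morphism.
\<close>

definition root_hom ::
  "nat \<Rightarrow> 'a::field mat set \<Rightarrow> 'a mat set \<Rightarrow> ('a mat \<Rightarrow> 'a) \<Rightarrow> ('a \<Rightarrow> 'a mat) \<Rightarrow> bool" where
  "root_hom m G T \<chi> y \<longleftrightarrow> range y \<subseteq> G \<and> (\<forall>b c. y (b + c) = y b * y c) \<and>
     (\<forall>i<m. \<forall>j<m. \<exists>p. \<forall>c. y c $$ (i, j) = poly p c) \<and>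
     (\<exists>f \<in> poly_fun m. \<forall>c. f (y c) = c) \<and>
     (\<forall>t\<in>T. \<forall>c. t * y c * inv\<^bsub>GL m\<^esub> t = y (\<chi> t * c))"

text \<open>
  The largest \<open>r\<close> with \<open>\<beta> - r \<alpha>\<close> a root; the structure constants of a Chevalley basis are
  \<open>\<plusminus>(r + 1)\<close>.
\<close>

definition string_len :: "nat \<Rightarrow> int vec \<Rightarrow> int vec \<Rightarrow> nat" where
  "string_len n \<alpha> \<beta> = (GREATEST r. \<beta> - int r \<cdot>\<^sub>v \<alpha> \<in> B_roots n)"

text \<open>
  Chevalley's commutator formula. In type \<open>B\<close> the only roots \<open>i \<alpha> + j \<beta>\<close> with \<open>i, j > 0\<close>
  are \<open>\<alpha> + \<beta>\<close>, \<open>\<alpha> + 2 \<beta>\<close> and \<open>2 \<alpha> + \<beta>\<close>, the last two do not both occur, and the factors commute.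
\<close>

definition root_factor :: "nat \<Rightarrow> nat \<Rightarrow> 'a::field root_maps \<Rightarrow> int vec \<Rightarrow> 'a \<Rightarrow> 'a mat" where
  "root_factor n m x \<gamma> c = (if \<gamma> \<in> B_roots n then x \<gamma> c else 1\<^sub>m m)"

definition commutator_formula ::
  "nat \<Rightarrow> nat \<Rightarrow> 'a::field root_maps \<Rightarrow> int vec \<Rightarrow> int vec \<Rightarrow> bool" where
  "commutator_formula n m x \<alpha> \<beta> \<longleftrightarrow>
     (\<exists>c11 c12 c21 :: int. \<bar>c11\<bar> = int (string_len n \<alpha> \<beta>) + 1 \<and>
       (\<forall>a b. x \<alpha> a * x \<beta> b * inv\<^bsub>GL m\<^esub> (x \<alpha> a) * inv\<^bsub>GL m\<^esub> (x \<beta> b) =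
          root_factor n m x (\<alpha> + \<beta>) (of_int c11 * a * b) *
          root_factor n m x (\<alpha> + 2 \<cdot>\<^sub>v \<beta>) (of_int c12 * a * b\<^sup>2) *
          root_factor n m x (2 \<cdot>\<^sub>v \<alpha> + \<beta>) (of_int c21 * a\<^sup>2 * b)))"

text \<open>
  Standard Chevalley generators of \<open>G\<close>: parametrisations of the root subgroups, generating \<open>G\<close>,
  normalised so as to satisfy the Chevalley relations. The signs are those of an arbitrary
  Chevalley basis.
\<close>

definition chevalley_generators ::
  "nat \<Rightarrow> nat \<Rightarrow> 'a::field mat set \<Rightarrow> (int vec \<Rightarrow> 'a mat \<Rightarrow> 'a) \<Rightarrow> 'a root_maps \<Rightarrow> bool" where
  "chevalley_generators n m G \<phi> x \<longleftrightarrow>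
     (\<forall>\<alpha> \<in> B_roots n. root_hom m G (chev_T n m x) (\<phi> \<alpha>) (x \<alpha>)) \<and>
     G = generate (GL m) {x \<alpha> c |\<alpha> c. \<alpha> \<in> B_roots n} \<and>
     (\<forall>\<alpha> \<in> B_roots n. \<forall>\<beta> \<in> B_roots n. \<beta> \<noteq> \<alpha> \<longrightarrow> \<beta> \<noteq> - \<alpha> \<longrightarrow> commutator_formula n m x \<alpha> \<beta>) \<and>
     (\<forall>\<alpha> \<in> B_roots n. \<forall>b c. b \<noteq> 0 \<longrightarrow> c \<noteq> 0 \<longrightarrow>
        h_elt x \<alpha> (b * c) = h_elt x \<alpha> b * h_elt x \<alpha> c) \<and>
     (\<forall>\<alpha> \<in> B_roots n. \<forall>\<beta> \<in> B_roots n. \<forall>b c. b \<noteq> 0 \<longrightarrow>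
        h_elt x \<alpha> b * x \<beta> c * inv\<^bsub>GL m\<^esub> (h_elt x \<alpha> b) = x \<beta> (b powi cartan \<beta> \<alpha> * c)) \<and>
     (\<forall>\<alpha> \<in> B_roots n. \<forall>\<beta> \<in> B_roots n. \<exists>\<epsilon> \<in> {1, - 1}. \<forall>c.
        m_elt x \<alpha> 1 * x \<beta> c * inv\<^bsub>GL m\<^esub> (m_elt x \<alpha> 1) = x (reflect \<alpha> \<beta>) (\<epsilon> * c))"

text \<open>
  \<open>g \<in> N\<close> represents \<open>w \<in> W\<close>: the pair lies in the subgroup generated by all
  \<open>(m\<^sub>\<alpha>(c), s\<^sub>\<alpha>)\<close>, which is the graph of the homomorphism \<open>N \<rightarrow> W\<close> with kernel \<open>T\<close>.
\<close>

definition represents :: "nat \<Rightarrow> nat \<Rightarrow> 'a::field root_maps \<Rightarrow> 'a mat \<Rightarrow> real mat \<Rightarrow> bool" where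
  "represents n m x g w \<longleftrightarrow>
     (g, w) \<in> generate (GL m \<times>\<times> GL n)
       {(m_elt x \<alpha> c, reflection n \<alpha>) |\<alpha> c. \<alpha> \<in> B_roots n \<and> c \<noteq> 0}"

definition has_spin_1 :: "nat \<Rightarrow> nat \<Rightarrow> 'a::field root_maps \<Rightarrow> real mat \<Rightarrow> bool" where
  "has_spin_1 n m x w \<longleftrightarrow>
     (\<forall>g. represents n m x g w \<longrightarrow> group.ord (GL m) g = weyl_order n w)"

end

theory Submission
  imports Defs
begin

text \<open>
  Elements of \<open>N\<close> are controlled modulo the torus: enumerating cosets along
  \<open>B\<^sub>1 \<subset> B\<^sub>2 \<subset> \<dots>\<close> shows that an element of \<open>N\<close> over \<open>1 \<in> W\<close> lies in the torus \<open>T\<close>, and more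
  precisely in the subtorus of the coordinates that are involved. The elements \<open>m\<^sub>v(c)\<close> with \<open>v\<close>
  short behave like generators of a Clifford algebra: each squares to the central element
  \<open>z = h\<^sub>n\<close>, and by the commutator formula two of them for orthogonal roots commute up to \<open>z\<close>.

  The \<open>k\<close>-th power of a Coxeter element of \<open>B\<^sub>k\<close> is \<open>-1\<close> on \<open>k\<close> coordinates. Hence its lift \<open>c\<close>
  satisfies \<open>c\<^sup>k = t q\<^sub>1 \<dots> q\<^sub>k\<close>, where \<open>q\<^sub>i\<close> is \<open>m\<^sub>v(1)\<close> for \<open>v = e\<^sub>i\<close> and \<open>t\<close> lies in the torus and
  is inverted by \<open>q\<^sub>1 \<dots> q\<^sub>k\<close>. So the \<open>2k\<close>-th power of \<open>c\<close> is \<open>(q\<^sub>1 \<dots> q\<^sub>k)\<^sup>2\<close>, which is \<open>z\<close> to the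
  power \<open>k(k+1)/2\<close>. Lifts of the \<open>r\<close> components commute pairwise up to \<open>z\<close>, as each contains
  exactly one short reflection; this contributes \<open>z\<close> to the power \<open>(d choose 2)(r choose 2)\<close>.

  Ellipticity makes every orbit of short roots contain the negative of each member, half a period
  away. Replacing a representative \<open>g\<close> by \<open>t g\<close> multiplies \<open>g\<^sup>d\<close> by a norm of \<open>t\<close>, whose factors
  cancel at distance half a period. In the same way \<open>g\<^sup>d\<close> centralises the short root subgroups;
  in the adjoint group the characters are generated by the short roots, so \<open>g\<^sup>d = 1\<close>.
\<close>

section \<open>Roots of type B\<close>

text \<open>\<open>represents\<close> describes N -> W only as a generated set of pairs, so that its
  kernel is the torus has to be proved; the coset enumeration does this. The relations leave signs
  open, and two of them matter. That \<open>m \<alpha> 1\<close> acts with equal signs on opposite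
  root subgroups makes conjugates of \<open>m\<close> again values of \<open>m\<close>. That it acts
  by -1 for orthogonal short roots u, v rests on a structure constant: v - u is a root and v - 2u is
  not, so the constant is +-2, and comparing coefficients gives the sign 1 +- 2, which must be -1.

  The exponent arises as follows. Squaring a product of k anticommuting generators takes k squares
  and k(k-1)/2 exchanges, in total k(k+1)/2, which is odd for k = 1, 2 mod 4. Raising to the power
  d/(2k) keeps this parity if d/(2k) is odd, that is, for relevant components, and makes it even
  otherwise; this gives f. Since d is even, the exchange term is odd just for d = 2 mod 4 and r = 2,
  3 mod 4, which is the extra 1.

  Coordinate sets index the constructions because the half turn of a component inverts only the
  torus of its own coordinates.\<close>

definition supported :: "nat set \<Rightarrow> int vec \<Rightarrow> bool" where
  "supported I v \<longleftrightarrow> (\<forall>j < dim_vec v. j \<notin> I \<longrightarrow> v $ j = 0)"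

definition short :: "nat \<Rightarrow> int vec \<Rightarrow> bool" where
  "short n v \<longleftrightarrow> v \<in> carrier_vec n \<and> v \<bullet> v = 1"

definition long :: "nat \<Rightarrow> int vec \<Rightarrow> bool" where
  "long n v \<longleftrightarrow> v \<in> carrier_vec n \<and> v \<bullet> v = 2"

lemma B_roots_iff: "v \<in> B_roots n \<longleftrightarrow> short n v \<or> long n v"
  by (auto simp: B_roots_def short_def long_def)

lemma B_roots_carrier: "v \<in> B_roots n \<Longrightarrow> v \<in> carrier_vec n"
  by (simp add: B_roots_def)

lemma short_root: "short n v \<Longrightarrow> v \<in> B_roots n"
  by (simp add: B_roots_iff)

lemma short_carrier: "short n v \<Longrightarrow> v \<in> carrier_vec n"
  by (simp add: short_def)

lemma scalar_prod_self: "v \<in> carrier_vec n \<Longrightarrow> v \<bullet> v = (\<Sum>i<n. v $ i * v $ i)"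
  by (auto simp: scalar_prod_def lessThan_atLeast0)

lemma uminus_vec_scalar:
  fixes u v :: "int vec"
  assumes "u \<in> carrier_vec n" "v \<in> carrier_vec n"
  shows "(- u) \<bullet> v = - (u \<bullet> v)" "u \<bullet> (- v) = - (u \<bullet> v)"
  using assms by auto

lemma B_roots_uminus [simp]: "- v \<in> B_roots n \<longleftrightarrow> v \<in> B_roots n"
proof -
  have "- v \<in> B_roots n" if "v \<in> B_roots n" for v :: "int vec"
    using that by (auto simp: B_roots_def uminus_vec_scalar[of _ n])
  from this[of v] this[of "- v"] show ?thesis by auto
qed

lemma short_uminus: "short n v \<Longrightarrow> short n (- v)"
  by (auto simp: short_def uminus_vec_scalar[of _ n])

lemma short_unit: "i < n \<Longrightarrow> short n (unit_vec n i)"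
  by (simp add: short_def)

lemma root_nonzero: "v \<in> B_roots n \<Longrightarrow> v \<noteq> - v"
proof
  assume v: "v \<in> B_roots n" "v = - v"
  then have "v \<bullet> v = - (v \<bullet> v)"
    using uminus_vec_scalar(1)[of v n v] by (auto simp: B_roots_def)
  with v show False by (auto simp: B_roots_def)
qed

text \<open>A sum of integer squares equal to 1 has a single nonzero term.\<close>

lemma short_cases:
  assumes "short n v"
  obtains i where "i < n" "v = unit_vec n i \<or> v = - unit_vec n i"
proof -
  have v: "v \<in> carrier_vec n" "(\<Sum>i<n. v $ i * v $ i) = 1"
    using assms scalar_prod_self[of v n] by (auto simp: short_def)
  have "\<exists>i<n. v $ i \<noteq> 0"
  proof (rule ccontr)
    assume "\<not> ?thesis"
    then have "(\<Sum>i<n. v $ i * v $ i) = 0" by (intro sum.neutral) auto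
    with v show False by simp
  qed
  then obtain i where i: "i < n" "v $ i \<noteq> 0" by blast
  have split: "(\<Sum>j<n. v $ j * v $ j) = v $ i * v $ i + (\<Sum>j\<in>{..<n}-{i}. v $ j * v $ j)"
    using i by (simp add: sum.remove)
  have nn: "(\<Sum>j\<in>{..<n}-{i}. v $ j * v $ j) \<ge> 0"
    by (intro sum_nonneg) auto
  have "v $ i * v $ i \<ge> 1"
    using i by (metis int_one_le_iff_zero_less not_less zero_less_mult_iff linorder_neqE)
  with split v nn have *: "v $ i * v $ i = 1" "(\<Sum>j\<in>{..<n}-{i}. v $ j * v $ j) = 0" by auto
  then have z: "v $ j = 0" if "j < n" "j \<noteq> i" for j
    using that sum_nonneg_eq_0_iff[of "{..<n}-{i}" "\<lambda>j. v $ j * v $ j"] by auto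
  from * have "v $ i = 1 \<or> v $ i = -1"
    by (metis zmult_eq_1_iff)
  then have "v = unit_vec n i \<or> v = - unit_vec n i"
  proof
    assume "v $ i = 1"
    then have "v = unit_vec n i"
      using v i z by (intro eq_vecI) auto
    then show ?thesis ..
  next
    assume "v $ i = -1"
    then have "v = - unit_vec n i"
      using v i z by (intro eq_vecI) auto
    then show ?thesis ..
  qed
  with i that show thesis by blast
qed

lemma short_orthogonal_disjoint:
  assumes "short n u" "short n v" "u \<bullet> v \<noteq> 0"
  shows "u = v \<or> u = - v"
  using assms
  by (elim short_cases) (auto simp: uminus_vec_scalar[of _ n] split: if_splits)

lemma supported_unit: "i < n \<Longrightarrow> supported I (unit_vec n i) \<longleftrightarrow> i \<in> I"
  by (auto simp: supported_def)

lemma supported_uminus [simp]: "supported I (- v) \<longleftrightarrow> supported I v"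
  by (auto simp: supported_def)

lemma supported_add: "supported I u \<Longrightarrow> supported I v \<Longrightarrow> dim_vec u = dim_vec v \<Longrightarrow> supported I (u + v)"
  by (auto simp: supported_def)

lemma supported_diff: "supported I u \<Longrightarrow> supported I v \<Longrightarrow> dim_vec u = dim_vec v \<Longrightarrow> supported I (u - v)"
  by (auto simp: supported_def)

lemma supported_smult: "supported I u \<Longrightarrow> supported I (k \<cdot>\<^sub>v u)"
  by (auto simp: supported_def)

lemma supported_mono: "supported I u \<Longrightarrow> I \<subseteq> J \<Longrightarrow> supported J u"
  by (auto simp: supported_def)

lemma supported_all: "v \<in> carrier_vec n \<Longrightarrow> {..<n} \<subseteq> I \<Longrightarrow> supported I v"
  by (auto simp: supported_def)

lemma long_sum:
  assumes "short n u" "short n v" "u \<bullet> v = 0"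
  shows "long n (u + v)" "long n (u - v)"
proof -
  have c: "u \<in> carrier_vec n" "v \<in> carrier_vec n" "v \<bullet> u = 0"
    using assms by (auto simp: short_def comm_scalar_prod[of v n u])
  show "long n (u + v)" "long n (u - v)" using assms c
    by (auto simp: long_def short_def add_scalar_prod_distrib[of _ n] scalar_prod_add_distrib[of _
        n]
        minus_scalar_prod_distrib[of _ n] scalar_prod_minus_distrib[of _ n])
qed

text \<open>Splitting off one nonzero coordinate, necessarily +-1, leaves a short root orthogonal to
  it. The support of the remainder is recorded because \<open>h_T\<close> must stay inside a given
  coordinate set.\<close>

lemma long_cases:
  assumes "long n v"
  obtains i u where "i < n" "short n u" "u $ i = 0" "v = unit_vec n i + u \<or> v = - unit_vec n i + u"
    "u \<bullet> unit_vec n i = 0" "supported {j. v $ j \<noteq> 0} u" "v $ i \<noteq> 0"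
proof -
  have v: "v \<in> carrier_vec n" "(\<Sum>i<n. v $ i * v $ i) = 2"
    using assms scalar_prod_self[of v n] by (auto simp: long_def)
  have "\<exists>i<n. v $ i \<noteq> 0"
  proof (rule ccontr)
    assume "\<not> ?thesis"
    then have "(\<Sum>i<n. v $ i * v $ i) = 0" by (intro sum.neutral) auto
    with v show False by simp
  qed
  then obtain i where i: "i < n" "v $ i \<noteq> 0" by blast
  have split: "(\<Sum>j<n. v $ j * v $ j) = v $ i * v $ i + (\<Sum>j\<in>{..<n}-{i}. v $ j * v $ j)"
    using i by (simp add: sum.remove)
  have nn: "(\<Sum>j\<in>{..<n}-{i}. v $ j * v $ j) \<ge> 0"
    by (intro sum_nonneg) auto
  have "v $ i * v $ i \<le> 2" using nn split v by simp
  moreover have "v $ i * v $ i \<ge> 4" if "\<bar>v $ i\<bar> \<ge> 2"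
    using that mult_mono[of 2 "\<bar>v $ i\<bar>" 2 "\<bar>v $ i\<bar>"] by simp
  ultimately have a: "v $ i = 1 \<or> v $ i = -1" using i by linarith
  define a where "a = v $ i"
  have a2: "a * a = 1" using a by (auto simp: a_def)
  define u where "u = v - a \<cdot>\<^sub>v unit_vec n i"
  have uc: "u \<in> carrier_vec n" using v by (simp add: u_def)
  have ve: "v \<bullet> unit_vec n i = a" "unit_vec n i \<bullet> v = a" using v i by (auto simp: a_def)
  have uu: "u \<bullet> u = 1" using v assms a2 i unfolding u_def
    by (simp add: minus_scalar_prod_distrib[of _ n] scalar_prod_minus_distrib[of _ n] ve long_def
        a_def[symmetric])
  have ui: "u $ i = 0" using v i by (simp add: u_def a_def)
  have vi: "v = unit_vec n i + u \<or> v = - unit_vec n i + u"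
    using a
  proof
    assume "v $ i = 1" then have "v = unit_vec n i + u"
      using v i by (intro eq_vecI) (auto simp: u_def a_def)
    then show ?thesis ..
  next
    assume "v $ i = -1" then have "v = - unit_vec n i + u"
      using v i by (intro eq_vecI) (auto simp: u_def a_def)
    then show ?thesis ..
  qed
  have "supported {j. v $ j \<noteq> 0} u" using v ui i by (auto simp: supported_def u_def)
  with that i uc uu ui vi show thesis by (auto simp: short_def)
qed

lemma cartan_short: "\<alpha> \<bullet> \<alpha> = 1 \<Longrightarrow> cartan \<beta> \<alpha> = 2 * (\<beta> \<bullet> \<alpha>)"
  by (simp add: cartan_def)

lemma cartan_long: "\<alpha> \<bullet> \<alpha> = 2 \<Longrightarrow> cartan \<beta> \<alpha> = \<beta> \<bullet> \<alpha>"
  by (simp add: cartan_def)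

lemma cartan_add:
  assumes "\<alpha> \<in> B_roots n" "u \<in> carrier_vec n" "v \<in> carrier_vec n"
  shows "cartan (u + v) \<alpha> = cartan u \<alpha> + cartan v \<alpha>" "cartan (u - v) \<alpha> = cartan u \<alpha> - cartan v \<alpha>"
    "cartan (- v) \<alpha> = - cartan v \<alpha>" "cartan (k \<cdot>\<^sub>v v) \<alpha> = k * cartan v \<alpha>"
  using assms
  by (auto simp: B_roots_def cartan_short cartan_long add_scalar_prod_distrib[of _ n]
        minus_scalar_prod_distrib[of _ n] uminus_vec_scalar[of _ n])

text \<open>The division in \<open>cartan\<close> is exact because a root has norm 1 or 2. In this
  form the fact transfers to the reals in \<open>acts_reflection\<close>.\<close>

lemma cartan_mult_norm:
  assumes "\<alpha> \<in> B_roots n"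
  shows "cartan \<beta> \<alpha> * (\<alpha> \<bullet> \<alpha>) = 2 * (\<beta> \<bullet> \<alpha>)"
  using assms by (auto simp: B_roots_def cartan_short cartan_long)

lemma cartan_self: "\<alpha> \<in> B_roots n \<Longrightarrow> cartan \<alpha> \<alpha> = 2"
  by (auto simp: B_roots_def cartan_def)

lemma reflect_carrier [simp, intro]:
  "\<alpha> \<in> B_roots n \<Longrightarrow> \<beta> \<in> carrier_vec n \<Longrightarrow> reflect \<alpha> \<beta> \<in> carrier_vec n"
  by (simp add: reflect_def B_roots_def)

lemma reflect_add:
  assumes "\<alpha> \<in> B_roots n" "u \<in> carrier_vec n" "v \<in> carrier_vec n"
  shows "reflect \<alpha> (u + v) = reflect \<alpha> u + reflect \<alpha> v"
    "reflect \<alpha> (u - v) = reflect \<alpha> u - reflect \<alpha> v"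
    "reflect \<alpha> (- v) = - reflect \<alpha> v"
proof -
  have "\<alpha> \<in> carrier_vec n" using assms by (simp add: B_roots_def)
  then show "reflect \<alpha> (u + v) = reflect \<alpha> u + reflect \<alpha> v"
    "reflect \<alpha> (u - v) = reflect \<alpha> u - reflect \<alpha> v"
    "reflect \<alpha> (- v) = - reflect \<alpha> v"
    using assms by (auto simp: reflect_def cartan_add[OF assms] algebra_simps intro!: eq_vecI)
qed

lemma reflect_scalar_prod:
  assumes "\<alpha> \<in> B_roots n" "u \<in> carrier_vec n" "v \<in> carrier_vec n"
  shows "reflect \<alpha> u \<bullet> reflect \<alpha> v = u \<bullet> v"
proof -
  have a: "\<alpha> \<in> carrier_vec n" using assms by (simp add: B_roots_def)
  have "reflect \<alpha> u \<bullet> reflect \<alpha> v =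
    u \<bullet> v - cartan v \<alpha> * (u \<bullet> \<alpha>) - cartan u \<alpha> * (v \<bullet> \<alpha>) + cartan u \<alpha> * (cartan v \<alpha> * (\<alpha> \<bullet> \<alpha>))"
    using assms a by (simp add: reflect_def minus_scalar_prod_distrib[of _ n]
      scalar_prod_minus_distrib[of _ n] algebra_simps comm_scalar_prod[of \<alpha> n v])
  then show ?thesis using assms(1) by (auto simp: B_roots_def cartan_short cartan_long)
qed

lemma reflect_root:
  assumes "\<alpha> \<in> B_roots n" "\<beta> \<in> B_roots n"
  shows "reflect \<alpha> \<beta> \<in> B_roots n"
  using assms reflect_scalar_prod[OF assms(1), of \<beta> \<beta>] by (auto simp: B_roots_def)

lemma reflect_self: "\<alpha> \<in> B_roots n \<Longrightarrow> reflect \<alpha> \<alpha> = - \<alpha>"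
  by (auto simp: reflect_def cartan_self intro!: eq_vecI)

lemma reflect_reflect:
  assumes "\<alpha> \<in> B_roots n" "v \<in> carrier_vec n"
  shows "reflect \<alpha> (reflect \<alpha> v) = v"
proof -
  have a: "\<alpha> \<in> carrier_vec n" using assms by (simp add: B_roots_def)
  have "cartan (reflect \<alpha> v) \<alpha> = - cartan v \<alpha>"
    using assms a unfolding reflect_def
    by (subst cartan_add(2)[OF assms(1)]) (auto simp: cartan_add[OF assms(1) _ a] cartan_self)
  then show ?thesis using assms a by (auto simp: reflect_def[of \<alpha> "reflect \<alpha> v"])
     (auto simp: reflect_def intro!: eq_vecI)
qed

lemma reflect_uminus_root:
  assumes "\<alpha> \<in> B_roots n" "v \<in> carrier_vec n"
  shows "reflect (- \<alpha>) v = reflect \<alpha> v" "cartan v (- \<alpha>) = - cartan v \<alpha>"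
proof -
  have a: "\<alpha> \<in> carrier_vec n" using assms by (simp add: B_roots_def)
  show "cartan v (- \<alpha>) = - cartan v \<alpha>"
    using assms a by (auto simp: B_roots_def cartan_def uminus_vec_scalar[of _ n])
  then show "reflect (- \<alpha>) v = reflect \<alpha> v" using assms a
    by (auto simp: reflect_def intro!: eq_vecI)
qed

lemma reflect_orthogonal:
  "v \<in> carrier_vec n \<Longrightarrow> \<alpha> \<in> carrier_vec n \<Longrightarrow> v \<bullet> \<alpha> = 0 \<Longrightarrow> reflect \<alpha> v = v"
  by (auto simp: reflect_def cartan_def intro!: eq_vecI)

lemma reflect_diff_short:
  assumes "short n u" "short n v" "u \<bullet> v = 0"
  shows "reflect (u - v) u = v" "reflect (u - v) v = u"
    "reflect (u + v) u = - v" "reflect (u + v) v = - u"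
proof -
  have c: "u \<in> carrier_vec n" "v \<in> carrier_vec n" "v \<bullet> u = 0" "u \<bullet> u = 1" "v \<bullet> v = 1" "u \<bullet> v = 0"
    using assms by (auto simp: short_def comm_scalar_prod[of v n u])
  note l = long_sum[OF assms]
  note d = add_scalar_prod_distrib[of _ n] scalar_prod_add_distrib[of _ n]
        minus_scalar_prod_distrib[of _ n] scalar_prod_minus_distrib[of _ n]
  have "cartan u (u - v) = 1" "cartan v (u - v) = -1" "cartan u (u + v) = 1" "cartan v (u + v) = 1"
    using l c by (simp_all add: cartan_long long_def d)
  then show "reflect (u - v) u = v" "reflect (u - v) v = u"
    "reflect (u + v) u = - v" "reflect (u + v) v = - u"
    using c by (auto simp: reflect_def intro!: eq_vecI)
qed

lemma reflect_supported:
  assumes "supported I \<alpha>" "supported I v" "\<alpha> \<in> carrier_vec n" "v \<in> carrier_vec n"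
  shows "supported I (reflect \<alpha> v)"
  using assms by (auto simp: reflect_def intro!: supported_diff supported_smult)

section \<open>Chevalley relations\<close>

context group
begin

definition cj :: "'a \<Rightarrow> 'a \<Rightarrow> 'a" where
  "cj g y = g \<otimes> y \<otimes> inv g"

lemma cancel_left [simp]:
  assumes "g \<in> carrier G" "y \<in> carrier G"
  shows "inv g \<otimes> (g \<otimes> y) = y" "g \<otimes> (inv g \<otimes> y) = y"
  using assms by (simp_all add: m_assoc[symmetric])

lemmas word_simps = m_assoc inv_mult_group

lemma cj_closed [simp, intro]: "g \<in> carrier G \<Longrightarrow> y \<in> carrier G \<Longrightarrow> cj g y \<in> carrier G"
  by (simp add: cj_def)

lemma cj_mult:
  "g \<in> carrier G \<Longrightarrow> a \<in> carrier G \<Longrightarrow> b \<in> carrier G \<Longrightarrow> cj g (a \<otimes> b) = cj g a \<otimes> cj g b"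
  by (simp add: cj_def word_simps)

lemma cj_cj:
  "g \<in> carrier G \<Longrightarrow> h \<in> carrier G \<Longrightarrow> y \<in> carrier G \<Longrightarrow> cj (g \<otimes> h) y = cj g (cj h y)"
  by (simp add: cj_def word_simps)

lemma cj_inv: "g \<in> carrier G \<Longrightarrow> y \<in> carrier G \<Longrightarrow> cj g (inv y) = inv (cj g y)"
  by (simp add: cj_def word_simps)

lemma cj_one [simp]: "g \<in> carrier G \<Longrightarrow> cj g \<one> = \<one>" "y \<in> carrier G \<Longrightarrow> cj \<one> y = y"
  by (simp_all add: cj_def)

lemma cj_cancel [simp]:
  assumes "g \<in> carrier G" "y \<in> carrier G"
  shows "cj (inv g) (cj g y) = y" "cj g (cj (inv g) y) = y"
  using assms by (simp_all add: cj_def word_simps)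

lemma mult_cj: "g \<in> carrier G \<Longrightarrow> y \<in> carrier G \<Longrightarrow> g \<otimes> y = cj g y \<otimes> g"
  by (simp add: cj_def word_simps)

lemma cj_fixed_iff:
  assumes "g \<in> carrier G" "y \<in> carrier G"
  shows "cj g y = y \<longleftrightarrow> g \<otimes> y = y \<otimes> g"
  using assms mult_cj[OF assms] by simp

lemma cj_fixed_sym:
  assumes "g \<in> carrier G" "y \<in> carrier G" "cj g y = y"
  shows "cj y g = g"
  using assms cj_fixed_iff by metis

lemma cj_fixed_inv:
  assumes "g \<in> carrier G" "y \<in> carrier G" "cj g y = y"
  shows "cj (inv g) y = y"
  using assms cj_cancel by metis

end

text \<open>The generators are split off from the relations because \<open>m\<close>,
  \<open>h\<close> and \<open>x_or_one\<close> must exist before the relations can be stated in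
  terms of them. The ambient group is abstract; matrices return only in
  \<open>chevalley_matrix_group\<close>.\<close>

locale root_maps = group \<G> for \<G> (structure) +
  fixes n :: nat and x :: "int vec \<Rightarrow> 'k::alg_closed_field \<Rightarrow> 'a"
  assumes x_closed [simp, intro]: "\<alpha> \<in> B_roots n \<Longrightarrow> x \<alpha> c \<in> carrier \<G>"
begin

definition m :: "int vec \<Rightarrow> 'k \<Rightarrow> 'a" where
  "m \<alpha> c = x \<alpha> c \<otimes> x (- \<alpha>) (- inverse c) \<otimes> x \<alpha> c"

definition h :: "int vec \<Rightarrow> 'k \<Rightarrow> 'a" where
  "h \<alpha> c = m \<alpha> c \<otimes> m \<alpha> (- 1)"

definition x_or_one :: "int vec \<Rightarrow> 'k \<Rightarrow> 'a" where
  "x_or_one \<gamma> c = (if \<gamma> \<in> B_roots n then x \<gamma> c else \<one>)"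

lemma m_closed [simp, intro]: "\<alpha> \<in> B_roots n \<Longrightarrow> m \<alpha> c \<in> carrier \<G>"
  by (simp add: m_def)

lemma h_closed [simp, intro]: "\<alpha> \<in> B_roots n \<Longrightarrow> h \<alpha> c \<in> carrier \<G>"
  by (simp add: h_def)

end

locale chevalley_group = root_maps \<G> n x
  for \<G> (structure) and n :: nat and x :: "int vec \<Rightarrow> 'k::alg_closed_field \<Rightarrow> 'a" +
  assumes two: "(2::'k) \<noteq> 0" and rank: "n > 1"
    and x_add: "\<alpha> \<in> B_roots n \<Longrightarrow> x \<alpha> (b + c) = x \<alpha> b \<otimes> x \<alpha> c"
    and x_inj: "\<alpha> \<in> B_roots n \<Longrightarrow> x \<alpha> b = x \<alpha> c \<Longrightarrow> b = c"
    and x_commutator: "\<alpha> \<in> B_roots n \<Longrightarrow> \<beta> \<in> B_roots n \<Longrightarrow> \<beta> \<noteq> \<alpha> \<Longrightarrow> \<beta> \<noteq> - \<alpha> \<Longrightarrow>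
      \<exists>c11 c12 c21 :: int. \<bar>c11\<bar> = int (string_len n \<alpha> \<beta>) + 1 \<and>
       (\<forall>a b. x \<alpha> a \<otimes> x \<beta> b \<otimes> inv (x \<alpha> a) \<otimes> inv (x \<beta> b) =
          x_or_one (\<alpha> + \<beta>) (of_int c11 * a * b) \<otimes>
          x_or_one (\<alpha> + 2 \<cdot>\<^sub>v \<beta>) (of_int c12 * a * b\<^sup>2) \<otimes>
          x_or_one (2 \<cdot>\<^sub>v \<alpha> + \<beta>) (of_int c21 * a\<^sup>2 * b))"
    and h_mult: "\<alpha> \<in> B_roots n \<Longrightarrow> b \<noteq> 0 \<Longrightarrow> c \<noteq> 0 \<Longrightarrow> h \<alpha> (b * c) = h \<alpha> b \<otimes> h \<alpha> c"
    and h_x: "\<alpha> \<in> B_roots n \<Longrightarrow> \<beta> \<in> B_roots n \<Longrightarrow> b \<noteq> 0 \<Longrightarrow>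
      h \<alpha> b \<otimes> x \<beta> c \<otimes> inv (h \<alpha> b) = x \<beta> (b powi cartan \<beta> \<alpha> * c)"
    and m_x: "\<alpha> \<in> B_roots n \<Longrightarrow> \<beta> \<in> B_roots n \<Longrightarrow> \<exists>\<epsilon> \<in> {1, - 1}. \<forall>c.
      m \<alpha> 1 \<otimes> x \<beta> c \<otimes> inv (m \<alpha> 1) = x (reflect \<alpha> \<beta>) (\<epsilon> * c)"
begin

lemma cj_h_x: "\<alpha> \<in> B_roots n \<Longrightarrow> \<beta> \<in> B_roots n \<Longrightarrow> b \<noteq> 0 \<Longrightarrow>
    cj (h \<alpha> b) (x \<beta> c) = x \<beta> (b powi cartan \<beta> \<alpha> * c)"
  by (simp add: cj_def h_x)

lemma x_zero [simp]: assumes "\<alpha> \<in> B_roots n" shows "x \<alpha> 0 = \<one>"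
proof -
  have "x \<alpha> 0 \<otimes> x \<alpha> 0 = x \<alpha> 0"
    using x_add[OF assms, of 0 0] by simp
  then show ?thesis using assms by (metis r_cancel_one' x_closed)
qed

lemma x_minus: assumes "\<alpha> \<in> B_roots n" shows "x \<alpha> (- c) = inv (x \<alpha> c)"
  using assms x_add[OF assms, of "- c" c] by (metis add.left_inverse inv_equality x_closed x_zero)

lemma x_eq_one_iff: assumes "\<alpha> \<in> B_roots n" shows "x \<alpha> c = \<one> \<longleftrightarrow> c = 0"
  using assms x_inj[OF assms, of c 0] by auto

lemma one_ne_minus_one: "(1::'k) \<noteq> - 1"
  using two by (metis add.right_inverse one_add_one)

text \<open>A primitive eighth root of unity serves. Its square differs from 1 and from its own
  inverse, so \<open>h \<alpha> s\<close> separates the weights 2, 0 and -2.\<close>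

lemma exists_scalar: "\<exists>s::'k. s \<noteq> 0 \<and> s\<^sup>2 \<noteq> 1 \<and> s ^ 4 \<noteq> 1"
proof -
  obtain s :: 'k where s: "s ^ 4 = - 1"
    using nth_root_exists[of 4 "-1"] by auto
  have "s\<^sup>2 \<noteq> 1"
  proof
    assume "s\<^sup>2 = 1"
    then have "s ^ 4 = 1" by (metis mult_2 numeral_Bit0 power_add power_one mult_1)
    with s one_ne_minus_one show False by simp
  qed
  moreover have "s \<noteq> 0" using s by auto
  ultimately show ?thesis using s one_ne_minus_one by metis
qed

lemma exists_sqrt: "\<exists>s::'k. s\<^sup>2 = c"
  using nth_root_exists[of 2 c] by auto

lemma m_minus: assumes "\<alpha> \<in> B_roots n" shows "m \<alpha> (- c) = inv (m \<alpha> c)"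
  using assms by (simp add: m_def x_minus word_simps)

lemma h_eq: "\<alpha> \<in> B_roots n \<Longrightarrow> h \<alpha> c = m \<alpha> c \<otimes> inv (m \<alpha> 1)"
  by (simp add: h_def m_minus)

lemma m_eq: "\<alpha> \<in> B_roots n \<Longrightarrow> m \<alpha> c = h \<alpha> c \<otimes> m \<alpha> 1"
  by (simp add: h_eq word_simps)

lemma h_one [simp]: "\<alpha> \<in> B_roots n \<Longrightarrow> h \<alpha> 1 = \<one>"
  by (simp add: h_eq)

lemma h_inverse:
  assumes "\<alpha> \<in> B_roots n" "c \<noteq> 0"
  shows "h \<alpha> (inverse c) = inv (h \<alpha> c)"
proof -
  have "h \<alpha> (inverse c) \<otimes> h \<alpha> c = \<one>"
    using assms h_mult[of \<alpha> "inverse c" c] by simp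
  then show ?thesis using assms by (simp add: inv_equality)
qed

lemma h_minus_one_square: "\<alpha> \<in> B_roots n \<Longrightarrow> h \<alpha> (- 1) \<otimes> h \<alpha> (- 1) = \<one>"
  using h_mult[of \<alpha> "-1" "-1"] by simp

text \<open>By definition \<open>h \<alpha> (- 1)\<close> is the inverse of this square, since
  \<open>m \<alpha> (- 1)\<close> inverts \<open>m \<alpha> 1\<close>; and it is its own
  inverse.\<close>

lemma m_square: assumes "\<alpha> \<in> B_roots n" shows "m \<alpha> 1 \<otimes> m \<alpha> 1 = h \<alpha> (- 1)"
proof -
  have "h \<alpha> (- 1) = inv (m \<alpha> 1 \<otimes> m \<alpha> 1)"
    using assms by (simp add: h_eq m_minus word_simps)
  moreover have "inv (h \<alpha> (- 1)) = h \<alpha> (- 1)"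
    using h_minus_one_square[OF assms] assms by (simp add: inv_equality)
  ultimately show ?thesis using assms by (metis inv_inv m_closed Group.monoid.m_closed is_monoid)
qed

lemma cj_h_m:
  assumes "\<alpha> \<in> B_roots n" "\<beta> \<in> B_roots n" "b \<noteq> 0"
  shows "cj (h \<alpha> b) (m \<beta> c) = m \<beta> (b powi cartan \<beta> \<alpha> * c)"
proof -
  have "cartan (- \<beta>) \<alpha> = - cartan \<beta> \<alpha>"
    using cartan_add(3)[OF assms(1) _ B_roots_carrier[OF assms(2)]] B_roots_carrier[OF assms(2)]
        by blast
  then show ?thesis using assms
    by (simp add: m_def cj_mult cj_h_x power_int_minus mult.commute power_int_inverse)
qed

text \<open>Conjugation scales both factors \<open>m\<close> of \<open>h \<beta> c\<close> by the
  same number, which amounts to conjugating \<open>h \<beta> c\<close> by another value of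
  \<open>h \<beta>\<close>. These values commute because \<open>h \<beta>\<close> is
  multiplicative.\<close>

lemma cj_h_h:
  assumes "\<alpha> \<in> B_roots n" "\<beta> \<in> B_roots n" "b \<noteq> 0" "c \<noteq> 0"
  shows "cj (h \<alpha> b) (h \<beta> c) = h \<beta> c"
proof -
  let ?k = "b powi cartan \<beta> \<alpha>"
  have k: "?k \<noteq> 0" using assms by simp
  have "cj (h \<alpha> b) (h \<beta> c) = m \<beta> (?k * c) \<otimes> inv (m \<beta> ?k)"
    using assms by (simp add: h_eq[of \<beta>] cj_mult cj_inv cj_h_m)
  also have "\<dots> = h \<beta> ?k \<otimes> h \<beta> c \<otimes> inv (h \<beta> ?k)"
    using assms k by (simp add: m_eq[of \<beta> "?k * c"] m_eq[of \<beta> ?k] h_mult word_simps)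
  also have "h \<beta> ?k \<otimes> h \<beta> c = h \<beta> c \<otimes> h \<beta> ?k"
    using h_mult[OF assms(2) k assms(4)] h_mult[OF assms(2) assms(4) k] by (simp add: mult.commute)
  finally show ?thesis using assms by (simp add: word_simps)
qed

text \<open>A common element commutes with both root subgroups, hence with
  \<open>h \<gamma> s\<close>, which however multiplies its parameter by the square of
  \<open>s\<close>.\<close>

lemma opposite_root_subgroups_disjoint:
  assumes g: "\<gamma> \<in> B_roots n" and eq: "x \<gamma> p = x (- \<gamma>) q"
  shows "p = 0"
proof -
  have g': "- \<gamma> \<in> B_roots n" using g by simp
  obtain s :: 'k where s: "s \<noteq> 0" "s\<^sup>2 \<noteq> 1" using exists_scalar by blast
  have ab: "cj (x \<delta> a) (x \<delta> b) = x \<delta> b" if "\<delta> \<in> B_roots n" for \<delta> a b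
    using that x_add[OF that, of a b] x_add[OF that, of b a] by (simp add: cj_fixed_iff add.commute)
  have "cj (x \<gamma> a) (x \<gamma> p) = x \<gamma> p" "cj (x (- \<gamma>) a) (x \<gamma> p) = x \<gamma> p" for a
    using ab[OF g] ab[OF g'] unfolding eq[symmetric] by (blast, metis eq)
  then have "cj (m \<gamma> a) (x \<gamma> p) = x \<gamma> p" for a
    using g g' by (simp add: m_def cj_cj)
  then have "cj (h \<gamma> s) (x \<gamma> p) = x \<gamma> p"
    using g by (simp add: h_def cj_cj)
  moreover have "cj (h \<gamma> s) (x \<gamma> p) = x \<gamma> (s\<^sup>2 * p)"
    using cj_h_x[OF g g s(1)] cartan_self[OF g] by (simp add: power_int_def)
  ultimately have "s\<^sup>2 * p = p" using x_inj[OF g] by metis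
  with s show ?thesis by simp
qed

lemma cj_m_x:
  assumes "\<alpha> \<in> B_roots n" "\<beta> \<in> B_roots n"
  obtains \<epsilon> where "\<epsilon> = 1 \<or> \<epsilon> = - 1" "\<And>c. cj (m \<alpha> 1) (x \<beta> c) = x (reflect \<alpha> \<beta>) (\<epsilon> * c)"
proof -
  obtain \<epsilon> where "\<epsilon> \<in> {1, - 1}" "\<forall>c. m \<alpha> 1 \<otimes> x \<beta> c \<otimes> inv (m \<alpha> 1) = x (reflect \<alpha> \<beta>) (\<epsilon> * c)"
    using m_x[OF assms] by blast
  then show thesis using that[of \<epsilon>] by (simp add: cj_def)
qed

text \<open>What matters later is that both scalars are invertible; they are signs times powers of
  \<open>c\<close>.\<close>

lemma m_swaps:
  assumes g: "\<gamma> \<in> B_roots n" and c: "c \<noteq> 0"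
  obtains a b where "a \<noteq> 0" "b \<noteq> 0" "\<And>d. cj (m \<gamma> c) (x \<gamma> d) = x (- \<gamma>) (a * d)"
    "\<And>d. cj (m \<gamma> c) (x (- \<gamma>) d) = x \<gamma> (b * d)"
proof -
  have g': "- \<gamma> \<in> B_roots n" using g by simp
  have r: "reflect \<gamma> \<gamma> = - \<gamma>" "reflect \<gamma> (- \<gamma>) = \<gamma>"
    using reflect_self[OF g] reflect_add(3)[OF g _ B_roots_carrier[OF g]] B_roots_carrier[OF g]
        by auto
  obtain \<epsilon> where e: "\<epsilon> = 1 \<or> \<epsilon> = - 1" "\<And>c. cj (m \<gamma> 1) (x \<gamma> c) = x (- \<gamma>) (\<epsilon> * c)"
    using cj_m_x[OF g g] r by metis
  obtain \<epsilon>' where e': "\<epsilon>' = 1 \<or> \<epsilon>' = - 1" "\<And>c. cj (m \<gamma> 1) (x (- \<gamma>) c) = x \<gamma> (\<epsilon>' * c)"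
    using cj_m_x[OF g g'] r by metis
  have "cj (m \<gamma> c) (x \<gamma> b) = x (- \<gamma>) (c powi cartan (- \<gamma>) \<gamma> * \<epsilon> * b)" for b
    using g g' c by (simp add: m_eq[of \<gamma> c] cj_cj e cj_h_x mult.assoc)
  moreover have "cj (m \<gamma> c) (x (- \<gamma>) b) = x \<gamma> (c powi cartan \<gamma> \<gamma> * \<epsilon>' * b)" for b
    using g g' c by (simp add: m_eq[of \<gamma> c] cj_cj e' cj_h_x mult.assoc)
  ultimately show thesis using c e(1) e'(1)
    by (intro that[of "c powi cartan (- \<gamma>) \<gamma> * \<epsilon>" "c powi cartan \<gamma> \<gamma> * \<epsilon>'"]) auto
qed

text \<open>If the two signs differed, the images under \<open>m\<^sub>\<alpha>(1)\<close> of the elements \<open>m\<^sub>\<beta>(c)\<close> would force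
  the opposite root subgroups of \<open>s\<^sub>\<alpha> \<beta>\<close> to commute.\<close>

lemma cj_m_x_opposite:
  assumes a: "\<alpha> \<in> B_roots n" and b: "\<beta> \<in> B_roots n"
  obtains \<epsilon> where "\<epsilon> = 1 \<or> \<epsilon> = - 1" "\<And>c. cj (m \<alpha> 1) (x \<beta> c) = x (reflect \<alpha> \<beta>) (\<epsilon> * c)"
    "\<And>c. cj (m \<alpha> 1) (x (- \<beta>) c) = x (- reflect \<alpha> \<beta>) (\<epsilon> * c)"
proof -
  define \<gamma> where "\<gamma> = reflect \<alpha> \<beta>"
  have g: "\<gamma> \<in> B_roots n" using a b by (simp add: \<gamma>_def reflect_root)
  have g': "- \<gamma> \<in> B_roots n" and b': "- \<beta> \<in> B_roots n" using g b by simp_all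
  have r': "reflect \<alpha> (- \<beta>) = - \<gamma>"
    using reflect_add(3)[OF a _ B_roots_carrier[OF b]] B_roots_carrier[OF b] by (auto simp: \<gamma>_def)
  obtain \<epsilon> where e: "\<epsilon> = 1 \<or> \<epsilon> = - 1" "\<And>c. cj (m \<alpha> 1) (x \<beta> c) = x \<gamma> (\<epsilon> * c)"
    using cj_m_x[OF a b] \<gamma>_def by metis
  obtain \<epsilon>' where e': "\<epsilon>' = 1 \<or> \<epsilon>' = - 1" "\<And>c. cj (m \<alpha> 1) (x (- \<beta>) c) = x (- \<gamma>) (\<epsilon>' * c)"
    using cj_m_x[OF a b'] r' by metis
  have "\<epsilon>' = \<epsilon>"
  proof (rule ccontr)
    assume ne: "\<epsilon>' \<noteq> \<epsilon>"
    then have en: "\<epsilon>' = - \<epsilon>" "\<epsilon> * \<epsilon> = 1" "inverse \<epsilon> = \<epsilon>" "\<epsilon> \<noteq> 0" using e(1) e'(1) by auto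
    \<comment> \<open>With opposite signs, \<open>X\<close> is the word for
      \<open>m \<gamma> 1\<close> with the sign of its middle factor reversed, and it still carries
      the root subgroup of \<open>- \<gamma>\<close> to that of \<open>\<gamma>\<close>.\<close>
    define X where "X = cj (m \<alpha> 1) (m \<beta> \<epsilon>)"
    define M where "M = m \<gamma> 1"
    have Xc: "X \<in> carrier \<G>" and Mc: "M \<in> carrier \<G>" using a b g by (auto simp: X_def M_def)
    have X: "X = x \<gamma> 1 \<otimes> x (- \<gamma>) 1 \<otimes> x \<gamma> 1"
      using a b b' en by (simp add: X_def m_def[of \<beta>] cj_mult e(2) e'(2))
    have M: "M = x \<gamma> 1 \<otimes> inv (x (- \<gamma>) 1) \<otimes> x \<gamma> 1"
      using g' by (simp add: M_def m_def x_minus)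
    obtain u u' where u: "u \<noteq> 0" "u' \<noteq> 0" "\<And>c. cj (m \<beta> \<epsilon>) (x \<beta> c) = x (- \<beta>) (u * c)"
      "\<And>c. cj (m \<beta> \<epsilon>) (x (- \<beta>) c) = x \<beta> (u' * c)"
      by (rule m_swaps[OF b en(4)]) (rule that)
    have X_cj: "cj X (cj (m \<alpha> 1) y) = cj (m \<alpha> 1) (cj (m \<beta> \<epsilon>) y)" if "y \<in> carrier \<G>" for y
      using a b that by (simp add: X_def cj_def word_simps)
    have e'': "x (- \<gamma>) c = cj (m \<alpha> 1) (x (- \<beta>) (\<epsilon>' * c))" for c
      using e' by (auto simp: mult.assoc[symmetric])
    have XU: "cj X (x (- \<gamma>) c) = x \<gamma> (\<epsilon> * u' * \<epsilon>' * c)" for c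
      by (simp add: e'' X_cj[OF x_closed[OF b']] u e mult.assoc)
    obtain v v' where v: "v \<noteq> 0" "v' \<noteq> 0" "\<And>c. cj M (x \<gamma> c) = x (- \<gamma>) (v * c)"
      "\<And>c. cj M (x (- \<gamma>) c) = x \<gamma> (v' * c)"
      using m_swaps[OF g, of 1] by (auto simp: M_def)
    define y where "y = 2 / v'"
    have y: "y \<noteq> 0" using v(2) two by (auto simp: y_def)
    have Mi: "cj M (x (- \<gamma>) (- y)) = x \<gamma> (- 2)"
      using v(2) by (auto simp: v(4) y_def)
    have two_g: "x \<gamma> (- 2) = inv (x \<gamma> 1) \<otimes> inv (x \<gamma> 1)"
      using x_add[OF g, of "- 1" "- 1"] x_minus[OF g, of 1] by simp
    \<comment> \<open>The factor \<open>x \<gamma> (- 2)\<close> absorbs the inner ends of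
      \<open>X\<close> and \<open>M\<close>, whose middle factors then cancel. Moving it across
      \<open>M\<close> instead gives
      \<open>X \<otimes> M = x \<gamma> 2 \<otimes> x (- \<gamma>) y\<close> with \<open>y\<close>
      nonzero, as 2 is.\<close>
    have "X \<otimes> x \<gamma> (- 2) \<otimes> M = x \<gamma> 1 \<otimes> x \<gamma> 1"
      using g g' by (simp add: X M two_g word_simps)
    moreover have "X \<otimes> x \<gamma> (- 2) \<otimes> M = X \<otimes> M \<otimes> x (- \<gamma>) (- y)"
      using g' Xc Mc by (simp add: Mi[symmetric] cj_def word_simps)
    ultimately have x2: "x \<gamma> 2 = X \<otimes> M \<otimes> inv (x (- \<gamma>) y)"
      using g' x_add[OF g, of 1 1] by (simp add: x_minus)
    have XM: "X \<otimes> M = x \<gamma> 2 \<otimes> x (- \<gamma>) y"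
      unfolding x2 using g' Xc Mc by (simp add: m_assoc)
    have comm: "cj (x \<gamma> a) (x \<gamma> b) = x \<gamma> b" for a b
      using g x_add[OF g, of a b] x_add[OF g, of b a] by (simp add: cj_fixed_iff add.commute)
    \<comment> \<open>\<open>M\<close> takes the root subgroup of \<open>\<gamma>\<close> to the
      opposite one and \<open>X\<close> takes it back, so the product normalises it; so does
      \<open>x \<gamma> 2\<close>, hence also the remaining factor
      \<open>x (- \<gamma>) y\<close>.\<close>
    have stab: "\<exists>c'. cj (x (- \<gamma>) y) (x \<gamma> c) = x \<gamma> c'" for c
    proof -
      have "cj (x (- \<gamma>) y) (x \<gamma> c) = cj (inv (x \<gamma> 2)) (cj (X \<otimes> M) (x \<gamma> c))"
        using g g' by (simp add: XM cj_cj)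
      also have "cj (X \<otimes> M) (x \<gamma> c) = cj X (cj M (x \<gamma> c))"
        using g Xc Mc by (simp add: cj_cj)
      also have "\<dots> = x \<gamma> (\<epsilon> * u' * \<epsilon>' * (v * c))" by (simp add: v XU)
      finally show ?thesis using cj_fixed_inv[OF x_closed[OF g] x_closed[OF g] comm] by auto
    qed
    have stab1: "\<exists>c'. cj (x (- \<gamma>) b) (x \<gamma> c) = x \<gamma> c'" for b c
    proof (cases "b = 0")
      case True then show ?thesis using g g' by auto
    next
      case False
      \<comment> \<open>Conjugation by \<open>h \<gamma> s\<close> scales the opposite root subgroup
        by s^(-2), so a square root spreads the property from \<open>y\<close> to every nonzero
        \<open>b\<close>.\<close>
      obtain s where s: "s\<^sup>2 = y / b" using exists_sqrt by blast
      then have s0: "s \<noteq> 0" using False y by auto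
      have k: "cartan (- \<gamma>) \<gamma> = - 2" "cartan \<gamma> \<gamma> = 2"
        using g cartan_add(3)[OF g _ B_roots_carrier[OF g], of "0\<^sub>v n"] cartan_self[OF g] by auto
      have "inverse (s\<^sup>2) * y = b" using s y by simp
      then have "cj (h \<gamma> s) (x (- \<gamma>) y) = x (- \<gamma>) b"
        using g g' s0 by (simp add: cj_h_x k power_int_minus)
      moreover obtain c0 where c0: "x \<gamma> c = cj (h \<gamma> s) (x \<gamma> c0)"
        using g s0 by (auto simp: cj_h_x k intro: that[of "c / s\<^sup>2"])
      ultimately have "cj (x (- \<gamma>) b) (x \<gamma> c) = cj (h \<gamma> s) (cj (x (- \<gamma>) y) (x \<gamma> c0))"
        using g g' by (simp add: cj_def word_simps flip: \<open>cj (h \<gamma> s) (x (- \<gamma>) y) = x (- \<gamma>) b\<close>)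
      then show ?thesis using stab[of c0] g s0 by (auto simp: cj_h_x)
    qed
    have stab2: "\<exists>c'. cj (x \<gamma> b) (x (- \<gamma>) c) = x (- \<gamma>) c'" for b c
    proof -
      have "x \<gamma> b = cj M (x (- \<gamma>) (b / v'))" "x (- \<gamma>) c = cj M (x \<gamma> (c / v))" using v by auto
      then have "cj (x \<gamma> b) (x (- \<gamma>) c) = cj M (cj (x (- \<gamma>) (b / v')) (x \<gamma> (c / v)))"
        using g g' Mc by (simp add: cj_def word_simps)
      then show ?thesis using stab1[of "b / v'" "c / v"] v by auto
    qed
    \<comment> \<open>The two opposite root subgroups now normalise each other, so their commutators
      lie in the trivial intersection. Then \<open>M\<close> would centralise
      \<open>x \<gamma> 1\<close> instead of moving it to the opposite subgroup.\<close>
    have fixed: "cj (x \<gamma> 1) (x (- \<gamma>) b) = x (- \<gamma>) b" for b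
    proof -
      obtain c1 where c1: "cj (x \<gamma> 1) (x (- \<gamma>) b) = x (- \<gamma>) c1" using stab2 by blast
      obtain c2 where c2: "cj (x (- \<gamma>) b) (x \<gamma> (- 1)) = x \<gamma> c2" using stab1 by blast
      have "x \<gamma> (1 + c2) = x \<gamma> 1 \<otimes> cj (x (- \<gamma>) b) (x \<gamma> (- 1))"
        using x_add[OF g] c2 by simp
      also have "\<dots> = cj (x \<gamma> 1) (x (- \<gamma>) b) \<otimes> x (- \<gamma>) (- b)"
        using g g' by (simp add: cj_def word_simps x_minus)
      also have "\<dots> = x (- \<gamma>) (c1 + - b)" by (simp only: c1 x_add[OF g'])
      finally have eq: "x \<gamma> (1 + c2) = x (- \<gamma>) (c1 + - b)" .
      then have "1 + c2 = 0" using opposite_root_subgroups_disjoint[OF g] by blast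
      then have "x (- \<gamma>) (c1 + - b) = \<one>" using eq g by simp
      then have "c1 = b" using x_eq_one_iff[OF g'] by simp
      with c1 show ?thesis by simp
    qed
    have "cj (x (- \<gamma>) b) (x \<gamma> 1) = x \<gamma> 1" for b
      by (rule cj_fixed_sym[OF x_closed[OF g] x_closed[OF g'] fixed])
    then have "cj M (x \<gamma> 1) = x \<gamma> 1"
      using g g' comm[of 1 1] by (simp add: M_def m_def cj_cj)
    then have "x \<gamma> 1 = x (- \<gamma>) (v * 1)" by (simp only: v(3))
    then show False using opposite_root_subgroups_disjoint[OF g] zero_neq_one by metis
  qed
  with e e' that show thesis by (auto simp: \<gamma>_def)
qed

text \<open>The middle factor of \<open>m\<close> needs the inverse scalar, and a sign is its own
  inverse; so equal signs on opposite root subgroups carry the whole word to a value of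
  \<open>m\<close>.\<close>

lemma m_m:
  assumes a: "\<alpha> \<in> B_roots n" and b: "\<beta> \<in> B_roots n"
  obtains \<epsilon> where "\<epsilon> = 1 \<or> \<epsilon> = - 1" "\<And>c. cj (m \<alpha> 1) (m \<beta> c) = m (reflect \<alpha> \<beta>) (\<epsilon> * c)"
proof -
  obtain \<epsilon> where e: "\<epsilon> = 1 \<or> \<epsilon> = - 1" "\<And>c. cj (m \<alpha> 1) (x \<beta> c) = x (reflect \<alpha> \<beta>) (\<epsilon> * c)"
    "\<And>c. cj (m \<alpha> 1) (x (- \<beta>) c) = x (- reflect \<alpha> \<beta>) (\<epsilon> * c)"
    by (rule cj_m_x_opposite[OF a b]) (rule that)
  have "inverse \<epsilon> = \<epsilon>" using e(1) by auto
  then have "cj (m \<alpha> 1) (m \<beta> c) = m (reflect \<alpha> \<beta>) (\<epsilon> * c)" for c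
    using a b by (simp add: m_def[of _ c] m_def[of _ "\<epsilon> * c"] cj_mult e mult.commute)
  with e(1) that show thesis by blast
qed

text \<open>\<open>m \<alpha> 1\<close> commutes with itself, while by \<open>m_m\<close>
  conjugation by it leads to the opposite root.\<close>

lemma m_opposite:
  assumes "\<alpha> \<in> B_roots n"
  obtains \<epsilon> where "\<epsilon> = 1 \<or> \<epsilon> = - 1" "m \<alpha> 1 = m (- \<alpha>) \<epsilon>"
proof -
  obtain \<epsilon> where e: "\<epsilon> = 1 \<or> \<epsilon> = - 1" "\<And>c. cj (m \<alpha> 1) (m \<alpha> c) = m (- \<alpha>) (\<epsilon> * c)"
    using m_m[OF assms assms] reflect_self[OF assms] by metis
  have "cj (m \<alpha> 1) (m \<alpha> 1) = m \<alpha> 1"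
    using assms by (simp add: cj_fixed_iff)
  with e(2)[of 1] e(1) that show thesis by auto
qed

text \<open>Scalars may appear, but they are inverse to each other on opposite roots: exactly the
  condition for \<open>m \<beta> c\<close> to go to \<open>m (w \<beta>) (\<eta> * c)\<close> with
  the same \<open>\<eta>\<close>.\<close>

definition x_equivariant :: "'a \<Rightarrow> (int vec \<Rightarrow> int vec) \<Rightarrow> bool" where
  "x_equivariant g w \<longleftrightarrow> g \<in> carrier \<G> \<and> (\<forall>\<beta> \<in> B_roots n. w \<beta> \<in> B_roots n \<and> (\<exists>\<eta>. \<eta> \<noteq> 0 \<and> (\<forall>c.
     cj g (x \<beta> c) = x (w \<beta>) (\<eta> * c) \<and> cj g (x (- \<beta>) c) = x (- w \<beta>) (inverse \<eta> * c))))"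

lemma x_equivariant_one: "x_equivariant \<one> (\<lambda>v. v)"
  by (auto simp: x_equivariant_def intro!: exI[of _ 1])

lemma x_equivariant_mult:
  assumes "x_equivariant g v" "x_equivariant k w"
  shows "x_equivariant (g \<otimes> k) (\<lambda>u. v (w u))"
  unfolding x_equivariant_def
proof (intro conjI ballI)
  show "g \<otimes> k \<in> carrier \<G>" using assms by (simp add: x_equivariant_def)
next
  fix \<beta> assume b: "\<beta> \<in> B_roots n"
  then obtain \<eta> where e: "w \<beta> \<in> B_roots n" "\<eta> \<noteq> 0" "\<And>c. cj k (x \<beta> c) = x (w \<beta>) (\<eta> * c)"
     "\<And>c. cj k (x (- \<beta>) c) = x (- w \<beta>) (inverse \<eta> * c)"
    using assms(2) by (auto simp: x_equivariant_def)
  then obtain \<zeta> where z: "v (w \<beta>) \<in> B_roots n" "\<zeta> \<noteq> 0" "\<And>c. cj g (x (w \<beta>) c) = x (v (w \<beta>)) (\<zeta> * c)"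
     "\<And>c. cj g (x (- w \<beta>) c) = x (- v (w \<beta>)) (inverse \<zeta> * c)"
    using assms(1) unfolding x_equivariant_def by metis
  show "v (w \<beta>) \<in> B_roots n" using z by simp
  show "\<exists>\<eta>. \<eta> \<noteq> 0 \<and> (\<forall>c. cj (g \<otimes> k) (x \<beta> c) = x (v (w \<beta>)) (\<eta> * c) \<and>
     cj (g \<otimes> k) (x (- \<beta>) c) = x (- v (w \<beta>)) (inverse \<eta> * c))"
    using assms b e z by (intro exI[of _ "\<zeta> * \<eta>"]) (auto simp: x_equivariant_def cj_cj mult.assoc)
qed

lemma x_equivariant_m:
  assumes a: "\<alpha> \<in> B_roots n" and c: "c \<noteq> 0"
  shows "x_equivariant (m \<alpha> c) (reflect \<alpha>)"
  unfolding x_equivariant_def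
proof (intro conjI ballI)
  show "m \<alpha> c \<in> carrier \<G>" using a by simp
next
  fix \<beta> assume b: "\<beta> \<in> B_roots n"
  show r: "reflect \<alpha> \<beta> \<in> B_roots n" using a b by (rule reflect_root)
  obtain \<epsilon> where e: "\<epsilon> = 1 \<or> \<epsilon> = - 1" "\<And>c. cj (m \<alpha> 1) (x \<beta> c) = x (reflect \<alpha> \<beta>) (\<epsilon> * c)"
    "\<And>c. cj (m \<alpha> 1) (x (- \<beta>) c) = x (- reflect \<alpha> \<beta>) (\<epsilon> * c)"
    by (rule cj_m_x_opposite[OF a b]) (rule that)
  have ie: "inverse \<epsilon> = \<epsilon>" "\<epsilon> \<noteq> 0" using e(1) by auto
  have k: "cartan (- reflect \<alpha> \<beta>) \<alpha> = - cartan (reflect \<alpha> \<beta>) \<alpha>"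
    using cartan_add(3)[OF a _ B_roots_carrier[OF r]] B_roots_carrier[OF r] by blast
  show "\<exists>\<eta>. \<eta> \<noteq> 0 \<and> (\<forall>d. cj (m \<alpha> c) (x \<beta> d) = x (reflect \<alpha> \<beta>) (\<eta> * d) \<and>
     cj (m \<alpha> c) (x (- \<beta>) d) = x (- reflect \<alpha> \<beta>) (inverse \<eta> * d))"
    using a b c ie r
    by (intro exI[of _ "c powi cartan (reflect \<alpha> \<beta>) \<alpha> * \<epsilon>"])
       (auto simp: m_eq[of \<alpha> c] cj_cj e cj_h_x k power_int_minus mult.assoc)
qed

lemma x_equivariant_cj_m:
  assumes "x_equivariant g w" "\<beta> \<in> B_roots n"
  obtains \<eta> where "\<eta> \<noteq> 0" "\<And>c. cj g (m \<beta> c) = m (w \<beta>) (\<eta> * c)"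
proof -
  obtain \<eta> where e: "\<eta> \<noteq> 0" "\<And>c. cj g (x \<beta> c) = x (w \<beta>) (\<eta> * c)"
     "\<And>c. cj g (x (- \<beta>) c) = x (- w \<beta>) (inverse \<eta> * c)" "g \<in> carrier \<G>"
    using assms by (auto simp: x_equivariant_def)
  have "cj g (m \<beta> c) = m (w \<beta>) (\<eta> * c)" for c
    using assms(2) e by (simp add: m_def cj_mult)
  with e that show thesis by blast
qed

text \<open>The unknown scalar of \<open>m\<close> disappears for \<open>h\<close>: it enters as
  conjugation by \<open>h (w \<beta>) \<eta>\<close>, which is trivial by
  \<open>cj_h_h\<close>.\<close>

lemma x_equivariant_cj_h:
  assumes "x_equivariant g w" "\<beta> \<in> B_roots n" "c \<noteq> 0"
  shows "cj g (h \<beta> c) = h (w \<beta>) c"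
proof -
  obtain \<eta> where e: "\<eta> \<noteq> 0" "\<And>c. cj g (m \<beta> c) = m (w \<beta>) (\<eta> * c)"
    by (rule x_equivariant_cj_m[OF assms(1,2)]) (rule that)
  have w: "w \<beta> \<in> B_roots n" and g: "g \<in> carrier \<G>" using assms by (auto simp: x_equivariant_def)
  have "cj g (h \<beta> c) = m (w \<beta>) (\<eta> * c) \<otimes> inv (m (w \<beta>) \<eta>)"
    using assms g e by (simp add: h_eq cj_mult cj_inv)
  also have "\<dots> = h (w \<beta>) \<eta> \<otimes> h (w \<beta>) c \<otimes> inv (h (w \<beta>) \<eta>)"
    using w e assms by (simp add: m_eq[of _ "\<eta> * c"] m_eq[of _ \<eta>] h_mult word_simps)
  also have "\<dots> = h (w \<beta>) c"
    using cj_h_h[OF w w e(1) assms(3)] by (simp add: cj_def)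
  finally show ?thesis .
qed

text \<open>The coroot of s_\<alpha>(\<beta>) is that of \<beta> minus
  \<open>cartan \<alpha> \<beta>\<close> times that of \<alpha>; this is the multiplicative form. It
  comes from moving \<open>h \<beta> c\<close> past \<open>m \<alpha> 1\<close>, which rescales the
  argument of \<open>m \<alpha>\<close>.\<close>

lemma h_reflect:
  assumes a: "\<alpha> \<in> B_roots n" and b: "\<beta> \<in> B_roots n" and c: "c \<noteq> 0"
  shows "h (reflect \<alpha> \<beta>) c = h \<beta> c \<otimes> h \<alpha> (c powi (- cartan \<alpha> \<beta>))"
proof -
  have "h (reflect \<alpha> \<beta>) c = cj (m \<alpha> 1) (h \<beta> c)"
    using x_equivariant_cj_h[OF x_equivariant_m[OF a] b c, of 1] by simp
  also have "\<dots> = h \<beta> c \<otimes> cj (inv (h \<beta> c)) (m \<alpha> 1) \<otimes> inv (m \<alpha> 1)"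
    using a b by (simp add: cj_def word_simps)
  also have "cj (inv (h \<beta> c)) (m \<alpha> 1) = m \<alpha> (c powi (- cartan \<alpha> \<beta>))"
    using a b c by (simp add: h_inverse[symmetric] cj_h_m power_int_minus power_int_inverse)
  finally show ?thesis using a b by (simp add: h_eq[of \<alpha>] m_assoc)
qed

lemma h_uminus:
  assumes b: "\<beta> \<in> B_roots n" and c: "c \<noteq> 0"
  shows "h (- \<beta>) c = inv (h \<beta> c)"
proof -
  have "h (- \<beta>) c = h \<beta> (c * c powi (- 2))"
    using h_reflect[OF b b c] reflect_self[OF b] cartan_self[OF b] b c by (simp add: h_mult)
  also have "c * c powi (- 2) = inverse c"
    using c by (simp add: power_int_minus power2_eq_square field_simps)
  finally show ?thesis using b c by (simp add: h_inverse)
qed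

text \<open>The coroot of the long root u + v is half the sum of the coroots 2u and 2v, hence the
  square on the left. It follows from \<open>h_reflect\<close>, as the reflection in u + v takes u
  to -v.\<close>

lemma h_short_sum:
  assumes u: "short n u" and v: "short n v" and o: "u \<bullet> v = 0" and s: "s \<noteq> 0"
  shows "h (u + v) (s\<^sup>2) = h u s \<otimes> h v s"
proof -
  have r: "u \<in> B_roots n" "v \<in> B_roots n" "u + v \<in> B_roots n"
    using assms long_sum by (auto simp: B_roots_iff)
  have "cartan (u + v) u = 2"
    using u v o by (simp add: cartan_short short_def add_scalar_prod_distrib[of _ n]
        comm_scalar_prod[of v n u])
  then have "inv (h v s) = h u s \<otimes> inv (h (u + v) (s\<^sup>2))"
    using h_reflect[OF r(3) r(1) s] reflect_diff_short(3)[OF u v o] r s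
    by (simp add: h_uminus power_int_minus flip: h_inverse)
  then have "inv (h v s) \<otimes> h (u + v) (s\<^sup>2) = h u s"
    using r by (simp add: m_assoc)
  then have "h (u + v) (s\<^sup>2) = h v s \<otimes> h u s"
    using r by (metis cancel_left(2) h_closed inv_closed m_closed)
  also have "\<dots> = h u s \<otimes> h v s"
    using cj_h_h[OF r(2) r(1) s s] r by (simp add: cj_fixed_iff)
  finally show ?thesis .
qed

end

section \<open>Signs for orthogonal roots\<close>

context chevalley_group
begin

text \<open>Under these inequalities \<alpha> + \<beta>, \<alpha> + 2\<beta> and 2\<alpha> + \<beta>
  all have norm above 2, so every factor of the commutator formula is trivial.\<close>

lemma x_commute:
  assumes a: "\<alpha> \<in> B_roots n" and b: "\<beta> \<in> B_roots n"
    and nn: "\<alpha> \<bullet> \<beta> \<ge> 0" and big: "\<alpha> \<bullet> \<alpha> + 2 * (\<alpha> \<bullet> \<beta>) + \<beta> \<bullet> \<beta> > 2"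
  shows "cj (x \<alpha> c) (x \<beta> d) = x \<beta> d"
proof (cases "\<beta> = \<alpha>")
  case True
  then show ?thesis using a x_add[OF a, of c d] x_add[OF a, of d c]
    by (simp add: cj_fixed_iff add.commute)
next
  case False
  note ca = B_roots_carrier[OF a] B_roots_carrier[OF b]
  note dist = add_scalar_prod_distrib[of _ n] scalar_prod_add_distrib[of _ n]
  have pos: "\<alpha> \<bullet> \<alpha> > 0" "\<beta> \<bullet> \<beta> > 0" using a b by (auto simp: B_roots_def)
  have sym: "\<beta> \<bullet> \<alpha> = \<alpha> \<bullet> \<beta>" using ca by (simp add: comm_scalar_prod[of \<beta> n \<alpha>])
  have "\<beta> \<noteq> - \<alpha>"
    using nn pos ca by (auto simp: uminus_vec_scalar[of _ n])
  moreover have "\<alpha> + \<beta> \<notin> B_roots n" "\<alpha> + 2 \<cdot>\<^sub>v \<beta> \<notin> B_roots n" "2 \<cdot>\<^sub>v \<alpha> + \<beta> \<notin> B_roots n"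
    using big nn pos ca by (auto simp: B_roots_def dist sym)
  ultimately have "x \<alpha> c \<otimes> x \<beta> d \<otimes> inv (x \<alpha> c) \<otimes> inv (x \<beta> d) = \<one>"
    using x_commutator[OF a b False] by (auto simp: x_or_one_def)
  then have "inv (inv (x \<beta> d)) = x \<alpha> c \<otimes> x \<beta> d \<otimes> inv (x \<alpha> c)"
    using a b by (intro inv_equality) auto
  then show ?thesis using b by (simp add: cj_def)
qed

lemma short_long_facts:
  assumes u: "short n u" and v: "short n v" and o: "u \<bullet> v = 0"
  shows "u \<in> carrier_vec n" "v \<in> carrier_vec n" "u \<in> B_roots n" "v \<in> B_roots n"
    "u + v \<in> B_roots n" "u - v \<in> B_roots n" "v + u \<in> B_roots n" "v - u \<in> B_roots n"
    "u \<bullet> u = 1" "v \<bullet> v = 1" "v \<bullet> u = 0"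
proof -
  show c: "u \<in> carrier_vec n" "v \<in> carrier_vec n" "u \<bullet> u = 1" "v \<bullet> v = 1"
    using u v by (auto simp: short_def)
  show o': "v \<bullet> u = 0" using c o by (simp add: comm_scalar_prod[of v n u])
  show "u \<in> B_roots n" "v \<in> B_roots n" using u v by (auto simp: B_roots_iff)
  show "u + v \<in> B_roots n" "u - v \<in> B_roots n" "v + u \<in> B_roots n" "v - u \<in> B_roots n"
    using long_sum[OF u v o] long_sum[OF v u o'] by (auto simp: B_roots_iff)
qed

lemma short_multiple_root_iff:
  assumes u: "short n u" and v: "short n v" and o: "u \<bullet> v = 0"
  shows "v - int r \<cdot>\<^sub>v u \<in> B_roots n \<longleftrightarrow> r \<le> 1"
proof -
  note f = short_long_facts[OF assms]
  have "(v - int r \<cdot>\<^sub>v u) \<bullet> (v - int r \<cdot>\<^sub>v u) = 1 + int r * int r"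
    using f o by (simp add: minus_scalar_prod_distrib[of _ n] scalar_prod_minus_distrib[of _ n])
  moreover have "int r * int r \<ge> 4" if "r \<ge> 2"
    using that mult_mono[of 2 "int r" 2 "int r"] by simp
  moreover have "r = 0 \<or> r = 1 \<or> r \<ge> 2" by linarith
  ultimately show ?thesis using f by (auto simp: B_roots_def)
qed

text \<open>Source of the constant +-2 in \<open>commutator_short_short\<close>, and with it of the
  anticommutation: v - u is still a root, v - 2u has norm 5.\<close>

lemma string_len_short_short:
  assumes "short n u" "short n v" "u \<bullet> v = 0"
  shows "string_len n u v = 1"
  unfolding string_len_def short_multiple_root_iff[OF assms]
  by (rule Greatest_equality) auto

lemma string_len_short_long:
  assumes u: "short n u" and v: "short n v" and o: "u \<bullet> v = 0"
  shows "string_len n u (v - u) = 0"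
proof -
  have "v - u - int r \<cdot>\<^sub>v u = v - int (Suc r) \<cdot>\<^sub>v u" for r
    using short_long_facts[OF assms] by (auto simp: algebra_simps intro!: eq_vecI)
  then have "v - u - int r \<cdot>\<^sub>v u \<in> B_roots n \<longleftrightarrow> r = 0" for r
    using short_multiple_root_iff[OF assms, of "Suc r"] by (simp del: of_nat_Suc)
  then show ?thesis unfolding string_len_def by (auto intro!: Greatest_equality)
qed

lemma commutator_short_short:
  assumes u: "short n u" and v: "short n v" and o: "u \<bullet> v = 0"
  obtains k :: int where "\<bar>k\<bar> = 2" "\<And>a b. cj (x u a) (x v b) = x (u + v) (of_int k * a * b) \<otimes> x v b"
proof -
  note f = short_long_facts[OF assms]
  have ne: "v \<noteq> u" "v \<noteq> - u" using f o by (auto simp: uminus_vec_scalar[of _ n])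
  have "u + 2 \<cdot>\<^sub>v v \<notin> B_roots n" "2 \<cdot>\<^sub>v u + v \<notin> B_roots n"
    using f o by (auto simp: B_roots_def add_scalar_prod_distrib[of _ n] scalar_prod_add_distrib[of
        _ n])
  then obtain k :: int where k: "\<bar>k\<bar> = 2"
    "\<And>a b. x u a \<otimes> x v b \<otimes> inv (x u a) \<otimes> inv (x v b) = x (u + v) (of_int k * a * b)"
    using x_commutator[OF f(3,4) ne] string_len_short_short[OF assms] f
    by (auto simp: x_or_one_def)
  have "cj (x u a) (x v b) = x u a \<otimes> x v b \<otimes> inv (x u a) \<otimes> inv (x v b) \<otimes> x v b" for a b
    using f by (simp add: cj_def word_simps)
  with k that show thesis by simp
qed

lemma commutator_short_long:
  assumes u: "short n u" and v: "short n v" and o: "u \<bullet> v = 0"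
  obtains k l :: int where "\<bar>k\<bar> = 1"
    "\<And>a b. cj (x u a) (x (v - u) b) = x v (of_int k * a * b) \<otimes> x (v + u) (of_int l * a\<^sup>2 * b)
        \<otimes> x (v - u) b"
proof -
  note f = short_long_facts[OF assms]
  note dist = add_scalar_prod_distrib[of _ n] scalar_prod_add_distrib[of _ n]
     minus_scalar_prod_distrib[of _ n] scalar_prod_minus_distrib[of _ n]
  have "(v - u) \<bullet> (v - u) = 2" using f o by (simp add: dist)
  then have ne: "v - u \<noteq> u" "v - u \<noteq> - u" using f by (auto simp: uminus_vec_scalar[of _ n])
  have eq: "u + (v - u) = v" "2 \<cdot>\<^sub>v u + (v - u) = v + u"
    using f by (auto intro!: eq_vecI)
  have "u + 2 \<cdot>\<^sub>v (v - u) \<notin> B_roots n"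
    using f o by (auto simp: B_roots_def dist)
  then obtain k l :: int where k: "\<bar>k\<bar> = 1"
    "\<And>a b. x u a \<otimes> x (v - u) b \<otimes> inv (x u a) \<otimes> inv (x (v - u) b) =
       x v (of_int k * a * b) \<otimes> x (v + u) (of_int l * a\<^sup>2 * b)"
    using x_commutator[OF f(3,8) ne] string_len_short_long[OF assms] f
    by (auto simp: x_or_one_def eq)
  have "cj (x u a) (x (v - u) b) = x u a \<otimes> x (v - u) b \<otimes> inv (x u a) \<otimes> inv (x (v - u) b)
      \<otimes> x (v - u) b" for a b
    using f by (simp add: cj_def word_simps)
  with k that show thesis by simp
qed

text \<open>The roots v, v - u, v + u have weights 1, 2, 0 under the coroot of v - u. Conjugation by
  \<open>h (v - u) (- 1)\<close> therefore changes only the sign of \<open>a\<close>.\<close>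

lemma x_independent:
  assumes u: "short n u" and v: "short n v" and o: "u \<bullet> v = 0"
    and eq: "x v a \<otimes> x (v - u) b \<otimes> x (v + u) c = \<one>"
  shows "a = 0"
proof -
  note f = short_long_facts[OF assms(1-3)]
  note dist = add_scalar_prod_distrib[of _ n] scalar_prod_add_distrib[of _ n]
     minus_scalar_prod_distrib[of _ n] scalar_prod_minus_distrib[of _ n]
  have sq: "(v - u) \<bullet> (v - u) = 2" "(v + u) \<bullet> (v + u) = 2" using f o by (simp_all add: dist)
  have k: "cartan v (v - u) = 1" "cartan (v - u) (v - u) = 2" "cartan (v + u) (v - u) = 0"
     "cartan v (v + u) = 1" "cartan (v - u) (v + u) = 0"
    using f o by (simp_all add: cartan_long sq dist)
  have "x v a \<otimes> x (v - u) b = inv (x (v + u) c)"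
    using eq f by (simp add: inv_equality)
  moreover have "cj (h (v - u) (- 1)) (x v a \<otimes> x (v - u) b) = x v (- a) \<otimes> x (v - u) b"
    using f by (simp add: cj_mult cj_h_x k)
  moreover have "cj (h (v - u) (- 1)) (inv (x (v + u) c)) = inv (x (v + u) c)"
    using f by (simp add: cj_inv cj_h_x k)
  ultimately have "x v a \<otimes> x (v - u) b = x v (- a) \<otimes> x (v - u) b" by metis
  then have "x v a = x v (- a)" using f by simp
  then have "a + a = 0" using x_inj[OF f(4), of a "- a"] by (simp add: eq_neg_iff_add_eq_0)
  then have "2 * a = 0" by (simp only: mult_2)
  with two show ?thesis by simp
qed

text \<open>Compare the middle weight of the adjoint representation of \<open>SL\<^sub>2\<close>, on which the
  nontrivial Weyl element acts by \<open>-1\<close>.\<close>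

lemma cj_m_x_short_orthogonal:
  assumes u: "short n u" and v: "short n v" and o: "u \<bullet> v = 0"
  shows "cj (m u 1) (x v b) = x v (- b)"
proof -
  note f = short_long_facts[OF assms(1-3)]
  note dist = add_scalar_prod_distrib[of _ n] scalar_prod_add_distrib[of _ n]
     minus_scalar_prod_distrib[of _ n] scalar_prod_minus_distrib[of _ n] uminus_vec_scalar[of _ n]
  have u': "short n (- u)" and o': "- u \<bullet> v = 0" using u o f by (auto simp: short_uminus dist)
  have vu: "v - - u = v + u" "v + - u = v - u" "- u + v = v - u" "u + v = v + u"
     using f by (auto intro!: eq_vecI)
  have "reflect u v = v" using f by (simp add: reflect_orthogonal[of _ n])
  then obtain \<epsilon> where e: "\<epsilon> = 1 \<or> \<epsilon> = - 1" "\<And>c. cj (m u 1) (x v c) = x v (\<epsilon> * c)"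
    using cj_m_x[OF f(3,4)] by metis
  obtain k :: int where k: "\<bar>k\<bar> = 2" "\<And>a b. cj (x u a) (x v b) = x (v + u) (of_int k * a * b)
      \<otimes> x v b"
    using commutator_short_short[OF u v o] vu by metis
  obtain l :: int where l: "\<And>a b. cj (x (- u) a) (x v b) = x (v - u) (of_int l * a * b) \<otimes> x v b"
    using commutator_short_short[OF u' v o'] vu by metis
  obtain p q :: int where p: "\<bar>p\<bar> = 1"
    "\<And>a b. cj (x (- u) a) (x (v + u) b) = x v (of_int p * a * b) \<otimes> x (v - u) (of_int q * a\<^sup>2 * b)
        \<otimes> x (v + u) b"
    using commutator_short_long[OF u' v o'] vu by metis
  have c1: "x (v - u) a \<otimes> x v b = x v b \<otimes> x (v - u) a" for a b
    using x_commute[OF f(8,4), of a b] f o by (simp add: cj_fixed_iff dist)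
  have c2: "x (v + u) a \<otimes> x v b = x v b \<otimes> x (v + u) a" for a b
    using x_commute[OF f(7,4), of a b] f o by (simp add: cj_fixed_iff dist)
  have c3: "x (v + u) a \<otimes> x (v - u) b = x (v - u) b \<otimes> x (v + u) a" for a b
    using x_commute[OF f(7,8), of a b] f o by (simp add: cj_fixed_iff dist)
  define K P :: 'k where "K = of_int k" and "P = of_int p"
  \<comment> \<open>The outermost factor of \<open>m u 1\<close> is moved to the left, so that both
    sides can be expanded by commutators. The coefficients at the root v then decide the
    sign.\<close>
  have "cj (inv (x u 1)) (cj (m u 1) (x v 1)) = cj (x (- u) (- 1)) (cj (x u 1) (x v 1))"
    using f by (simp add: m_def cj_cj)
  moreover have "inv (x u 1) = x u (- 1)" using f by (simp add: x_minus)
  ultimately have eq: "x (v + u) (- K * \<epsilon>) \<otimes> x v \<epsilon> =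
     x v (- P * K) \<otimes> x (v - u) (of_int q * K) \<otimes> x (v + u) K \<otimes> (x (v - u) (- of_int l) \<otimes> x v 1)"
    (is "?L = ?R")
    using f by (simp add: e k l p cj_mult K_def P_def)
  have "?L \<in> carrier \<G>" using f by simp
  then have "\<one> = ?R \<otimes> inv ?L"
    by (subst eq[symmetric]) simp
  also have "inv ?L = x v (- \<epsilon>) \<otimes> x (v + u) (K * \<epsilon>)"
    using f by (simp add: x_minus inv_mult_group)
  also have "?R \<otimes> (x v (- \<epsilon>) \<otimes> x (v + u) (K * \<epsilon>)) = x v (- P * K) \<otimes> x (v - u) (of_int q * K) \<otimes>
      x (v + u) K \<otimes> x (v - u) (- of_int l) \<otimes> (x v 1 \<otimes> x v (- \<epsilon>)) \<otimes> x (v + u) (K * \<epsilon>)"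
    using f by (simp add: m_assoc)
  also have "\<dots> = (x v (- P * K) \<otimes> (x v 1 \<otimes> x v (- \<epsilon>))) \<otimes> (x (v - u) (of_int q * K)
      \<otimes> x (v - u) (- of_int l)) \<otimes> (x (v + u) K \<otimes> x (v + u) (K * \<epsilon>))"
  proof -
    have left: "x (v - u) a \<otimes> (x v b \<otimes> y) = x v b \<otimes> (x (v - u) a \<otimes> y)"
      "x (v + u) a \<otimes> (x v b \<otimes> y) = x v b \<otimes> (x (v + u) a \<otimes> y)"
      "x (v + u) a \<otimes> (x (v - u) b \<otimes> y) = x (v - u) b \<otimes> (x (v + u) a \<otimes> y)"
      if "y \<in> carrier \<G>" for a b y
      using f that c1 c2 c3 by (simp_all add: m_assoc[symmetric])
    show ?thesis using f by (simp add: m_assoc left c1 c2 c3)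
  qed
  also have "\<dots> = x v (- P * K + (1 - \<epsilon>)) \<otimes> x (v - u) (of_int q * K + (- of_int l)) \<otimes> x (v + u) (K
      + K * \<epsilon>)"
    by (simp only: x_add[OF f(4)] x_add[OF f(8)] x_add[OF f(7)] diff_conv_add_uminus)
  finally have A: "- P * K + (1 - \<epsilon>) = 0"
    using x_independent[OF u v o] by metis
  have "P * K = 2 \<or> P * K = - 2"
  proof -
    have "p * k = 2 \<or> p * k = - 2" using k(1) p(1) by (auto simp: abs_if split: if_splits)
    then have "(of_int (p * k) :: 'k) = 2 \<or> (of_int (p * k) :: 'k) = - 2"
      by (elim disjE) (simp_all only: of_int_numeral of_int_minus simp_thms)
    then show ?thesis by (simp add: P_def K_def)
  qed
  \<comment> \<open>By \<open>A\<close>, \<epsilon> = 1 - P K is -1 or 3. In the second case 3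
    differs from 1 because 2 is nonzero, so the sign is -1 again.\<close>
  then have "\<epsilon> = - 1"
  proof
    assume "P * K = 2"
    then have "\<epsilon> = - 1" using A by (simp add: algebra_simps)
    then show ?thesis .
  next
    assume "P * K = - 2"
    then have "\<epsilon> = 3" using A by (simp add: algebra_simps)
    moreover have "(2::'k) = 3 - 1" by simp
    ultimately have "\<epsilon> \<noteq> 1" using two by force
    with e(1) show ?thesis by blast
  qed
  with e show ?thesis by simp
qed

text \<open>A short coroot pairs evenly with every root, so the power of -1 that appears is 1. This
  makes \<open>z\<close> central in N.\<close>

lemma cj_h_short_m:
  assumes "short n v" "\<alpha> \<in> B_roots n"
  shows "cj (h v (- 1)) (m \<alpha> c) = m \<alpha> c"
proof -
  have "cartan \<alpha> v = 2 * (\<alpha> \<bullet> v)" using assms by (simp add: short_def cartan_short)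
  then have "even (cartan \<alpha> v)" by simp
  then show ?thesis using assms by (simp add: cj_h_m short_root)
qed

section \<open>The element z and the Clifford relations\<close>

definition z :: 'a where
  "z = h (unit_vec n (n - 1)) (- 1)"

text \<open>A long reflection moves one short root to any orthogonal one, but its lift commutes with
  \<open>h v (- 1)\<close>; so the two elements coincide.\<close>

lemma h_short_minus_one:
  assumes v: "short n v"
  shows "h v (- 1) = z"
proof -
  define u :: "int vec" where "u = unit_vec n (n - 1)"
  have u: "short n u" using rank by (simp add: u_def short_unit)
  have r: "u \<in> B_roots n" "v \<in> B_roots n" using u v by (simp_all add: short_root)
  show ?thesis
  proof (cases "u \<bullet> v = 0")
    case True
    have a: "u - v \<in> B_roots n" using short_long_facts(6)[OF u v True] .
    have "h u (- 1) = cj (m (u - v) 1) (h v (- 1))"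
      using x_equivariant_cj_h[OF x_equivariant_m[OF a] r(2), of 1
          "-1"] reflect_diff_short(2)[OF u v True]
      by simp
    also have "\<dots> = h v (- 1)"
      using cj_fixed_sym[OF _ _ cj_h_short_m[OF v a]] r a by blast
    finally show ?thesis by (simp add: z_def u_def)
  next
    case False
    then have "u = v \<or> u = - v" using short_orthogonal_disjoint u v by blast
    then show ?thesis
    proof
      assume "u = - v"
      then have "h u (- 1) = inv (h v (- 1))" using h_uminus[OF r(2)] by simp
      also have "\<dots> = h v (- 1)" using h_minus_one_square[OF r(2)] r by (simp add: inv_equality)
      finally show ?thesis by (simp add: z_def u_def)
    qed (simp add: z_def u_def)
  qed
qed

lemma z_closed [simp, intro]: "z \<in> carrier \<G>"
  using rank by (simp add: z_def short_unit short_root)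

lemma z_square [simp]: "z \<otimes> z = \<one>"
  using h_minus_one_square[OF short_root[OF short_unit]] rank by (simp add: z_def)

lemma z_inv [simp]: "inv z = z"
  by (simp add: inv_equality)

lemma cj_z_m: "\<alpha> \<in> B_roots n \<Longrightarrow> cj z (m \<alpha> c) = m \<alpha> c"
  using cj_h_short_m[OF short_unit] rank by (simp add: z_def)

text \<open>Conjugation by \<open>m \<alpha> 1\<close> inverts \<open>h \<alpha> c\<close>, so the
  scalar cancels in the square.\<close>

lemma m_root_square:
  assumes a: "\<alpha> \<in> B_roots n" and c: "c \<noteq> 0"
  shows "m \<alpha> c \<otimes> m \<alpha> c = h \<alpha> (- 1)"
proof -
  have "m \<alpha> c \<otimes> m \<alpha> c = h \<alpha> c \<otimes> cj (m \<alpha> 1) (h \<alpha> c) \<otimes> (m \<alpha> 1 \<otimes> m \<alpha> 1)"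
    using a by (simp add: m_eq[of \<alpha> c] cj_def word_simps)
  also have "cj (m \<alpha> 1) (h \<alpha> c) = inv (h \<alpha> c)"
    using x_equivariant_cj_h[OF x_equivariant_m[OF a] a c, of 1] a c
    by (simp add: reflect_self h_uminus)
  finally show ?thesis using a by (simp add: m_square)
qed

lemma m_short_square: "short n v \<Longrightarrow> c \<noteq> 0 \<Longrightarrow> m v c \<otimes> m v c = z"
  using m_root_square short_root h_short_minus_one by metis

text \<open>\<open>m u 1\<close> negates both root subgroups of +-v and \<open>h u c\<close>
  centralises them. So \<open>m v d\<close> goes to its inverse, which differs from it by its square
  \<open>z\<close>.\<close>

lemma m_short_anticommute:
  assumes u: "short n u" and v: "short n v" and o: "u \<bullet> v = 0" and c: "c \<noteq> 0" "d \<noteq> 0"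
  shows "m u c \<otimes> m v d = z \<otimes> (m v d \<otimes> m u c)"
proof -
  note f = short_long_facts[OF u v o]
  have v': "short n (- v)" "u \<bullet> - v = 0" using v f o
      by (auto simp: short_uminus uminus_vec_scalar[of _ n])
  have "cj (m u c) (m v d) = cj (h u c) (m v (- d))"
    using f cj_m_x_short_orthogonal[OF u v o] cj_m_x_short_orthogonal[OF u v']
    by (simp add: m_eq[of u c] cj_cj m_def[of v] cj_mult)
  also have "\<dots> = m v (- d)"
    using f c by (simp add: cj_h_m cartan_short)
  also have "\<dots> = inv (m v d)" using f by (simp add: m_minus)
  also have "\<dots> = z \<otimes> m v d"
  proof (rule inv_equality)
    show "z \<otimes> m v d \<otimes> m v d = \<one>"
      using m_short_square[OF v c(2)] f by (simp add: m_assoc)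
  qed (use f in auto)
  finally show ?thesis using mult_cj[of "m u c" "m v d"] f by (simp add: m_assoc)
qed

text \<open>If one of the orthogonal roots is long, no combination with either choice of signs is
  short enough to be a root, and the root subgroups commute.\<close>

lemma m_orthogonal_commute:
  assumes a: "\<alpha> \<in> B_roots n" and b: "\<beta> \<in> B_roots n" and o: "\<alpha> \<bullet> \<beta> = 0"
    and l: "\<alpha> \<bullet> \<alpha> + \<beta> \<bullet> \<beta> > 2"
  shows "m \<alpha> c \<otimes> m \<beta> d = m \<beta> d \<otimes> m \<alpha> c"
proof -
  note ca = B_roots_carrier[OF a] B_roots_carrier[OF b]
  have "cj (x \<alpha>' c) (x \<beta>' d) = x \<beta>' d" if "\<alpha>' = \<alpha> \<or> \<alpha>' = - \<alpha>" "\<beta>' = \<beta> \<or> \<beta>' = - \<beta>" for \<alpha>' \<beta>' c d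
    using that a b o l ca by (intro x_commute) (auto simp: uminus_vec_scalar[of _ n])
  then have "cj (m \<alpha> c) (m \<beta> d) = m \<beta> d"
    using a b by (simp add: m_def cj_mult cj_cj)
  then show ?thesis using a b by (simp add: cj_fixed_iff)
qed

end

section \<open>The torus and representatives of Weyl group elements\<close>

text \<open>Weyl group elements are functions whose values off \<open>carrier_vec n\<close> are
  arbitrary, so linearity is demanded there only.\<close>

definition linear_isometry :: "nat \<Rightarrow> (int vec \<Rightarrow> int vec) \<Rightarrow> bool" where
  "linear_isometry n w \<longleftrightarrow> (\<forall>u \<in> carrier_vec n. w u \<in> carrier_vec n \<and> w (- u) = - w u \<and>
     (\<forall>v \<in> carrier_vec n. w (u + v) = w u + w v \<and> w (u - v) = w u - w v \<and> w u \<bullet> w v = u \<bullet> v))"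

lemma linear_isometryD:
  assumes "linear_isometry n w" "u \<in> carrier_vec n" "v \<in> carrier_vec n"
  shows "w u \<in> carrier_vec n" "w (- u) = - w u" "w (u + v) = w u + w v" "w (u - v) = w u - w v"
    "w u \<bullet> w v = u \<bullet> v"
  using assms by (auto simp: linear_isometry_def)

lemma linear_isometry_id: "linear_isometry n (\<lambda>v. v)"
  by (simp add: linear_isometry_def)

lemma linear_isometry_reflect: "\<alpha> \<in> B_roots n \<Longrightarrow> linear_isometry n (reflect \<alpha>)"
  by (simp add: linear_isometry_def reflect_add[of \<alpha> n] reflect_scalar_prod)

lemma linear_isometry_comp:
  "linear_isometry n v \<Longrightarrow> linear_isometry n w \<Longrightarrow> linear_isometry n (\<lambda>u. v (w u))"
  by (simp add: linear_isometry_def)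

lemma linear_isometry_short: "linear_isometry n w \<Longrightarrow> short n v \<Longrightarrow> short n (w v)"
  by (auto simp: short_def linear_isometry_def)

lemma linear_isometry_funpow: "linear_isometry n w \<Longrightarrow> linear_isometry n (w ^^ k)"
  by (induction k) (simp_all add: linear_isometry_id[folded id_def] linear_isometry_comp o_def)

context group
begin

lemma generate_cj_closed:
  assumes S: "S \<subseteq> carrier G" and g: "g \<in> carrier G" and gen: "\<And>y. y \<in> S \<Longrightarrow> cj g y \<in> generate G S'"
    and S': "S' \<subseteq> carrier G" and t: "t \<in> generate G S"
  shows "cj g t \<in> generate G S'"
  using t
proof (induction rule: generate.induct)
  case one
  then show ?case using g by (simp add: generate.one)
next
  case (incl y)
  then show ?case by (rule gen)
next
  case (inv y)
  then show ?case using gen[of y] g S S' by (auto simp: cj_inv subset_iff intro!: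
      generate_m_inv_closed[of S'])
next
  case (eng a b)
  then have "a \<in> carrier G" "b \<in> carrier G" using generate_in_carrier[OF S] by auto
  with eng g show ?case by (simp add: cj_mult generate.eng)
qed

lemma generate_commute:
  assumes S: "S \<subseteq> carrier G" and g: "g \<in> carrier G" and gen: "\<And>y. y \<in> S \<Longrightarrow> cj g y = y"
    and t: "t \<in> generate G S"
  shows "cj g t = t"
  using t
proof (induction rule: generate.induct)
  case one
  then show ?case using g by simp
next
  case (incl y)
  then show ?case by (rule gen)
next
  case (inv y)
  then show ?case using gen[of y] g S by (auto simp: cj_inv)
next
  case (eng a b)
  then have "a \<in> carrier G" "b \<in> carrier G" using generate_in_carrier[OF S] by auto
  with eng g show ?case by (simp add: cj_mult)
qed

end

context chevalley_group
begin

text \<open>Short coroots suffice, since \<open>h_T\<close> recovers the long ones. The index set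
  keeps track of the coordinates that a lift can involve.\<close>

definition T_gens :: "nat set \<Rightarrow> 'a set" where
  "T_gens I = {h (unit_vec n i) s |i s. i \<in> I \<and> i < n \<and> s \<noteq> 0}"

definition T :: "nat set \<Rightarrow> 'a set" where
  "T I = generate \<G> (T_gens I)"

lemma T_gens_carrier: "T_gens I \<subseteq> carrier \<G>"
  by (auto simp: T_gens_def short_root short_unit)

lemma T_carrier: "t \<in> T I \<Longrightarrow> t \<in> carrier \<G>"
  unfolding T_def using generate_in_carrier[OF T_gens_carrier] .

lemma T_one: "\<one> \<in> T I"
  by (simp add: T_def generate.one)

lemma T_mult: "s \<in> T I \<Longrightarrow> t \<in> T I \<Longrightarrow> s \<otimes> t \<in> T I"
  by (simp add: T_def generate.eng)

lemma T_inv: "t \<in> T I \<Longrightarrow> inv t \<in> T I"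
  unfolding T_def using generate_m_inv_closed[OF T_gens_carrier] .

lemma T_mono: "I \<subseteq> J \<Longrightarrow> T I \<subseteq> T J"
  unfolding T_def by (intro mono_generate) (auto simp: T_gens_def)

lemma h_short_T:
  assumes "short n v" "supported I v" "s \<noteq> 0"
  shows "h v s \<in> T I"
proof -
  obtain i where i: "i < n" "v = unit_vec n i \<or> v = - unit_vec n i" using assms(1)
      by (rule short_cases)
  then have "i \<in> I" using assms(2) by (auto simp: supported_unit)
  then have "h (unit_vec n i) s \<in> T I"
    unfolding T_def using i assms(3) by (intro generate.incl) (auto simp: T_gens_def)
  then show ?thesis using i assms(3) by (auto simp: h_uminus short_root short_unit T_inv)
qed

text \<open>A long root is a sum of two orthogonal short roots with support in the same set. Its
  coroot is half the sum of theirs, and a square root of \<open>c\<close>, available in an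
  algebraically closed field, makes up for the half.\<close>

lemma h_T:
  assumes a: "\<alpha> \<in> B_roots n" and s: "supported I \<alpha>" and c: "c \<noteq> 0"
  shows "h \<alpha> c \<in> T I"
proof (cases "short n \<alpha>")
  case True
  then show ?thesis using h_short_T s c by blast
next
  case False
  then have "long n \<alpha>" using a by (simp add: B_roots_iff)
  then obtain i u where i: "i < n" "short n u" "\<alpha> = unit_vec n i + u \<or> \<alpha> = - unit_vec n i + u"
    "u \<bullet> unit_vec n i = 0" "supported {j. \<alpha> $ j \<noteq> 0} u" "\<alpha> $ i \<noteq> 0"
    by (rule long_cases) (rule that)
  have u: "u \<in> carrier_vec n" "dim_vec \<alpha> = n" "dim_vec u = n" using i(2) B_roots_carrier[OF a]
      by (auto simp: short_def)
  have su: "supported I u" using i(5) s u by (auto simp: supported_def)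
  have iI: "i \<in> I" using i(1,6) s u by (auto simp: supported_def)
  obtain v where v: "short n v" "supported I v" "\<alpha> = v + u" "v \<bullet> u = 0"
  proof -
    have o: "unit_vec n i \<bullet> u = 0" using i u by (simp add: comm_scalar_prod[of _ n u])
    from i(3) show thesis
    proof
      assume "\<alpha> = unit_vec n i + u" then show thesis
        using that[of "unit_vec n i"] i iI o by (simp add: supported_unit short_unit)
    next
      assume "\<alpha> = - unit_vec n i + u" then show thesis
        using that[of "- unit_vec n i"] i iI o u
        by (simp add: supported_unit short_unit short_uminus uminus_vec_scalar[of _ n])
    qed
  qed
  obtain r where r: "r\<^sup>2 = c" using exists_sqrt by blast
  then have "r \<noteq> 0" using c by auto
  then show ?thesis using h_short_sum[OF v(1) i(2) v(4), of r] v r su i(2)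
    by (simp add: T_mult h_short_T)
qed

lemma T_commute:
  assumes "s \<in> T I" "t \<in> T J"
  shows "s \<otimes> t = t \<otimes> s"
proof -
  have 1: "cj (h (unit_vec n i) b) t = t" if "i < n" "b \<noteq> 0" for i b
    by (rule generate_commute[OF T_gens_carrier _ _ assms(2)[unfolded T_def]])
       (use that in \<open>auto simp: T_gens_def short_root short_unit cj_h_h\<close>)
  have t: "t \<in> carrier \<G>" and s: "s \<in> carrier \<G>" using assms T_carrier by auto
  have "cj t s = s"
  proof (rule generate_commute[OF T_gens_carrier t _ assms(1)[unfolded T_def]])
    fix y assume "y \<in> T_gens I"
    then obtain i b where y: "y = h (unit_vec n i) b" "i < n" "b \<noteq> 0" by (auto simp: T_gens_def)
    then have "y \<in> carrier \<G>" "cj y t = t" using 1[of i b] by (auto simp: short_root short_unit)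
    then show "cj t y = y" by (intro cj_fixed_sym[OF _ t])
  qed
  then show ?thesis using s t by (simp add: cj_fixed_iff)
qed

text \<open>The graph of the homomorphism \<open>N \<rightarrow> W\<close>, restricted to the subsystem of roots supported
  in \<open>I\<close>; Weyl group elements are functions on \<open>\<int>\<^sup>n\<close>, relevant on \<open>carrier_vec n\<close> only.\<close>

inductive rep :: "nat set \<Rightarrow> 'a \<Rightarrow> (int vec \<Rightarrow> int vec) \<Rightarrow> bool" for I where
  rep_one: "rep I \<one> (\<lambda>v. v)"
| rep_step: "rep I g w \<Longrightarrow> \<alpha> \<in> B_roots n \<Longrightarrow> supported I \<alpha> \<Longrightarrow> c \<noteq> 0 \<Longrightarrow> rep I (m \<alpha> c
    \<otimes> g) (\<lambda>v. reflect \<alpha> (w v))"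

lemma rep_equivariant: "rep I g w \<Longrightarrow> x_equivariant g w"
  by (induction rule: rep.induct) (auto intro: x_equivariant_one x_equivariant_mult x_equivariant_m)

lemma rep_closed: "rep I g w \<Longrightarrow> g \<in> carrier \<G>"
  using rep_equivariant by (auto simp: x_equivariant_def)

lemma rep_isometry: "rep I g w \<Longrightarrow> linear_isometry n w"
  by (induction rule: rep.induct)
     (auto intro: linear_isometry_id linear_isometry_comp linear_isometry_reflect)

lemma rep_m: "\<alpha> \<in> B_roots n \<Longrightarrow> supported I \<alpha> \<Longrightarrow> c \<noteq> 0 \<Longrightarrow> rep I (m \<alpha> c) (reflect \<alpha>)"
  using rep_step[OF rep_one, of \<alpha> I c] by simp

lemma rep_mult:
  assumes "rep I g v" "rep I k w"
  shows "rep I (g \<otimes> k) (\<lambda>u. v (w u))"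
  using assms
proof (induction rule: rep.induct)
  case rep_one
  then show ?case using rep_closed[OF assms(2)] by simp
next
  case (rep_step g v \<alpha> c)
  have "rep I (m \<alpha> c \<otimes> (g \<otimes> k)) (\<lambda>u. reflect \<alpha> (v (w u)))"
    using rep_step by (intro rep.rep_step) auto
  then show ?case using rep_closed[OF rep_step(1)] rep_closed[OF assms(2)] rep_step(2)
    by (simp add: m_assoc)
qed

lemma rep_pow: "rep I g w \<Longrightarrow> rep I (g [^] (k::nat)) (w ^^ k)"
proof (induction k)
  case 0
  then show ?case by (simp add: rep_one id_def)
next
  case (Suc k)
  then have "rep I (g [^] k \<otimes> g) (\<lambda>u. (w ^^ k) (w u))" by (intro rep_mult) auto
  then show ?case by (simp add: funpow_Suc_right o_def del: funpow.simps)
qed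

lemma rep_inverse:
  assumes "rep I g w"
  shows "\<exists>w'. rep I (inv g) w' \<and> (\<forall>v \<in> carrier_vec n. w' (w v) = v \<and> w (w' v) = v)"
  using assms
proof (induction rule: rep.induct)
  case rep_one
  then show ?case by (intro exI[of _ "\<lambda>v. v"]) (simp add: rep.rep_one)
next
  case (rep_step g w \<alpha> c)
  then obtain w' where w': "rep I (inv g) w'" "\<forall>v \<in> carrier_vec n. w' (w v) = v \<and> w (w' v) = v"
      by blast
  have m: "inv (m \<alpha> c) = m \<alpha> (- c)" using rep_step m_minus by simp
  have "rep I (inv g \<otimes> inv (m \<alpha> c)) (\<lambda>v. w' (reflect \<alpha> v))"
    unfolding m by (rule rep_mult[OF w'(1) rep_m]) (use rep_step in auto)
  moreover have "\<forall>v \<in> carrier_vec n. w' (reflect \<alpha> (reflect \<alpha> (w v))) = v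
      \<and> reflect \<alpha> (w (w' (reflect \<alpha> v))) = v"
    using w'(2) rep_step(2) linear_isometryD(1)[OF rep_isometry[OF rep_step(1)]]
    by (auto simp: reflect_reflect)
  ultimately show ?case using rep_closed[OF rep_step(1)] rep_step(2) by (auto simp: inv_mult_group)
qed

lemma rep_supported: "rep I g w \<Longrightarrow> v \<in> carrier_vec n \<Longrightarrow> supported I v \<Longrightarrow> supported I (w v)"
  by (induction rule: rep.induct)
     (auto intro!: reflect_supported[of _ _ _ n] simp: B_roots_carrier linear_isometryD(1)[OF
         rep_isometry])

lemma rep_mono: "rep I g w \<Longrightarrow> I \<subseteq> J \<Longrightarrow> rep J g w"
  by (induction rule: rep.induct) (auto intro: rep.intros supported_mono)

lemma rep_cj_h:
  "rep I g w \<Longrightarrow> \<beta> \<in> B_roots n \<Longrightarrow> c \<noteq> 0 \<Longrightarrow> cj g (h \<beta> c) = h (w \<beta>) c"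
  using x_equivariant_cj_h rep_equivariant by blast

lemma rep_cj_T:
  assumes "rep I g w" "t \<in> T I"
  shows "cj g t \<in> T I"
  unfolding T_def
proof (rule generate_cj_closed[OF T_gens_carrier rep_closed[OF assms(1)] _ T_gens_carrier
    assms(2)[unfolded T_def]])
  fix y assume "y \<in> T_gens I"
  then obtain i b where y: "y = h (unit_vec n i) b" "i < n" "b \<noteq> 0" "i \<in> I"
      by (auto simp: T_gens_def)
  then have "cj g y = h (w (unit_vec n i)) b"
    using rep_cj_h[OF assms(1)] by (simp add: short_root short_unit)
  moreover have "short n (w (unit_vec n i))"
    using linear_isometry_short[OF rep_isometry[OF assms(1)]] y short_unit by blast
  moreover have "supported I (w (unit_vec n i))"
    using rep_supported[OF assms(1)] y by (simp add: supported_unit)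
  ultimately show "cj g y \<in> generate \<G> (T_gens I)" using h_short_T y by (simp add: T_def)
qed

lemma rep_cj_z: "rep I g w \<Longrightarrow> cj g z = z"
proof (induction rule: rep.induct)
  case rep_one
  then show ?case by simp
next
  case (rep_step g w \<alpha> c)
  then show ?case using cj_fixed_sym[OF _ _ cj_z_m, of \<alpha> c] rep_closed[OF rep_step(1)]
      by (simp add: cj_cj)
qed

text \<open>Both factors of \<open>h\<close> lie over the same reflection, which cancels against
  itself.\<close>

lemma rep_h:
  assumes "\<alpha> \<in> B_roots n" "supported I \<alpha>" "c \<noteq> 0"
  shows "\<exists>w. rep I (h \<alpha> c) w \<and> (\<forall>v \<in> carrier_vec n. w v = v)"
  using rep_mult[OF rep_m[OF assms] rep_m[OF assms(1,2), of "- 1"]] assms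
  by (intro exI[of _ "\<lambda>v. reflect \<alpha> (reflect \<alpha> v)"]) (auto simp: h_def reflect_reflect)

end

section \<open>The kernel of the map from N to W\<close>

lemma reflect_conjugate:
  assumes "\<rho> \<in> B_roots n" "\<alpha> \<in> B_roots n" "v \<in> carrier_vec n"
  shows "reflect (reflect \<rho> \<alpha>) (reflect \<rho> v) = reflect \<rho> (reflect \<alpha> v)"
proof -
  note a = B_roots_carrier[OF assms(1)] B_roots_carrier[OF assms(2)]
  have "cartan (reflect \<rho> v) (reflect \<rho> \<alpha>) = cartan v \<alpha>"
    using assms a by (simp add: cartan_def reflect_scalar_prod)
  moreover have "reflect \<rho> (c \<cdot>\<^sub>v \<alpha>) = c \<cdot>\<^sub>v reflect \<rho> \<alpha>" for c
    using a by (auto simp: reflect_def cartan_add[OF assms(1) a(2) a(2)] algebra_simps intro!: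
        eq_vecI)
  ultimately show ?thesis using assms a
    by (simp add: reflect_def[of "reflect \<rho> \<alpha>"] reflect_def[of \<alpha> v] reflect_add[of \<rho> n])
qed

context chevalley_group
begin

text \<open>\<open>h (v \<beta>) s\<close> has weight 2 on the root subgroup of
  \<open>v \<beta>\<close>, but 0 or -2 on that of any other short root. So a group element
  determines how its Weyl element acts on short roots.\<close>

lemma x_equivariant_unique:
  assumes v: "x_equivariant g v" and w: "x_equivariant g w" and b: "\<beta> \<in> B_roots n"
    and sv: "short n (v \<beta>)" and sw: "short n (w \<beta>)"
  shows "v \<beta> = w \<beta>"
proof (rule ccontr)
  assume ne: "v \<beta> \<noteq> w \<beta>"
  obtain \<eta> where e: "\<eta> \<noteq> 0" "\<And>c. cj g (x \<beta> c) = x (v \<beta>) (\<eta> * c)"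
    using v b unfolding x_equivariant_def by blast
  obtain \<zeta> where z: "\<zeta> \<noteq> 0" "\<And>c. cj g (x \<beta> c) = x (w \<beta>) (\<zeta> * c)"
    using w b unfolding x_equivariant_def by blast
  obtain s :: 'k where s: "s \<noteq> 0" "s\<^sup>2 \<noteq> 1" "s ^ 4 \<noteq> 1" using exists_scalar by blast
  define k where "k = cartan (w \<beta>) (v \<beta>)"
  have r: "v \<beta> \<in> B_roots n" "w \<beta> \<in> B_roots n" using sv sw by (auto simp: short_root)
  have eq: "x (v \<beta>) (\<eta> * c) = x (w \<beta>) (\<zeta> * c)" for c using e z by metis
  have "x (v \<beta>) (s\<^sup>2 * \<eta>) = cj (h (v \<beta>) s) (x (v \<beta>) (\<eta> * 1))"
    using r s by (simp add: cj_h_x cartan_self)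
  also have "\<dots> = cj (h (v \<beta>) s) (x (w \<beta>) (\<zeta> * 1))" by (simp only: eq)
  also have "\<dots> = x (w \<beta>) (\<zeta> * (s powi k))"
    using r s by (simp add: cj_h_x k_def mult.commute)
  also have "\<dots> = x (v \<beta>) (\<eta> * (s powi k))" by (simp only: eq)
  finally have "s\<^sup>2 * \<eta> = \<eta> * (s powi k)" using x_inj[OF r(1)] by blast
  then have *: "s\<^sup>2 = s powi k" using e(1) by (simp add: mult.commute)
  have "k = 0 \<or> k = - 2"
  proof (cases "w \<beta> \<bullet> v \<beta> = 0")
    case True
    then show ?thesis using sv by (simp add: k_def cartan_short short_def)
  next
    case False
    then have "w \<beta> = - v \<beta>" using short_orthogonal_disjoint[OF sw sv] ne by auto
    then show ?thesis using cartan_add(3)[OF r(1) _ B_roots_carrier[OF r(1)], of "v \<beta>"]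
      cartan_self[OF r(1)] B_roots_carrier[OF r(1)] by (simp add: k_def)
  qed
  then show False
  proof
    assume "k = 0" with * s show False by simp
  next
    assume "k = - 2"
    then have eq: "s\<^sup>2 = inverse (s\<^sup>2)" using * by (simp add: power_int_minus)
    have "inverse (s\<^sup>2) * s\<^sup>2 = 1" using s by simp
    then have "s\<^sup>2 * s\<^sup>2 = 1" by (simp only: eq[symmetric])
    then have "s ^ 4 = 1" by (simp flip: power_add)
    with s show False by simp
  qed
qed

section \<open>Congruence modulo the torus\<close>

definition eqT :: "nat set \<Rightarrow> 'a \<Rightarrow> 'a \<Rightarrow> bool" where
  "eqT I g k \<longleftrightarrow> k \<in> carrier \<G> \<and> (\<exists>t \<in> T I. g = t \<otimes> k)"

lemma eqT_carrier: "eqT I g k \<Longrightarrow> g \<in> carrier \<G> \<and> k \<in> carrier \<G>"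
  by (auto simp: eqT_def T_carrier)

lemma eqT_refl: "g \<in> carrier \<G> \<Longrightarrow> eqT I g g"
  by (auto simp: eqT_def intro!: bexI[OF _ T_one])

lemma eqT_trans [trans]: "eqT I a b \<Longrightarrow> eqT I b c \<Longrightarrow> eqT I a c"
  unfolding eqT_def using T_mult T_carrier m_assoc by (metis (no_types, lifting))

lemma eqT_sym: assumes "eqT I a b" shows "eqT I b a"
proof -
  obtain t where t: "t \<in> T I" "a = t \<otimes> b" "b \<in> carrier \<G>" using assms by (auto simp: eqT_def)
  then have "b = inv t \<otimes> a" "a \<in> carrier \<G>" using T_carrier by auto
  then show ?thesis using T_inv[OF t(1)] by (auto simp: eqT_def)
qed

lemma eqT_mult_right: "eqT I a b \<Longrightarrow> c \<in> carrier \<G> \<Longrightarrow> eqT I (a \<otimes> c) (b \<otimes> c)"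
  by (auto simp: eqT_def m_assoc T_carrier)

text \<open>The torus factor has to be pulled out past \<open>g\<close>, so \<open>g\<close> must
  normalise \<open>T I\<close>; multiplication on the right needs nothing of the kind.\<close>

lemma eqT_mult_left:
  assumes g: "rep I g w" and e: "eqT I a b"
  shows "eqT I (g \<otimes> a) (g \<otimes> b)"
proof -
  obtain t where t: "t \<in> T I" "a = t \<otimes> b" "b \<in> carrier \<G>" using e by (auto simp: eqT_def)
  have c: "g \<in> carrier \<G>" "t \<in> carrier \<G>" using rep_closed[OF g] T_carrier[OF t(1)] .
  have "g \<otimes> a = cj g t \<otimes> (g \<otimes> b)" using t c by (simp add: cj_def word_simps)
  then show ?thesis using rep_cj_T[OF g t(1)] c t by (auto simp: eqT_def)
qed

lemma eqT_m_scalar: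
  "\<alpha> \<in> B_roots n \<Longrightarrow> supported I \<alpha> \<Longrightarrow> c \<noteq> 0 \<Longrightarrow> eqT I (m \<alpha> c) (m \<alpha> 1)"
  using m_eq[of \<alpha> c] h_T by (auto simp: eqT_def)

lemma eqT_m_uminus:
  assumes a: "\<alpha> \<in> B_roots n" and s: "supported I \<alpha>"
  shows "eqT I (m (- \<alpha>) 1) (m \<alpha> 1)"
proof -
  obtain \<epsilon> where "\<epsilon> = 1 \<or> \<epsilon> = - 1" "m (- \<alpha>) 1 = m (- (- \<alpha>)) \<epsilon>"
    using m_opposite[of "- \<alpha>"] a by auto
  then show ?thesis using eqT_m_scalar[OF a s, of \<epsilon>] by auto
qed

lemma eqT_m_square:
  assumes a: "\<alpha> \<in> B_roots n" and s: "supported I \<alpha>"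
  shows "eqT I (m \<alpha> 1 \<otimes> m \<alpha> 1) \<one>"
  using m_square[OF a] h_T[OF a s, of "- 1"] a by (auto simp: eqT_def intro!: bexI[of _
      "h \<alpha> (- 1)"])

lemma eqT_m_m:
  assumes a: "\<alpha> \<in> B_roots n" "supported I \<alpha>" and b: "\<beta> \<in> B_roots n" "supported I \<beta>"
  shows "eqT I (m \<alpha> 1 \<otimes> m \<beta> 1) (m (reflect \<alpha> \<beta>) 1 \<otimes> m \<alpha> 1)"
proof -
  obtain \<epsilon> where e: "\<epsilon> = 1 \<or> \<epsilon> = - 1" "\<And>c. cj (m \<alpha> 1) (m \<beta> c) = m (reflect \<alpha> \<beta>) (\<epsilon> * c)"
    by (rule m_m[OF a(1) b(1)]) (rule that)
  have "m \<alpha> 1 \<otimes> m \<beta> 1 = m (reflect \<alpha> \<beta>) \<epsilon> \<otimes> m \<alpha> 1"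
    using mult_cj[of "m \<alpha> 1" "m \<beta> 1"] e(2)[of 1] a b by simp
  moreover have "reflect \<alpha> \<beta> \<in> B_roots n" "supported I (reflect \<alpha> \<beta>)"
    using a b reflect_root reflect_supported B_roots_carrier by blast+
  ultimately show ?thesis using eqT_m_scalar[of "reflect \<alpha> \<beta>" I \<epsilon>] a e(1)
    by (auto intro: eqT_mult_right)
qed

lemma eqT_m_m':
  assumes a: "\<alpha> \<in> B_roots n" "supported I \<alpha>" and b: "\<beta> \<in> B_roots n" "supported I \<beta>"
  shows "eqT I (m \<alpha> 1 \<otimes> m \<beta> 1) (m \<beta> 1 \<otimes> m (reflect \<beta> \<alpha>) 1)"
proof -
  have r: "reflect \<beta> \<alpha> \<in> B_roots n" "supported I (reflect \<beta> \<alpha>)"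
    using a b reflect_root reflect_supported B_roots_carrier by blast+
  show ?thesis using eqT_sym[OF eqT_m_m[OF b r]] a b by (simp add: reflect_reflect B_roots_carrier)
qed

end

text \<open>\<open>coset_rep \<beta>\<close> lies over an element of \<open>W\<close> taking \<open>e\<^sub>j\<close> to the short root \<open>\<beta>\<close>; modulo the torus
  these elements represent the cosets of the subgroup that belongs to the coordinates in \<open>J\<close>.\<close>

locale coset_enumeration = chevalley_group +
  fixes j :: nat and J :: "nat set"
  assumes j: "j < n" "j \<notin> J"
begin

abbreviation "e \<equiv> unit_vec n j :: int vec"

abbreviation "I \<equiv> insert j J"

text \<open>A root whose reflection takes \<open>e\<close> to \<beta>. The difference \<beta> - e
  fails only for \<beta> = - e, where it is - 2e and not a root.\<close>

definition coset_root :: "int vec \<Rightarrow> int vec" where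
  "coset_root \<beta> = (if \<beta> = - e then e else \<beta> - e)"

definition coset_rep :: "int vec \<Rightarrow> 'a" where
  "coset_rep \<beta> = (if \<beta> = e then \<one> else m (coset_root \<beta>) 1)"

definition in_coset :: "'a \<Rightarrow> int vec \<Rightarrow> bool" where
  "in_coset g \<beta> \<longleftrightarrow> (\<exists>k w. rep J k w \<and> eqT I g (coset_rep \<beta> \<otimes> k))"

lemma e_facts: "short n e" "e \<in> carrier_vec n" "e \<in> B_roots n" "supported I e" "e \<noteq> - e" "- e \<noteq> e"
  using j root_nonzero[OF short_root[OF short_unit[OF j(1)]]]
  by (auto simp: short_unit short_root supported_unit)

lemma short_e_cases:
  assumes "short n \<beta>"
  obtains "\<beta> = e" | "\<beta> = - e" | "\<beta> \<bullet> e = 0" "\<beta> \<noteq> e" "\<beta> \<noteq> - e"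
proof (cases "\<beta> \<bullet> e = 0")
  case True
  then have "\<beta> \<noteq> e" "\<beta> \<noteq> - e" using e_facts by (auto simp: short_def uminus_vec_scalar[of _ n])
  with True that show thesis by blast
next
  case False
  then show thesis using short_orthogonal_disjoint[OF assms e_facts(1)] that by blast
qed

lemma supported_J:
  assumes "\<beta> \<in> carrier_vec n" "supported I \<beta>" "\<beta> \<bullet> e = 0"
  shows "supported J \<beta>"
  using assms j by (auto simp: supported_def)

lemma coset_root:
  assumes b: "short n \<beta>" "supported I \<beta>" "\<beta> \<noteq> e"
  shows "coset_root \<beta> \<in> B_roots n" "supported I (coset_root \<beta>)" "reflect (coset_root \<beta>) e = \<beta>"
proof -
  have "coset_root \<beta> \<in> B_roots n \<and> supported I (coset_root \<beta>) \<and> reflect (coset_root \<beta>) e = \<beta>"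
    using b(1)
  proof (cases rule: short_e_cases)
    case 1 then show ?thesis using b by simp
  next
    case 2 then show ?thesis using e_facts by (simp add: coset_root_def reflect_self)
  next
    case 3
    then show ?thesis using e_facts short_long_facts[OF b(1) e_facts(1) 3(1)] b
        reflect_diff_short[OF b(1) e_facts(1) 3(1)]
      by (simp add: coset_root_def supported_diff)
  qed
  then show "coset_root \<beta> \<in> B_roots n" "supported I (coset_root \<beta>)" "reflect (coset_root \<beta>) e = \<beta>"
    by blast+
qed

lemma coset_rep_closed: "short n \<beta> \<Longrightarrow> supported I \<beta> \<Longrightarrow> coset_rep \<beta> \<in> carrier \<G>"
  using coset_root by (auto simp: coset_rep_def)

lemma in_coset_eqT: "eqT I g k \<Longrightarrow> in_coset k \<beta> \<Longrightarrow> in_coset g \<beta>"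
  by (auto simp: in_coset_def intro: eqT_trans)

lemma in_coset_rep: "eqT I g (coset_rep \<beta>) \<Longrightarrow> in_coset g \<beta>"
  using eqT_carrier rep_one by (fastforce simp: in_coset_def)

lemma in_coset_rep_m:
  assumes "eqT I g (coset_rep \<beta> \<otimes> m \<gamma> 1)" "\<gamma> \<in> B_roots n" "supported J \<gamma>"
  shows "in_coset g \<beta>"
  using assms rep_m[OF assms(2,3), of 1] by (auto simp: in_coset_def)

lemma in_coset_mult:
  assumes "in_coset g \<beta>" "rep J k w" "short n \<beta>" "supported I \<beta>"
  shows "in_coset (g \<otimes> k) \<beta>"
proof -
  obtain k' w' where k': "rep J k' w'" "eqT I g (coset_rep \<beta> \<otimes> k')" using assms
      by (auto simp: in_coset_def)
  have "eqT I (g \<otimes> k) (coset_rep \<beta> \<otimes> (k' \<otimes> k))"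
    using eqT_mult_right[OF k'(2) rep_closed[OF assms(2)]] coset_rep_closed[OF assms(3,4)]
      rep_closed[OF k'(1)] rep_closed[OF assms(2)] by (simp add: m_assoc)
  then show ?thesis using rep_mult[OF k'(1) assms(2)] by (auto simp: in_coset_def)
qed

text \<open>A root not orthogonal to \<open>e\<close> is up to sign the \<open>coset_root\<close> of
  the image of \<open>e\<close>, and opposite roots have congruent lifts.\<close>

lemma root_cases:
  assumes a: "\<alpha> \<in> B_roots n" "supported I \<alpha>"
  shows "supported J \<alpha> \<and> reflect \<alpha> e = e \<or>
    reflect \<alpha> e \<noteq> e \<and> eqT I (m \<alpha> 1) (coset_rep (reflect \<alpha> e))"
proof (cases "\<alpha> \<bullet> e = 0")
  case True
  then have "reflect \<alpha> e = e" "supported J \<alpha>"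
    using a e_facts B_roots_carrier[OF a(1)]
    by (auto simp: reflect_orthogonal[of _ n] comm_scalar_prod[of e n \<alpha>] intro: supported_J)
  then show ?thesis by blast
next
  case False
  note ac = B_roots_carrier[OF a(1)]
  define \<delta> where "\<delta> = reflect \<alpha> e"
  have d: "short n \<delta>" "supported I \<delta>" unfolding \<delta>_def
    using linear_isometry_short[OF linear_isometry_reflect[OF a(1)] e_facts(1)]
      reflect_supported[OF a(2) e_facts(4) ac e_facts(2)] by auto
  have ea: "e \<bullet> \<alpha> = \<alpha> \<bullet> e" using ac by (simp add: comm_scalar_prod[of e n \<alpha>])
  show ?thesis
  proof (cases "short n \<alpha>")
    case True
    then have "\<alpha> = e \<or> \<alpha> = - e" using False short_orthogonal_disjoint e_facts by blast
    then have "reflect \<alpha> e = - e" "eqT I (m \<alpha> 1) (m e 1)"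
      using e_facts eqT_m_uminus[OF e_facts(3,4)] eqT_refl[of "m e 1"]
      by (auto simp: reflect_self reflect_uminus_root[of _ n])
    then show ?thesis using e_facts by (auto simp: coset_rep_def coset_root_def)
  next
    case notshort: False
    then have l: "\<alpha> \<bullet> \<alpha> = 2" using a by (auto simp: B_roots_def short_def)
    \<comment> \<open>The image of \<open>e\<close> is e - a0 \<alpha>, whose product with
      \<open>e\<close> is 1 - a0^2. Being short it has product at least -1, which leaves a0 =
      +-1.\<close>
    define a0 where "a0 = \<alpha> \<bullet> e"
    have de: "\<delta> = e - a0 \<cdot>\<^sub>v \<alpha>" using l by (simp add: \<delta>_def reflect_def cartan_long ea a0_def)
    have prod: "\<delta> \<bullet> e = 1 - a0 * a0" using e_facts ac unfolding de
      by (simp add: minus_scalar_prod_distrib[of _ n] short_def a0_def)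
    have "\<delta> \<bullet> e \<ge> -1"
      using d(1)
    proof (cases rule: short_e_cases)
      case 1 then show ?thesis using e_facts by (simp add: short_def)
    next
      case 2 then show ?thesis using e_facts by (simp add: short_def uminus_vec_scalar[of _ n])
    next
      case 3 then show ?thesis by simp
    qed
    then have le: "a0 * a0 \<le> 2" using prod by simp
    moreover have "a0 * a0 \<ge> 4" if "\<bar>a0\<bar> \<ge> 2"
      using that mult_mono[of 2 "\<bar>a0\<bar>" 2 "\<bar>a0\<bar>"] by simp
    ultimately have a0: "a0 = 1 \<or> a0 = - 1" using False unfolding a0_def[symmetric] by linarith
    then have "\<delta> \<bullet> e = 0" using prod by auto
    then have ne: "\<delta> \<noteq> e" "\<delta> \<noteq> - e" using e_facts by (auto simp: short_def uminus_vec_scalar[of _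
        n])
    have "\<alpha> = \<delta> - e \<or> \<alpha> = - (\<delta> - e)" using a0 ac unfolding de by (auto intro!: eq_vecI)
    moreover have "coset_rep \<delta> = m (\<delta> - e) 1" using ne by (simp add: coset_rep_def coset_root_def)
    moreover have "\<delta> - e \<in> B_roots n" "supported I (\<delta> - e)"
      using coset_root[OF d ne(1)] ne by (auto simp: coset_root_def)
    ultimately have "eqT I (m \<alpha> 1) (coset_rep \<delta>)"
      using eqT_m_uminus[of "\<delta> - e" I] eqT_refl[of "m (\<delta> - e) 1"] by auto
    then show ?thesis using ne by (simp add: \<delta>_def)
  qed
qed

text \<open>The multiplication table of the coset representatives. Each case lifts an identity of
  reflections that rewrites the product as a representative times a reflection orthogonal to
  \<open>e\<close>, or as a square.\<close>

lemma in_coset_product: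
  assumes b: "short n \<beta>" "supported I \<beta>" "\<beta> \<noteq> e" and d: "short n \<delta>" "supported I \<delta>" "\<delta> \<noteq> e"
  shows "in_coset (m (coset_root \<beta>) 1 \<otimes> m (coset_root \<delta>) 1) (reflect (coset_root \<beta>) \<delta>)"
proof -
  note E = e_facts
  note rb = coset_root[OF b] and rd = coset_root[OF d]
  have eqs: "coset_rep (- e) = m e 1" "coset_rep e = \<one>" using E
      by (auto simp: coset_rep_def coset_root_def)
  have er: "coset_root (- e) = e" by (simp add: coset_root_def)
  have me: "m e 1 \<in> carrier \<G>" using E by simp
  show ?thesis
    using b(1)
  proof (cases rule: short_e_cases)
    case 1 with b show ?thesis by simp
  next
    case be: 2
    show ?thesis using d(1)
    proof (cases rule: short_e_cases)
      case 1 with d show ?thesis by simp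
    next
      case 2
      have "reflect e (- e) = e" using E by (simp add: reflect_add(3)[of e n e] reflect_self)
      then show ?thesis unfolding be 2 er
        using eqT_m_square[OF E(3,4)] eqs by (simp add: in_coset_rep)
    next
      case 3
      note f = short_long_facts[OF d(1) E(1) 3(1)]
      have cr: "coset_root \<delta> = \<delta> - e" using 3 by (simp add: coset_root_def)
      have "reflect e \<delta> = \<delta>" using f 3 by (simp add: reflect_orthogonal[of _ n])
      moreover have "eqT I (m e 1 \<otimes> m (\<delta> - e) 1) (m (\<delta> - e) 1 \<otimes> m \<delta> 1)"
        using eqT_m_m'[OF E(3,4) rd(1,2)] reflect_diff_short(2)[OF d(1) E(1) 3(1)] cr by simp
      moreover have "coset_rep \<delta> = m (\<delta> - e) 1" using 3 by (simp add: coset_rep_def cr)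
      ultimately show ?thesis unfolding be er cr
        using supported_J[OF f(1) d(2) 3(1)] f by (auto intro!: in_coset_rep_m[of _ _ \<delta>])
    qed
  next
    case bo: 3
    note f = short_long_facts[OF b(1) E(1) bo(1)]
    have cb: "coset_root \<beta> = \<beta> - e" using bo by (simp add: coset_root_def)
    have Jb: "supported J \<beta>" using supported_J[OF f(1) b(2) bo(1)] .
    have sum: "\<beta> + e \<in> B_roots n" "supported I (\<beta> + e)"
      using f b E by (auto intro: supported_add)
    have dif: "\<beta> - e \<in> B_roots n" "supported I (\<beta> - e)"
      using rb cb by auto
    have neg: "- \<beta> - e = - (\<beta> + e)" using f by (auto intro!: eq_vecI)
    have nbe: "- \<beta> \<noteq> e" "- \<beta> \<noteq> - e" using bo(2,3) by (metis uminus_uminus_vec)+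
    have refl: "reflect (\<beta> - e) \<beta> = e" "reflect (\<beta> - e) e = \<beta>"
        using reflect_diff_short[OF b(1) E(1) bo(1)] by auto
    show ?thesis using d(1)
    proof (cases rule: short_e_cases)
      case 1 with d show ?thesis by simp
    next
      case 2
      have r1: "reflect (\<beta> - e) (- e) = - \<beta>" using refl E
          by (simp add: reflect_add(3)[OF dif(1), of e])
      have r2: "reflect \<beta> (\<beta> - e) = - (\<beta> + e)"
        using f by (simp add: reflect_add(2)[OF f(3)] reflect_self reflect_orthogonal[of e n \<beta>]
            comm_scalar_prod[of e n \<beta>])
          (auto intro!: eq_vecI)
      have "eqT I (m (\<beta> - e) 1 \<otimes> m e 1) (m \<beta> 1 \<otimes> m (\<beta> - e) 1)"
        using eqT_m_m[OF dif E(3,4)] refl by simp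
      also have "eqT I \<dots> (m (- (\<beta> + e)) 1 \<otimes> m \<beta> 1)"
        using eqT_m_m[OF f(3) b(2) dif] r2 by simp
      finally have "eqT I (m (\<beta> - e) 1 \<otimes> m e 1) (coset_rep (- \<beta>) \<otimes> m \<beta> 1)"
        using nbe by (simp add: coset_rep_def coset_root_def neg)
      then show ?thesis unfolding 2 er cb r1 using Jb f by (auto intro!: in_coset_rep_m[of _ _ \<beta>])
    next
      case do: 3
      note g = short_long_facts[OF d(1) E(1) do(1)]
      have cd: "coset_root \<delta> = \<delta> - e" using do by (simp add: coset_root_def)
      have repd: "coset_rep \<delta> = m (\<delta> - e) 1" using do by (simp add: coset_rep_def cd)
      have difd: "\<delta> - e \<in> B_roots n" "supported I (\<delta> - e)"
        using rd cd by auto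
      consider "\<delta> = \<beta>" | "\<delta> = - \<beta>" | "\<beta> \<bullet> \<delta> = 0"
        using short_orthogonal_disjoint[OF d(1) b(1)] f g by (auto simp: comm_scalar_prod[of \<beta> n \<delta>])
      then show ?thesis
      proof cases
        case 1
        then show ?thesis unfolding 1 cb refl
          using eqT_m_square[OF dif] eqs by (simp add: in_coset_rep)
      next
        case 2
        \<comment> \<open>The reflections in \<beta> - e and \<beta> + e multiply to -1 on their
          plane, and so do those in \<open>e\<close> and \<beta>. To lift this,
          \<open>m (\<beta> + e) 1\<close> is replaced by the conjugate of
          \<open>m (\<beta> - e) 1\<close> under \<open>m e 1\<close>.\<close>
        have r1: "reflect (\<beta> - e) (- \<beta>) = - e" using refl f
            by (simp add: reflect_add(3)[OF dif(1), of \<beta>])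
        have r2: "reflect e (\<beta> - e) = \<beta> + e"
          using f E bo by (simp add: reflect_add(2)[OF E(3)] reflect_self reflect_orthogonal[of \<beta> n
              e])
            (auto intro!: eq_vecI)
        have c: "m (\<beta> - e) 1 \<in> carrier \<G>" "m (\<beta> + e) 1 \<in> carrier \<G>" "m \<beta> 1 \<in> carrier \<G>"
          using dif sum f by auto
        have "eqT I (m (\<beta> + e) 1) (m (\<beta> + e) 1 \<otimes> (m e 1 \<otimes> m e 1))"
          using eqT_mult_left[OF rep_m[OF sum] eqT_sym[OF eqT_m_square[OF E(3,4)]], of 1] c by simp
        also have "eqT I \<dots> (m e 1 \<otimes> m (\<beta> - e) 1 \<otimes> m e 1)"
          using eqT_mult_right[OF eqT_sym[OF eqT_m_m[OF E(3,4) dif]] me] r2 c me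
              by (simp add: m_assoc)
        finally have "eqT I (m (\<beta> + e) 1) (m e 1 \<otimes> m (\<beta> - e) 1 \<otimes> m e 1)" .
        then have "eqT I (m (- (\<beta> + e)) 1) (m e 1 \<otimes> m (\<beta> - e) 1 \<otimes> m e 1)"
          using eqT_m_uminus[OF sum] eqT_trans by blast
        then have "eqT I (m (\<beta> - e) 1 \<otimes> m (- (\<beta> + e)) 1) (m (\<beta> - e) 1 \<otimes> m e 1 \<otimes> m (\<beta> - e) 1
            \<otimes> m e 1)"
          using eqT_mult_left[OF rep_m[OF dif], of 1] c me by (fastforce simp: m_assoc)
        also have "eqT I \<dots> (m \<beta> 1 \<otimes> m (\<beta> - e) 1 \<otimes> m (\<beta> - e) 1 \<otimes> m e 1)"
          using eqT_m_m[OF dif E(3,4)] refl c me by (auto intro!: eqT_mult_right)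
        also have "eqT I \<dots> (m \<beta> 1 \<otimes> m e 1)"
          using eqT_mult_left[OF rep_m[OF f(3) b(2)] eqT_mult_right[OF eqT_m_square[OF dif] me], of
              1] c me
          by (simp add: m_assoc)
        also have "eqT I \<dots> (m e 1 \<otimes> m \<beta> 1)"
          using eqT_m_m'[OF f(3) b(2) E(3,4)] bo f by (simp add: reflect_orthogonal[of \<beta> n e])
        finally have "eqT I (m (\<beta> - e) 1 \<otimes> m (- (\<beta> + e)) 1) (coset_rep (- e) \<otimes> m \<beta> 1)"
            by (simp add: eqs)
        moreover have "coset_root \<delta> = - (\<beta> + e)" using cd neg 2 by simp
        ultimately show ?thesis using r1 Jb f unfolding cb 2
            by (auto intro!: in_coset_rep_m[of _ _ \<beta>])
      next
        case 3
        have db: "\<delta> \<bullet> \<beta> = 0" using 3 f g by (simp add: comm_scalar_prod[of \<delta> n \<beta>])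
        have r1: "reflect (\<beta> - e) \<delta> = \<delta>" using f g db do
          by (intro reflect_orthogonal[of _ n]) (auto simp: scalar_prod_minus_distrib[of _ n])
        have r2: "reflect (\<delta> - e) (\<beta> - e) = \<beta> - \<delta>"
        proof -
          have "reflect (\<delta> - e) \<beta> = \<beta>" using f g 3 bo
            by (intro reflect_orthogonal[of _ n]) (auto simp: scalar_prod_minus_distrib[of _ n])
          then show ?thesis using f g reflect_diff_short(2)[OF d(1) E(1) do(1)]
            by (simp add: reflect_add(2)[OF difd(1), of \<beta> e])
        qed
        have "eqT I (m (\<beta> - e) 1 \<otimes> m (\<delta> - e) 1) (coset_rep \<delta> \<otimes> m (\<beta> - \<delta>) 1)"
          using eqT_m_m'[OF dif difd] r2 repd by simp
        moreover have "\<beta> - \<delta> \<in> B_roots n" using short_long_facts(6)[OF b(1) d(1) 3] .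
        moreover have "supported J (\<beta> - \<delta>)" using Jb supported_J[OF g(1) d(2) do(1)] f g
          by (intro supported_diff) auto
        ultimately show ?thesis unfolding cb cd r1 by (auto intro!: in_coset_rep_m[of _ _ "\<beta> - \<delta>"])
      qed
    qed
  qed
qed

text \<open>Conjugation moves \<open>m \<alpha> 1\<close> to the right of the representative, where
  it becomes the lift of another reflection. By \<open>root_cases\<close> this either belongs to J
  or is itself a representative, and then the multiplication table applies.\<close>

lemma in_coset_m:
  assumes a: "\<alpha> \<in> B_roots n" "supported I \<alpha>" and b: "short n \<beta>" "supported I \<beta>"
  shows "in_coset (m \<alpha> 1 \<otimes> coset_rep \<beta>) (reflect \<alpha> \<beta>)"
proof (cases "\<beta> = e")
  case True
  have "in_coset (m \<alpha> 1) e" if "supported J \<alpha>"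
    by (rule in_coset_rep_m[of _ _ \<alpha>]) (use a that in \<open>simp_all add: coset_rep_def eqT_refl\<close>)
  moreover have "m \<alpha> 1 \<otimes> coset_rep e = m \<alpha> 1" using a by (simp add: coset_rep_def)
  ultimately show ?thesis using root_cases[OF a] True
    by (auto intro: in_coset_rep)
next
  case False
  note r = coset_root[OF b False]
  define \<rho> where "\<rho> = coset_root \<beta>"
  define \<alpha>' where "\<alpha>' = reflect \<rho> \<alpha>"
  have rho: "\<rho> \<in> B_roots n" "supported I \<rho>" "reflect \<rho> e = \<beta>" using r by (auto simp: \<rho>_def)
  have a': "\<alpha>' \<in> B_roots n" "supported I \<alpha>'"
    using a rho reflect_root reflect_supported B_roots_carrier unfolding \<alpha>'_def by blast+
  have rep: "coset_rep \<beta> = m \<rho> 1" using False by (simp add: coset_rep_def \<rho>_def)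
  have eq: "eqT I (m \<alpha> 1 \<otimes> m \<rho> 1) (m \<rho> 1 \<otimes> m \<alpha>' 1)"
    using eqT_m_m'[OF a rho(1,2)] by (simp add: \<alpha>'_def)
  have img: "reflect \<alpha> \<beta> = reflect \<rho> (reflect \<alpha>' e)"
    using reflect_conjugate[OF rho(1) a'(1) e_facts(2)] rho a
    by (simp add: \<alpha>'_def reflect_reflect[of \<rho> n] B_roots_carrier)
  from root_cases[OF a'] show ?thesis
  proof
    assume "supported J \<alpha>' \<and> reflect \<alpha>' e = e"
    then show ?thesis using eq img rho a' unfolding rep[symmetric]
        by (auto intro!: in_coset_rep_m[of _ _ \<alpha>'])
  next
    define \<delta> where "\<delta> = reflect \<alpha>' e"
    assume "reflect \<alpha>' e \<noteq> e \<and> eqT I (m \<alpha>' 1) (coset_rep (reflect \<alpha>' e))"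
    then have d: "\<delta> \<noteq> e" "eqT I (m \<alpha>' 1) (m (coset_root \<delta>) 1)" by (auto simp: \<delta>_def coset_rep_def)
    have "short n \<delta>" "supported I \<delta>" unfolding \<delta>_def
      using linear_isometry_short[OF linear_isometry_reflect[OF a'(1)] e_facts(1)]
        reflect_supported[OF a'(2) e_facts(4) B_roots_carrier[OF a'(1)] e_facts(2)] by auto
    then have "in_coset (m \<rho> 1 \<otimes> m (coset_root \<delta>) 1) (reflect \<rho> \<delta>)"
      using in_coset_product[OF b False _ _ d(1)] by (simp add: \<rho>_def)
    then show ?thesis using eqT_trans[OF eq eqT_mult_left[OF rep_m[OF rho(1,2)] d(2), of 1]]
      unfolding rep img \<delta>_def by (auto intro: in_coset_eqT)
  qed
qed

text \<open>Induction on the word: \<open>in_coset_m\<close> handles one new letter, so the label of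
  the coset is always the current image of \<open>e\<close>.\<close>

lemma rep_in_coset: "rep I g w \<Longrightarrow> in_coset g (w e)"
proof (induction rule: rep.induct)
  case rep_one
  show ?case by (rule in_coset_rep) (simp add: coset_rep_def eqT_refl)
next
  case (rep_step g w \<alpha> c)
  have s: "short n (w e)" "supported I (w e)"
    using linear_isometry_short[OF rep_isometry[OF rep_step(1)] e_facts(1)]
      rep_supported[OF rep_step(1) e_facts(2,4)] .
  note s' = linear_isometry_short[OF linear_isometry_reflect[OF rep_step(2)] s(1)]
    reflect_supported[OF rep_step(3) s(2) B_roots_carrier[OF rep_step(2)] short_carrier[OF s(1)]]
  obtain k v where k: "rep J k v" "eqT I g (coset_rep (w e) \<otimes> k)"
    using rep_step.IH by (auto simp: in_coset_def)
  have "eqT I (m \<alpha> c \<otimes> g) (m \<alpha> 1 \<otimes> g)"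
    by (rule eqT_mult_right[OF eqT_m_scalar[OF rep_step(2-4)] rep_closed[OF rep_step(1)]])
  also have "eqT I \<dots> (m \<alpha> 1 \<otimes> (coset_rep (w e) \<otimes> k))"
    using eqT_mult_left[OF rep_m[OF rep_step(2,3)] k(2), of 1] by simp
  also have "m \<alpha> 1 \<otimes> (coset_rep (w e) \<otimes> k) = m \<alpha> 1 \<otimes> coset_rep (w e) \<otimes> k"
    using coset_rep_closed[OF s] rep_closed[OF k(1)] rep_step(2) by (simp add: m_assoc)
  finally have "eqT I (m \<alpha> c \<otimes> g) (m \<alpha> 1 \<otimes> coset_rep (w e) \<otimes> k)" .
  then show ?case using in_coset_mult[OF in_coset_m[OF rep_step(2,3) s] k(1) s'] in_coset_eqT
      by blast
qed

end

context chevalley_group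
begin

lemma T_rep: "t \<in> T I \<Longrightarrow> \<exists>w. rep I t w \<and> (\<forall>v \<in> carrier_vec n. w v = v)"
  unfolding T_def
proof (induction rule: generate.induct)
  case one
  then show ?case using rep_one by (intro exI[of _ "\<lambda>v. v"]) simp
next
  case (incl y)
  then show ?case by (auto simp: T_gens_def supported_unit short_unit short_root intro!: rep_h)
next
  case (inv y)
  then show ?case by (auto simp: T_gens_def supported_unit short_unit short_root intro!: rep_h simp
      flip: h_inverse)
next
  case (eng a b)
  then obtain v w where "rep I a v" "rep I b w" "\<forall>u \<in> carrier_vec n. v u = u"
      "\<forall>u \<in> carrier_vec n. w u = u" by blast
  then show ?case using rep_mult by (intro exI[of _ "\<lambda>u. v (w u)"]) auto
qed

text \<open>Induction on the coordinates. If w fixes e_j, the coset has the trivial representative,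
  so g is a torus element times a lift over the remaining coordinates. With no coordinates left
  there are no roots.\<close>

theorem rep_kernel:
  assumes "finite I" "I \<subseteq> {..<n}" "rep I g w" "\<And>i. i \<in> I \<Longrightarrow> w (unit_vec n i) = unit_vec n i"
  shows "g \<in> T I"
  using assms
proof (induction I arbitrary: g w rule: finite_induct)
  case empty
  have "\<alpha> \<notin> B_roots n" if "supported {} \<alpha>" for \<alpha>
  proof
    assume a: "\<alpha> \<in> B_roots n"
    then have "\<alpha> = - \<alpha>" using that B_roots_carrier[OF a]
        by (auto simp: supported_def intro!: eq_vecI)
    with root_nonzero[OF a] show False by simp
  qed
  with empty(2) have "g = \<one>" by (cases rule: rep.cases) auto
  then show ?case by (simp add: T_one)
next
  case (insert j J)
  then interpret coset_enumeration \<G> n x j J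
    by unfold_locales auto
  have "in_coset g (unit_vec n j)" using rep_in_coset[OF insert.prems(2)] insert.prems(3)[of j]
      by simp
  then obtain k v where k: "rep J k v" "eqT (insert j J) g (coset_rep (unit_vec n j) \<otimes> k)"
      by (auto simp: in_coset_def)
  then obtain t where t: "t \<in> T (insert j J)" "g = t \<otimes> k"
    using rep_closed[OF k(1)] by (auto simp: coset_rep_def eqT_def)
  obtain u where u: "rep (insert j J) t u" "\<forall>v \<in> carrier_vec n. u v = v" using T_rep[OF t(1)]
      by blast
  have "v (unit_vec n i) = unit_vec n i" if i: "i \<in> J" for i
  proof -
    have s: "short n (unit_vec n i)" using insert.prems(1) i by (auto intro: short_unit)
    have sv: "short n (v (unit_vec n i))" using linear_isometry_short[OF rep_isometry[OF k(1)] s] .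
    \<comment> \<open>The factor k comes with its own map v, not yet related to w. Both maps
      describe the action of g on short root subgroups, so uniqueness transfers the fixed vectors
      from w to v.\<close>
    have "x_equivariant g (\<lambda>y. u (v y))"
      using rep_equivariant[OF rep_mult[OF u(1) rep_mono[OF k(1), of "insert j J"]]] t(2) by auto
    then have "w (unit_vec n i) = u (v (unit_vec n i))"
      using x_equivariant_unique[OF rep_equivariant[OF insert.prems(2)], of _
          "unit_vec n i"] s sv u(2) i
        linear_isometry_short[OF rep_isometry[OF insert.prems(2)] s]
      by (simp add: short_root short_carrier)
    then show ?thesis using insert.prems(3)[of i] i u(2) sv by (simp add: short_carrier)
  qed
  then have "k \<in> T J" using insert.IH[OF _ k(1)] insert.prems(1) by blast
  then show ?case using t T_mult T_mono[of J "insert j J"] by blast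
qed

end

section \<open>Powers of representatives\<close>

text \<open>The period divides 2k. A nonzero remainder r of d modulo 2k would give - u already at
  step k - r or r - k, against minimality, or u = - u if r = k.\<close>

lemma neg_orbit_dvd:
  assumes k: "k > 0" "(w ^^ k) u = - (u :: int vec)" and lin: "\<And>l. (w ^^ l) (- u) = - (w ^^ l) u"
    and min: "\<And>i. 0 < i \<Longrightarrow> i < k \<Longrightarrow> (w ^^ i) u \<noteq> - u" and ne: "u \<noteq> - u" and d: "(w ^^ d) u = u"
  shows "2 * k dvd d"
proof -
  have per: "(w ^^ (2 * k)) u = u"
    using k lin by (simp add: mult_2 funpow_add)
  then have "(w ^^ (q * (2 * k))) u = u" for q
    by (induction q) (simp_all add: funpow_add)
  moreover define r where "r = d mod (2 * k)"
  moreover have "d = r + (d div (2 * k)) * (2 * k)" by (simp only: r_def mod_div_mult_eq)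
  ultimately have r: "(w ^^ r) u = u" using d by (metis comp_apply funpow_add)
  have "r < 2 * k" using k by (simp add: r_def)
  have "r = 0"
  proof (rule ccontr)
    assume r0: "r \<noteq> 0"
    show False
    proof (cases "r \<le> k")
      case True
      have "(w ^^ (k - r)) ((w ^^ r) u) = (w ^^ (k - r + r)) u"
          by (simp only: funpow_add comp_apply)
      also have "\<dots> = - u" using True k by simp
      finally have "(w ^^ (k - r)) u = - u" by (simp only: r)
      then show False using min[of "k - r"] r0 True ne by (cases "k = r") auto
    next
      case False
      have "(w ^^ (r - k)) ((w ^^ k) u) = (w ^^ (r - k + k)) u"
          by (simp only: funpow_add comp_apply)
      also have "\<dots> = u" using False r by simp
      finally have "- (w ^^ (r - k)) u = u" by (simp only: k lin)
      then have "(w ^^ (r - k)) u = - u" by (metis uminus_uminus_vec)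
      then show False using min[of "r - k"] False \<open>r < 2 * k\<close> by simp
    qed
  qed
  then show ?thesis by (simp add: r_def mod_eq_0_iff_dvd)
qed

lemma linear_isometry_funpow_uminus:
  assumes "linear_isometry n w" "u \<in> carrier_vec n"
  shows "(w ^^ l) (- u) = - (w ^^ l) u"
  using linear_isometryD(2)[OF linear_isometry_funpow[OF assms(1)] assms(2,2)] .

text \<open>The orbit sum of \<open>u\<close> is fixed by \<open>w\<close>, hence zero, so some orbit element has a negative
  scalar product with \<open>u\<close>.\<close>

lemma elliptic_orbit:
  assumes w: "linear_isometry n w" and ell: "\<And>v. v \<in> carrier_vec n \<Longrightarrow> w v = v \<Longrightarrow> v = 0\<^sub>v n"
    and u: "short n u" and d: "d > 0" "(w ^^ d) u = u"
  obtains k where "k > 0" "(w ^^ k) u = - u" "\<And>j. (w ^^ j) u = u \<Longrightarrow> 2 * k dvd j"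
proof -
  define S where "S l = foldr (+) (map (\<lambda>i. (w ^^ i) u) (rev [0..<l])) (0\<^sub>v n)" for l
  have S: "S 0 = 0\<^sub>v n" "S (Suc l) = (w ^^ l) u + S l" for l by (simp_all add: S_def)
  have uc: "u \<in> carrier_vec n" "u \<bullet> u = 1" using u by (auto simp: short_def)
  have wc: "(w ^^ l) u \<in> carrier_vec n" for l
    using linear_isometryD(1)[OF linear_isometry_funpow[OF w] uc(1) uc(1)] .
  have Sc: "S l \<in> carrier_vec n" for l by (induction l) (auto simp: S wc)
  have w0: "w (0\<^sub>v n) = 0\<^sub>v n"
    using linear_isometryD(1,4)[OF w, of "0\<^sub>v n" "0\<^sub>v n"] by simp
  have wS: "w (S l) + u = (w ^^ l) u + S l" for l
  proof (induction l)
    case 0 then show ?case using uc w0 by (simp add: S)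
  next
    case (Suc l)
    have "w (S (Suc l)) + u = w ((w ^^ l) u) + (w (S l) + u)"
      using linear_isometryD(1,3)[OF w wc Sc] linear_isometryD(1)[OF w Sc Sc] uc
          by (simp add: S assoc_add_vec[of _ n])
    then show ?case by (simp add: Suc.IH S)
  qed
  have "w (S d) = S d"
  proof -
    have eq: "w (S d) + u = S d + u" using wS[of d] d Sc uc by (simp add: comm_add_vec[of u n])
    have "w (S d) $ i = S d $ i" if "i < n" for i
      using that arg_cong[OF eq, of "\<lambda>v. v $ i"] linear_isometryD(1)[OF w Sc Sc, of d] Sc[of d] uc
          by simp
    then show ?thesis using linear_isometryD(1)[OF w Sc Sc, of d] Sc[of d] by (intro eq_vecI) auto
  qed
  then have S0: "S d = 0\<^sub>v n" using ell Sc by blast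
  have "\<exists>l<d. (w ^^ l) u = - u"
  proof (rule ccontr)
    assume none: "\<not> ?thesis"
    have nn: "(w ^^ l) u \<bullet> u \<ge> 0" if "l < d" for l
    proof (cases "(w ^^ l) u \<bullet> u = 0")
      case False
      then have "(w ^^ l) u = u"
        using short_orthogonal_disjoint[OF linear_isometry_short[OF linear_isometry_funpow[OF w] u]
            u] none that by blast
      then show ?thesis using uc by simp
    qed simp
    \<comment> \<open>The summand of index 0 is u itself and contributes 1; the others are
      nonnegative. For l = d this contradicts the vanishing of the orbit sum.\<close>
    have "S l \<bullet> u \<ge> 1" if "0 < l" "l \<le> d" for l
      using that
    proof (induction l)
      case (Suc l)
      have "S (Suc l) \<bullet> u = (w ^^ l) u \<bullet> u + S l \<bullet> u"
        using wc Sc uc by (simp add: S add_scalar_prod_distrib[of _ n])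
      then show ?case using Suc nn[of l] uc by (cases "l = 0") (auto simp: S)
    qed simp
    from this[of d] d S0 uc show False by simp
  qed
  then obtain l where l: "(w ^^ l) u = - u" by blast
  define k where "k = (LEAST k. (w ^^ k) u = - u)"
  have k: "(w ^^ k) u = - u" unfolding k_def using l by (rule LeastI)
  have ne: "u \<noteq> - u" using root_nonzero short_root[OF u] .
  then have "k > 0" using k by (metis funpow_0 gr0I)
  moreover have "(w ^^ i) u \<noteq> - u" if "i < k" for i using not_less_Least that unfolding k_def .
  ultimately show thesis
    using that[OF _ k] neg_orbit_dvd[OF _ k linear_isometry_funpow_uminus[OF w uc(1)] _ ne] by blast
qed

context chevalley_group
begin

lemma rep_z_commute: "rep I g w \<Longrightarrow> g \<otimes> z = z \<otimes> g"
  using rep_cj_z rep_closed by (simp add: cj_fixed_iff)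

lemma z_pow_commute: "rep I g w \<Longrightarrow> g \<otimes> z [^] (k::nat) = z [^] k \<otimes> g"
proof (induction k)
  case (Suc k)
  have "g \<otimes> (z [^] k \<otimes> z) = z [^] k \<otimes> (g \<otimes> z)"
    using Suc rep_closed by (simp flip: m_assoc)
  then show ?case using rep_z_commute[OF Suc.prems] rep_closed[OF Suc.prems] by (simp add: m_assoc)
qed (simp add: rep_closed)

lemma z_pow_mod: "z [^] (k::nat) = (if even k then \<one> else z)"
  by (induction k) (auto simp: nat_pow_Suc)

lemma z_pow_add: "z [^] (j::nat) \<otimes> z [^] (k::nat) = z [^] (j + k)"
  by (simp add: nat_pow_mult)

section \<open>Clifford products of short generators\<close>

definition Q :: "nat list \<Rightarrow> 'a" where
  "Q js = foldr (\<lambda>j y. m (unit_vec n j) 1 \<otimes> y) js \<one>"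

lemma Q_simps: "Q [] = \<one>" "Q (j # js) = m (unit_vec n j) 1 \<otimes> Q js"
  by (simp_all add: Q_def)

lemma Q_rep:
  assumes "set js \<subseteq> {..<n}" "distinct js"
  shows "\<exists>w. rep (set js) (Q js) w \<and> (\<forall>i<n. w (unit_vec n i)
      = (if i \<in> set js then - unit_vec n i else unit_vec n i))"
  using assms
proof (induction js)
  case Nil
  then show ?case by (intro exI[of _ "\<lambda>v. v"]) (simp add: Q_simps rep_one)
next
  case (Cons j js)
  then obtain w where w: "rep (set js) (Q js) w"
    "\<And>i. i < n \<Longrightarrow> w (unit_vec n i) = (if i \<in> set js then - unit_vec n i else unit_vec n i)" by auto
  have j: "j < n" "j \<notin> set js" using Cons.prems by auto
  let ?e = "unit_vec n j :: int vec"
  have e: "?e \<in> B_roots n" "?e \<in> carrier_vec n" using j short_root[OF short_unit] by auto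
  have "rep (set (j # js)) (Q (j # js)) (\<lambda>v. reflect ?e (w v))"
    unfolding Q_simps using j e rep_mono[OF w(1)]
    by (intro rep_step) (auto simp: supported_unit)
  moreover have "reflect ?e (unit_vec n i) = (if i = j then - ?e else unit_vec n i)" if
      "i < n" for i
    using e j that by (auto simp: reflect_self intro!: reflect_orthogonal[of _ n])
  moreover have "reflect ?e (- unit_vec n i) = (if i = j then ?e else - unit_vec n i)" if
      "i < n" for i
    using e that calculation(2)[OF that] reflect_add(3)[OF e(1), of "unit_vec n i" "unit_vec n i"]
        by simp
  ultimately show ?case using w(2) j
    by (intro exI[of _ "\<lambda>v. reflect ?e (w v)"]) auto
qed

lemma Q_anticommute:
  assumes "set js \<subseteq> {..<n}" "j < n" "j \<notin> set js" "distinct js"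
  shows "m (unit_vec n j) 1 \<otimes> Q js = z [^] length js \<otimes> (Q js \<otimes> m (unit_vec n j) 1)"
  using assms
proof (induction js)
  case Nil
  then show ?case by (simp add: Q_simps short_root short_unit)
next
  case (Cons i js)
  let ?q = "m (unit_vec n j) 1" and ?p = "m (unit_vec n i) 1"
  obtain w where w: "rep (set js) (Q js) w" using Q_rep[of js] Cons.prems by auto
  have c: "?q \<in> carrier \<G>" "?p \<in> carrier \<G>" "Q js \<in> carrier \<G>"
    using Cons.prems rep_closed[OF w] by (auto simp: short_root short_unit)
  have p: "rep {..<n} ?p (reflect (unit_vec n i))" using Cons.prems
    by (intro rep_m) (auto simp: short_root short_unit supported_unit)
  have "?q \<otimes> ?p = z \<otimes> (?p \<otimes> ?q)"
    using Cons.prems by (intro m_short_anticommute) (auto simp: short_unit)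
  then have "?q \<otimes> (?p \<otimes> Q js) = z \<otimes> (?p \<otimes> (?q \<otimes> Q js))"
    using c by (simp flip: m_assoc)
  also have "?q \<otimes> Q js = z [^] length js \<otimes> (Q js \<otimes> ?q)"
    using Cons by auto
  also have "z \<otimes> (?p \<otimes> (z [^] length js \<otimes> (Q js \<otimes> ?q))) = (z \<otimes> z [^] length js) \<otimes> (?p \<otimes> Q js \<otimes> ?q)"
  proof -
    have "?p \<otimes> (z [^] length js \<otimes> y) = z [^] length js \<otimes> (?p \<otimes> y)" if "y \<in> carrier \<G>" for y
      using z_pow_commute[OF p, of "length js"] c that by (simp flip: m_assoc)
    then show ?thesis using c by (simp add: m_assoc)
  qed
  also have "z \<otimes> z [^] length js = z [^] length (i # js)"
    by (subst nat_pow_Suc2[symmetric]) simp_all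
  finally show ?case using c by (simp add: Q_simps m_assoc)
qed

text \<open>Prepending a generator to a product of k others costs k exchanges and one square, and
  the triangular numbers grow by k + 1.\<close>

lemma Q_square:
  assumes "set js \<subseteq> {..<n}" "distinct js"
  shows "Q js \<otimes> Q js = z [^] (length js * (length js + 1) div 2)"
  using assms
proof (induction js)
  case Nil
  then show ?case by (simp add: Q_simps)
next
  case (Cons j js)
  let ?q = "m (unit_vec n j) 1" and ?k = "length js"
  obtain w where w: "rep (set js) (Q js) w" using Q_rep[of js] Cons.prems by auto
  have c: "?q \<in> carrier \<G>" "Q js \<in> carrier \<G>"
    using Cons.prems rep_closed[OF w] by (auto simp: short_root short_unit)
  have "Q js \<otimes> ?q = z [^] ?k \<otimes> (?q \<otimes> Q js)"
  proof -
    have "z [^] ?k \<otimes> (?q \<otimes> Q js) = z [^] ?k \<otimes> (z [^] ?k \<otimes> (Q js \<otimes> ?q))"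
      using Q_anticommute[of js j] Cons.prems by simp
    also have "\<dots> = Q js \<otimes> ?q" using c by (simp add: z_pow_add z_pow_mod flip: m_assoc)
    finally show ?thesis by simp
  qed
  then have "?q \<otimes> Q js \<otimes> (?q \<otimes> Q js) = ?q \<otimes> (z [^] ?k \<otimes> (?q \<otimes> Q js)) \<otimes> Q js"
    using c by (simp add: m_assoc flip: m_assoc[of "Q js" ?q])
  also have "\<dots> = z [^] ?k \<otimes> (?q \<otimes> ?q) \<otimes> (Q js \<otimes> Q js)"
  proof -
    have "rep {..<n} ?q (reflect (unit_vec n j))" using Cons.prems
      by (intro rep_m) (auto simp: short_root short_unit supported_unit)
    then have "?q \<otimes> z [^] ?k = z [^] ?k \<otimes> ?q" by (rule z_pow_commute)
    then show ?thesis using c by (simp add: m_assoc) (simp flip: m_assoc)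
  qed
  also have "?q \<otimes> ?q = z [^] (1::nat)" using Cons.prems by (simp add: m_short_square short_unit)
  also have "Q js \<otimes> Q js = z [^] (?k * (?k + 1) div 2)" using Cons by simp
  also have "z [^] ?k \<otimes> z [^] (1::nat) \<otimes> z [^] (?k * (?k + 1) div 2) = z [^] (?k + 1 + ?k * (?k
      + 1) div 2)"
    by (simp only: z_pow_add)
  also have "?k + 1 + ?k * (?k + 1) div 2 = length (j # js) * (length (j # js) + 1) div 2"
    by (simp add: algebra_simps)
  finally show ?case by (simp add: Q_simps)
qed

text \<open>Negated roots have inverse values of \<open>h\<close>, and inversion is a homomorphism
  because \<open>T I\<close> is commutative.\<close>

lemma T_inverted:
  assumes g: "rep J g w" and neg: "\<And>i. i \<in> I \<Longrightarrow> i < n \<Longrightarrow> w (unit_vec n i) = - unit_vec n i" and t: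
      "t \<in> T I"
  shows "cj g t = inv t"
  using t unfolding T_def
proof (induction rule: generate.induct)
  case one
  then show ?case using rep_closed[OF g] by simp
next
  case (incl y)
  then show ?case using rep_cj_h[OF g] neg by (auto simp: T_gens_def short_root short_unit h_uminus)
next
  case (inv y)
  then show ?case using rep_cj_h[OF g] neg rep_closed[OF g]
    by (auto simp: T_gens_def short_root short_unit h_uminus cj_inv)
next
  case (eng a b)
  then have ab: "a \<in> T I" "b \<in> T I" by (auto simp: T_def)
  then show ?case using eng T_commute[OF ab] rep_closed[OF g] T_carrier
    by (simp add: cj_mult inv_mult_group[symmetric])
qed

theorem half_turn_square:
  assumes I: "I \<subseteq> {..<n}" and c: "rep I c w"
    and neg: "\<And>i. i \<in> I \<Longrightarrow> (w ^^ k) (unit_vec n i) = - unit_vec n i"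
  shows "c [^] (2 * k) = z [^] (card I * (card I + 1) div 2)"
proof -
  have fin: "finite I" using I finite_subset by blast
  obtain js where js: "set js = I" "distinct js" using finite_distinct_list[OF fin] by blast
  obtain v where v0: "rep I (Q js) v" "\<forall>i<n. v (unit_vec n i)
      = (if i \<in> I then - unit_vec n i else unit_vec n i)"
    using Q_rep[of js] I js by auto
  have v: "rep I (Q js) v" "v (unit_vec n i) = - unit_vec n i" if "i \<in> I" for i
    using v0 that I by auto
  obtain v' where v': "rep I (inv (Q js)) v'" "\<And>u. u \<in> carrier_vec n \<Longrightarrow> v' (v u) = u"
    using rep_inverse[OF v0(1)] by blast
  have ck: "rep I (c [^] k) (w ^^ k)" using rep_pow[OF c] .
  have cl: "c [^] k \<in> carrier \<G>" "Q js \<in> carrier \<G>" using rep_closed[OF ck] rep_closed[OF v0(1)] .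
  define t where "t = c [^] k \<otimes> inv (Q js)"
  \<comment> \<open>Both factors lie over -1 on the coordinates in I. That the quotient lies in the
    torus of I, not merely in the full torus, is what lets \<open>Q js\<close> invert it.\<close>
  have "t \<in> T I" unfolding t_def
  proof (rule rep_kernel[OF fin I rep_mult[OF ck v'(1)]])
    fix i assume i: "i \<in> I"
    then have e: "unit_vec n i = - (v (unit_vec n i))" using v(2) by auto
    have "v' (- v (unit_vec n i)) = - v' (v (unit_vec n i))"
      using linear_isometryD(2)[OF rep_isometry[OF v'(1)], of "v (unit_vec n i)" "v (unit_vec n i)"]
        linear_isometryD(1)[OF rep_isometry[OF v0(1)], of "unit_vec n i" "unit_vec n i"] by simp
    then have "v' (unit_vec n i) = - unit_vec n i" using e v'(2) by simp
    then show "(w ^^ k) (v' (unit_vec n i)) = unit_vec n i"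
      using linear_isometryD(2)[OF rep_isometry[OF ck], of "unit_vec n i" "unit_vec n i"] neg[OF i]
          by simp
  qed
  have ct: "c [^] k = t \<otimes> Q js" and tc: "t \<in> carrier \<G>" using cl by (auto simp: t_def m_assoc)
  have "c [^] (2 * k) = c [^] k \<otimes> c [^] k" using rep_closed[OF c] by (simp add: nat_pow_mult mult_2)
  also have "\<dots> = t \<otimes> cj (Q js) t \<otimes> (Q js \<otimes> Q js)" unfolding ct using tc cl
      by (simp add: cj_def word_simps)
  also have "cj (Q js) t = inv t" using T_inverted[OF v0(1) v(2) \<open>t \<in> T I\<close>] by simp
  also have "Q js \<otimes> Q js = z [^] (card I * (card I + 1) div 2)"
    using Q_square[of js] js I distinct_card[OF js(2)] by simp
  finally show ?thesis using tc by simp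
qed

section \<open>Independence of the power from the representative\<close>

lemma h_mult_pow:
  assumes g: "rep I g w" and v: "short n v" and s: "s \<noteq> 0" and k: "(w ^^ k) v = - v"
  shows "(h v s \<otimes> g) [^] (2 * k) = g [^] (2 * k)"
proof -
  have gc: "g \<in> carrier \<G>" and hc: "h v s \<in> carrier \<G>" using rep_closed[OF g] v
      by (auto simp: short_root)
  \<comment> \<open>The l-th power of h g is g^l times the product of the h at the first l orbit
    members. Each of these is inverted by \<open>g [^] k\<close>, since powers of w commute;
    squaring at l = k cancels their product.\<close>
  define S where "S = {t \<in> T {..<n}. cj (g [^] k) t = inv t}"
  have S_mult: "a \<otimes> b \<in> S" if "a \<in> S" "b \<in> S" for a b
  proof -
    have ab: "a \<in> T {..<n}" "b \<in> T {..<n}" and c: "a \<in> carrier \<G>" "b \<in> carrier \<G>"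
      using that T_carrier by (auto simp: S_def)
    then have "cj (g [^] k) (a \<otimes> b) = inv (a \<otimes> b)"
      using T_commute[OF ab] that gc by (simp add: S_def cj_mult inv_mult_group[symmetric])
    then show ?thesis using ab by (simp add: S_def T_mult)
  qed
  have wl: "short n ((w ^^ l) v)" for l
    using linear_isometry_short[OF linear_isometry_funpow[OF rep_isometry[OF g]] v] .
  have hS: "h ((w ^^ l) v) s \<in> S" for l
  proof -
    have "cj (g [^] k) (h ((w ^^ l) v) s) = h ((w ^^ k) ((w ^^ l) v)) s"
      using rep_cj_h[OF rep_pow[OF g]] wl s by (simp add: short_root)
    also have "(w ^^ k) ((w ^^ l) v) = (w ^^ l) ((w ^^ k) v)"
      by (metis add.commute comp_apply funpow_add)
    also have "\<dots> = - (w ^^ l) v"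
      unfolding k using linear_isometry_funpow_uminus[OF rep_isometry[OF g] short_carrier[OF v]] .
    finally show ?thesis using wl[of l] s
      by (auto simp: S_def h_uminus short_root intro!: h_short_T supported_all[of _ n]
          short_carrier)
  qed
  have "\<exists>y \<in> S. (h v s \<otimes> g) [^] l = y \<otimes> g [^] l" for l :: nat
  proof (induction l)
    case 0
    have "\<one> \<in> S" using gc by (simp add: S_def T_one)
    then show ?case by (auto intro!: bexI[of _ \<one>])
  next
    case (Suc l)
    then obtain y where y: "y \<in> S" "(h v s \<otimes> g) [^] l = y \<otimes> g [^] l" by blast
    have yc: "y \<in> carrier \<G>" using y(1) T_carrier by (auto simp: S_def)
    have "(h v s \<otimes> g) [^] Suc l = y \<otimes> cj (g [^] l) (h v s) \<otimes> g [^] Suc l"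
      using yc gc hc by (simp add: y cj_def word_simps)
    moreover have "cj (g [^] l) (h v s) = h ((w ^^ l) v) s"
      using rep_cj_h[OF rep_pow[OF g]] v s by (simp add: short_root)
    ultimately show ?case using S_mult[OF y(1) hS] by auto
  qed
  then obtain y where y: "y \<in> S" "(h v s \<otimes> g) [^] k = y \<otimes> g [^] k" by blast
  have yc: "y \<in> carrier \<G>" "cj (g [^] k) y = inv y" using y(1) T_carrier by (auto simp: S_def)
  have "(h v s \<otimes> g) [^] (2 * k) = (h v s \<otimes> g) [^] k \<otimes> (h v s \<otimes> g) [^] k"
    using hc gc by (simp add: nat_pow_mult mult_2)
  also have "\<dots> = y \<otimes> cj (g [^] k) y \<otimes> (g [^] k \<otimes> g [^] k)" unfolding y(2) using yc(1) gc
      by (simp add: cj_def word_simps)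
  also have "\<dots> = g [^] (2 * k)" using yc gc by (simp add: nat_pow_mult mult_2)
  finally show ?thesis .
qed

text \<open>Ellipticity in the form that the cancellation uses. The half period k may differ from
  orbit to orbit, but 2k always divides d.\<close>

definition elliptic_exponent :: "nat \<Rightarrow> (int vec \<Rightarrow> int vec) \<Rightarrow> bool" where
  "elliptic_exponent d w \<longleftrightarrow> (\<forall>i<n. \<exists>k. 2 * k dvd d \<and> (w ^^ k) (unit_vec n i) = - unit_vec n i)"

lemma funpow_agree:
  fixes f g :: "int vec \<Rightarrow> int vec"
  assumes "\<And>v. v \<in> carrier_vec n \<Longrightarrow> f v = g v" "\<And>v. v \<in> carrier_vec n \<Longrightarrow> g v \<in> carrier_vec n"
      "v \<in> carrier_vec n"
  shows "(f ^^ k) v = (g ^^ k) v \<and> (g ^^ k) v \<in> carrier_vec n"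
  using assms by (induction k) auto

text \<open>The representative is generalised, so that factors of t can be absorbed into it one at a
  time: b g lies over the same map as g on \<open>carrier_vec n\<close>, and
  \<open>elliptic_exponent\<close> persists.\<close>

lemma T_mult_pow:
  assumes t: "t \<in> T {..<n}"
  shows "rep {..<n} g w \<Longrightarrow> elliptic_exponent d w \<Longrightarrow> (t \<otimes> g) [^] d = g [^] d"
  using t unfolding T_def
proof (induction arbitrary: g w rule: generate.induct)
  case one
  then show ?case using rep_closed by simp
next
  case (incl y)
  then obtain i s where y: "y = h (unit_vec n i) s" "i < n" "s \<noteq> 0" by (auto simp: T_gens_def)
  then obtain k q where k: "d = 2 * k * q" "(w ^^ k) (unit_vec n i) = - unit_vec n i"
    using incl by (auto simp: elliptic_exponent_def dvd_def)
  have "(y \<otimes> g) [^] (2 * k) = g [^] (2 * k)"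
    unfolding y(1) using h_mult_pow[OF incl(2) short_unit[OF y(2)] y(3) k(2)] .
  then show ?case using rep_closed[OF incl(2)] y unfolding k(1)
    by (simp add: short_root short_unit flip: nat_pow_pow)
next
  case (inv y)
  then obtain i s where y: "inv y = h (unit_vec n i) (inverse s)" "i < n" "s \<noteq> 0"
    by (auto simp: T_gens_def h_inverse short_root short_unit)
  then obtain k q where k: "d = 2 * k * q" "(w ^^ k) (unit_vec n i) = - unit_vec n i"
    using inv by (auto simp: elliptic_exponent_def dvd_def)
  have "(inv y \<otimes> g) [^] (2 * k) = g [^] (2 * k)"
    unfolding y(1) using h_mult_pow[OF inv(2) short_unit[OF y(2)] _ k(2)] y(3) by simp
  moreover have "inv y \<in> carrier \<G>" using y by (simp add: short_root short_unit)
  ultimately show ?case using rep_closed[OF inv(2)] unfolding k(1)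
    by (simp flip: nat_pow_pow)
next
  case (eng a b)
  have ab: "a \<in> T {..<n}" "b \<in> T {..<n}" using eng by (auto simp: T_def)
  obtain u where u: "rep {..<n} b u" "\<And>v. v \<in> carrier_vec n \<Longrightarrow> u v = v" using T_rep[OF ab(2)]
      by blast
  have wc: "w v \<in> carrier_vec n" if "v \<in> carrier_vec n" for v
    using linear_isometryD(1)[OF rep_isometry[OF eng.prems(1)] that that] .
  have "elliptic_exponent d (\<lambda>v. u (w v))"
    using eng.prems(2) funpow_agree[of "\<lambda>v. u (w v)" w] u(2) wc
        by (fastforce simp: elliptic_exponent_def)
  then have "(a \<otimes> (b \<otimes> g)) [^] d = (b \<otimes> g) [^] d"
    using eng.IH(1) rep_mult[OF u(1) eng.prems(1)] by blast
  also have "\<dots> = g [^] d" using eng by blast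
  finally show ?case using T_carrier ab rep_closed[OF eng.prems(1)] by (simp add: m_assoc)
qed

text \<open>Two representatives differ by a torus element, by \<open>rep_kernel\<close>. This allows
  an arbitrary one to be replaced by an explicit product of lifts of Coxeter elements.\<close>

theorem rep_pow_independent:
  assumes g: "rep {..<n} g w" and k: "rep {..<n} k v" and e: "elliptic_exponent d v"
    and agree: "\<And>i. i < n \<Longrightarrow> w (unit_vec n i) = v (unit_vec n i)"
  shows "g [^] d = k [^] d"
proof -
  obtain v' where v': "rep {..<n} (inv k) v'" "\<And>u. u \<in> carrier_vec n \<Longrightarrow> v (v' u) = u"
    using rep_inverse[OF k] by blast
  have c: "g \<in> carrier \<G>" "k \<in> carrier \<G>" using rep_closed g k by auto
  have "g \<otimes> inv k \<in> T {..<n}"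
  proof (rule rep_kernel[OF _ _ rep_mult[OF g v'(1)]])
    fix i assume i: "i \<in> {..<n}"
    \<comment> \<open>\<open>agree\<close> speaks of coordinate vectors only. The inverse map takes
      one to plus or minus another, and both maps commute with negation.\<close>
    then have "short n (v' (unit_vec n i))"
      using linear_isometry_short[OF rep_isometry[OF v'(1)] short_unit] by simp
    then obtain j where j: "j < n" "v' (unit_vec n i) = unit_vec n j \<or> v' (unit_vec n i)
        = - unit_vec n j"
      by (rule short_cases)
    then have "w (v' (unit_vec n i)) = v (v' (unit_vec n i))"
      using agree[OF j(1)] linear_isometryD(2)[OF rep_isometry[OF g], of "unit_vec n j"
          "unit_vec n j"]
        linear_isometryD(2)[OF rep_isometry[OF k], of "unit_vec n j" "unit_vec n j"] by auto
    then show "w (v' (unit_vec n i)) = unit_vec n i" using v'(2) by simp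
  qed auto
  then have "(g \<otimes> inv k \<otimes> k) [^] d = k [^] d" using T_mult_pow[OF _ k e] by blast
  then show ?thesis using c by (simp add: m_assoc)
qed

end

section \<open>Coxeter elements\<close>

text \<open>The Gram matrix condition of \<open>B_base\<close>, restated so that induction can
  remove the first node of the diagram. An empty chain is excluded because the last node must be
  short.\<close>

fun B_chain :: "int vec list \<Rightarrow> bool" where
  "B_chain [] \<longleftrightarrow> False"
| "B_chain [\<beta>] \<longleftrightarrow> \<beta> \<bullet> \<beta> = 1"
| "B_chain (\<beta> # \<gamma> # bs) \<longleftrightarrow> \<beta> \<bullet> \<beta> = 2 \<and> \<beta> \<bullet> \<gamma> = - 1 \<and> (\<forall>\<delta> \<in> set bs. \<beta> \<bullet> \<delta> = 0) \<and> B_chain (\<gamma> # bs)"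

lemma simple_root_scalar_prod:
  assumes "i < k" "j < k"
  shows "simple_root k i \<bullet> simple_root k j =
    (if i = j then if Suc i < k then 2 else 1 else if j = Suc i \<or> i = Suc j then - 1 else 0)"
  using assms
  by (auto simp: simple_root_def minus_scalar_prod_distrib[of _ k] scalar_prod_minus_distrib[of _
      k])

lemma B_base_Cons:
  assumes "B_base n (\<beta> # bs)"
  shows "B_base n bs"
  unfolding B_base_def
proof (intro conjI allI impI)
  show "set bs \<subseteq> B_roots n" using assms by (auto simp: B_base_def)
  fix i j assume ij: "i < length bs" "j < length bs"
  then have "(\<beta> # bs) ! Suc i \<bullet> (\<beta> # bs) ! Suc j =
     simple_root (Suc (length bs)) (Suc i) \<bullet> simple_root (Suc (length bs)) (Suc j)"
    using assms unfolding B_base_def by (metis Suc_less_eq length_Cons)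
  then show "bs ! i \<bullet> bs ! j = simple_root (length bs) i \<bullet> simple_root (length bs) j"
    using ij by (simp add: simple_root_scalar_prod)
qed

lemma B_base_chain: "B_base n bs \<Longrightarrow> bs \<noteq> [] \<Longrightarrow> B_chain bs"
proof (induction bs rule: B_chain.induct)
  case (2 \<beta>)
  then show ?case by (simp add: B_base_def simple_root_scalar_prod)
next
  case (3 \<beta> \<gamma> bs)
  let ?l = "\<beta> # \<gamma> # bs"
  have p: "?l ! i \<bullet> ?l ! j = simple_root (length ?l) i \<bullet> simple_root (length ?l) j"
    if "i < length ?l" "j < length ?l" for i j
    using 3(2) that unfolding B_base_def by blast
  have "\<beta> \<bullet> \<delta> = 0" if d: "\<delta> \<in> set bs" for \<delta>
  proof -
    obtain i where "i < length bs" "\<delta> = bs ! i" using d by (metis in_set_conv_nth)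
    then show ?thesis using p[of 0 "Suc (Suc i)"] by (simp add: simple_root_scalar_prod)
  qed
  moreover have "\<beta> \<bullet> \<beta> = 2" "\<beta> \<bullet> \<gamma> = - 1"
    using p[of 0 0] p[of 0 1] by (simp_all add: simple_root_scalar_prod)
  ultimately show ?case using 3(1)[OF B_base_Cons[OF 3(2)]] by simp
qed simp

lemma set_roots_carrier: "set bs \<subseteq> B_roots n \<Longrightarrow> set bs \<subseteq> carrier_vec n"
  using B_roots_carrier by blast

text \<open>For the standard base the sum telescopes to e_1; for a general base it plays the role of
  that vector.\<close>

definition vec_sum :: "nat \<Rightarrow> int vec list \<Rightarrow> int vec" where
  "vec_sum n bs = foldr (+) bs (0\<^sub>v n)"

lemma vec_sum_simps: "vec_sum n [] = 0\<^sub>v n" "vec_sum n (\<beta> # bs) = \<beta> + vec_sum n bs"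
  by (simp_all add: vec_sum_def)

lemma vec_sum_carrier: "set bs \<subseteq> carrier_vec n \<Longrightarrow> vec_sum n bs \<in> carrier_vec n"
  by (induction bs) (auto simp: vec_sum_simps)

lemma vec_sum_orthogonal:
  assumes "set bs \<subseteq> carrier_vec n" "v \<in> carrier_vec n" "\<forall>\<delta> \<in> set bs. v \<bullet> \<delta> = 0"
  shows "v \<bullet> vec_sum n bs = 0"
  using assms by (induction bs) (auto simp: vec_sum_simps scalar_prod_add_distrib[of _ n]
      vec_sum_carrier)

text \<open>In standard coordinates the sum is e_1, and the recursion is e_1 = (e_1 - e_2) +
  e_2.\<close>

lemma B_chain_sum:
  assumes "B_chain (\<gamma> # bs)" "set (\<gamma> # bs) \<subseteq> B_roots n"
  shows "short n (vec_sum n (\<gamma> # bs))" "vec_sum n (\<gamma> # bs) \<bullet> \<gamma> = 1"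
    "\<forall>\<delta> \<in> set bs. vec_sum n (\<gamma> # bs) \<bullet> \<delta> = 0"
proof -
  have "short n (vec_sum n (\<gamma> # bs)) \<and> vec_sum n (\<gamma> # bs) \<bullet> \<gamma> = 1 \<and>
    (\<forall>\<delta> \<in> set bs. vec_sum n (\<gamma> # bs) \<bullet> \<delta> = 0)"
    using assms
  proof (induction bs arbitrary: \<gamma>)
    case Nil
    then have "\<gamma> \<in> carrier_vec n" by (auto simp: B_roots_def)
    with Nil show ?case by (simp add: vec_sum_simps short_def)
  next
    case (Cons \<gamma>' bs)
    let ?u = "vec_sum n (\<gamma>' # bs)"
    have c: "\<gamma> \<in> carrier_vec n" "\<gamma>' \<in> carrier_vec n" "set bs \<subseteq> carrier_vec n" "?u \<in> carrier_vec n"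
      using set_roots_carrier[OF Cons.prems(2)] vec_sum_carrier[of "\<gamma>' # bs" n] by auto
    have IH: "short n ?u" "?u \<bullet> \<gamma>' = 1" "\<And>\<delta>. \<delta> \<in> set bs \<Longrightarrow> ?u \<bullet> \<delta> = 0"
      using Cons.IH[of \<gamma>'] Cons.prems by auto
    have g: "\<gamma> \<bullet> \<gamma> = 2" "\<gamma> \<bullet> \<gamma>' = - 1" "\<And>\<delta>. \<delta> \<in> set bs \<Longrightarrow> \<gamma> \<bullet> \<delta> = 0" using Cons.prems by auto
    have gu: "\<gamma> \<bullet> ?u = - 1" using c g vec_sum_orthogonal[OF c(3,1)]
      by (simp add: vec_sum_simps scalar_prod_add_distrib[of _ n] vec_sum_carrier)
    then have ug: "?u \<bullet> \<gamma> = - 1" using c by (simp add: comm_scalar_prod[of ?u n \<gamma>])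
    have eq: "vec_sum n (\<gamma> # \<gamma>' # bs) = \<gamma> + ?u" by (simp add: vec_sum_simps)
    have "\<delta> \<in> carrier_vec n" if "\<delta> \<in> set bs" for \<delta> using that c by auto
    then show ?case unfolding eq using c IH g gu ug
      by (auto simp: short_def add_scalar_prod_distrib[of _ n] scalar_prod_add_distrib[of _ n])
  qed
  then show "short n (vec_sum n (\<gamma> # bs))" "vec_sum n (\<gamma> # bs) \<bullet> \<gamma> = 1"
    "\<forall>\<delta> \<in> set bs. vec_sum n (\<gamma> # bs) \<bullet> \<delta> = 0" by blast+
qed

lemma foldr_reflect_isometry:
  "set cs \<subseteq> B_roots n \<Longrightarrow> linear_isometry n (foldr reflect cs)"
proof (induction cs)
  case Nil
  then show ?case using linear_isometry_id by (simp add: id_def)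
next
  case (Cons \<alpha> cs)
  then show ?case
    using linear_isometry_comp[OF linear_isometry_reflect[of \<alpha> n], of "foldr reflect cs"]
        by (simp add: o_def)
qed

lemma foldr_reflect_orthogonal:
  "set cs \<subseteq> carrier_vec n \<Longrightarrow> v \<in> carrier_vec n \<Longrightarrow> \<forall>\<delta> \<in> set cs. v \<bullet> \<delta> = 0 \<Longrightarrow> foldr reflect cs v = v"
  by (induction cs) (auto simp: reflect_orthogonal[of _ n])

lemma foldr_reflect_commute:
  assumes "set cs \<subseteq> B_roots n" "\<beta> \<in> B_roots n" "v \<in> carrier_vec n" "\<forall>\<delta> \<in> set cs. \<delta> \<bullet> \<beta> = 0"
  shows "foldr reflect cs (reflect \<beta> v) = reflect \<beta> (foldr reflect cs v)"
  using assms
proof (induction cs)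
  case (Cons \<delta> cs)
  have "reflect \<beta> \<delta> = \<delta>" using Cons.prems B_roots_carrier by (auto intro: reflect_orthogonal)
  moreover have "foldr reflect cs v \<in> carrier_vec n"
    using linear_isometryD(1)[OF foldr_reflect_isometry] Cons.prems by auto
  ultimately show ?case using Cons reflect_conjugate[of \<beta> n \<delta> "foldr reflect cs v"] by auto
qed simp

lemma B_chain_head_notin: "B_chain (\<gamma> # bs) \<Longrightarrow> \<gamma> \<notin> set bs"
  by (cases bs) auto

text \<open>In an arbitrary order, the first root of the chain can be moved to one of the two ends
  of the word, since it is orthogonal to all roots but its neighbour.\<close>

lemma coxeter_orbit:
  assumes "B_chain bs" "set bs \<subseteq> B_roots n" "mset cs = mset bs"
  shows "(foldr reflect cs ^^ length bs) (vec_sum n bs) = - vec_sum n bs \<and>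
    (\<forall>i. 0 < i \<longrightarrow> i < length bs \<longrightarrow> (foldr reflect cs ^^ i) (vec_sum n bs) \<bullet> vec_sum n bs = 0)"
  using assms
proof (induction bs arbitrary: cs rule: B_chain.induct)
  case (2 \<beta>)
  have "\<beta> \<in> carrier_vec n" using 2 B_roots_carrier by auto
  moreover have "cs = [\<beta>]" using 2 by simp
  ultimately show ?case using 2 by (simp add: vec_sum_simps reflect_self)
next
  case (3 \<beta> \<gamma> bs)
  let ?u = "vec_sum n (\<gamma> # bs)" and ?v = "vec_sum n (\<beta> # \<gamma> # bs)" and ?k = "length (\<gamma> # bs)"
  have ch: "B_chain (\<gamma> # bs)" and roots: "set (\<gamma> # bs) \<subseteq> B_roots n" "\<beta> \<in> B_roots n"
    using "3.prems" by auto
  note su = B_chain_sum[OF ch roots(1)]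
  note sv = B_chain_sum[OF "3.prems"(1,2)]
  have uc: "?u \<in> carrier_vec n" and vc: "?v \<in> carrier_vec n" using su(1) sv(1)
      by (auto simp: short_def)
  have bc: "\<beta> \<in> carrier_vec n" using roots B_roots_carrier by blast
  \<comment> \<open>With \<open>?v\<close> as e_1 and \<open>?u\<close> as e_2, the new root is e_1
    - e_2, and its reflection exchanges the two.\<close>
  have b: "\<beta> = ?v - ?u" unfolding vec_sum_simps(2)[of n \<beta> "\<gamma> # bs"] using uc bc
      by (auto intro!: eq_vecI)
  have vu: "?v \<bullet> ?u = 0"
    using sv(3) vc roots(1) B_roots_carrier by (intro vec_sum_orthogonal) auto
  then have uv: "?u \<bullet> ?v = 0" using uc vc by (simp add: comm_scalar_prod[of ?u n ?v])
  note refl = reflect_diff_short(1,2)[OF sv(1) su(1) vu, folded b]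
  have "\<beta> \<in> set cs" using "3.prems"(3) by (metis list.set_intros(1) set_mset_mset)
  then obtain A B where cs: "cs = A @ \<beta> # B" by (meson split_list)
  have AB: "mset (A @ B) = mset (\<gamma> # bs)" using "3.prems"(3) by (simp add: cs)
  have setAB: "set (A @ B) = set (\<gamma> # bs)" using AB by (metis set_mset_mset)
  have rAB: "set A \<subseteq> B_roots n" "set B \<subseteq> B_roots n" using setAB roots by auto
  define c where "c = foldr reflect (A @ B)"
  define w where "w = foldr reflect cs"
  define s where "s = reflect \<beta>"
  have IH: "(c ^^ ?k) ?u = - ?u" "\<And>i. 0 < i \<Longrightarrow> i < ?k \<Longrightarrow> (c ^^ i) ?u \<bullet> ?u = 0"
    using "3.IH"[OF ch roots(1) AB] unfolding c_def by blast+
  have ci: "linear_isometry n c" unfolding c_def using rAB by (intro foldr_reflect_isometry) auto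
  have si: "linear_isometry n s" unfolding s_def using roots by (intro linear_isometry_reflect) auto
  have cv: "c ?v = ?v" unfolding c_def
    using vc sv(3) setAB set_roots_carrier[OF rAB(1)] set_roots_carrier[OF rAB(2)]
    by (intro foldr_reflect_orthogonal[of _ n]) auto
  then have civ: "(c ^^ i) ?v = ?v" for i by (induction i) auto
  have cic: "(c ^^ i) ?u \<in> carrier_vec n" for i
    using linear_isometryD(1)[OF linear_isometry_funpow[OF ci] uc uc] .
  have cuv: "(c ^^ i) ?u \<bullet> ?v = 0" for i
    using linear_isometryD(5)[OF linear_isometry_funpow[OF ci] uc vc, of i] civ uv by simp
  have sfix: "s ((c ^^ i) ?u) = (c ^^ i) ?u" if "0 < i" "i < ?k" for i
  proof -
    have "(c ^^ i) ?u \<bullet> (?v - ?u) = 0" using cuv[of i] IH(2)[OF that] cic uc vc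
      by (simp add: scalar_prod_minus_distrib[of _ n])
    then show ?thesis unfolding s_def b[symmetric] using cic bc
        by (intro reflect_orthogonal[of _ n]) auto
  qed
  have sneg: "s (- ?u) = - ?v"
    using linear_isometryD(2)[OF si uc uc] refl by (simp add: s_def)
  have cneg: "c (- ?v) = - ?v" using linear_isometryD(2)[OF ci vc vc] cv by simp
  have orth: "\<delta> \<bullet> \<beta> = 0" if "\<delta> \<in> set bs" for \<delta>
    using that "3.prems"(1) roots bc B_roots_carrier by (auto simp: comm_scalar_prod[of \<delta> n \<beta>])
  have foldc: "foldr reflect cs v \<in> carrier_vec n" if "set cs \<subseteq> B_roots n"
      "v \<in> carrier_vec n" for cs v
    using linear_isometryD(1)[OF foldr_reflect_isometry[OF that(1)] that(2,2)] .
  have w_cases: "(\<forall>v \<in> carrier_vec n. w v = s (c v)) \<or> (\<forall>v \<in> carrier_vec n. w v = c (s v))"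
  proof -
    have "\<gamma> \<notin> set bs" using B_chain_head_notin[OF ch] .
    then have "count (mset (\<gamma> # bs)) \<gamma> = 1" by (simp add: count_eq_zero_iff)
    then have "count (mset A) \<gamma> + count (mset B) \<gamma> = 1" using AB by (metis count_union mset_append)
    then have "count (mset A) \<gamma> = 0 \<or> count (mset B) \<gamma> = 0" by linarith
    then have "\<gamma> \<notin> set A \<or> \<gamma> \<notin> set B" by (simp add: count_eq_zero_iff)
    then show ?thesis
    proof
      assume "\<gamma> \<notin> set A"
      then have "set A \<subseteq> set bs" using setAB by auto
      then have "\<forall>\<delta> \<in> set A. \<delta> \<bullet> \<beta> = 0" using orth by blast
      then have "w v = s (c v)" if "v \<in> carrier_vec n" for v
        using foldr_reflect_commute[OF rAB(1) roots(2) foldc[OF rAB(2) that]]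
        by (simp add: w_def cs c_def s_def)
      then show ?thesis by blast
    next
      assume "\<gamma> \<notin> set B"
      then have "set B \<subseteq> set bs" using setAB by auto
      then have "\<forall>\<delta> \<in> set B. \<delta> \<bullet> \<beta> = 0" using orth by blast
      then have "w v = c (s v)" if "v \<in> carrier_vec n" for v
        using foldr_reflect_commute[OF rAB(2) roots(2) that]
        by (simp add: w_def cs c_def s_def)
      then show ?thesis by blast
    qed
  qed
  have "(w ^^ Suc ?k) ?v = - ?v \<and> (\<forall>i. 0 < i \<longrightarrow> i < Suc ?k \<longrightarrow> (w ^^ i) ?v \<bullet> ?v = 0)"
    using w_cases
  proof
    assume w: "\<forall>v \<in> carrier_vec n. w v = s (c v)"
    \<comment> \<open>Here the orbit runs e_1, e_2, c e_2, ..., c^(k-1) e_2, - e_1. With the factors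
      in the other order it runs e_1, c e_2, ..., c^k e_2 = - e_2, - e_1, which removes the shift of
      index.\<close>
    have it: "(w ^^ Suc i) ?v = (c ^^ i) ?u" if "i < ?k" for i
      using that
    proof (induction i)
      case 0 then show ?case using w vc cv refl by (simp add: s_def)
    next
      case (Suc i)
      then have "(w ^^ Suc (Suc i)) ?v = w ((c ^^ i) ?u)" by simp
      also have "\<dots> = s ((c ^^ Suc i) ?u)" using w cic by simp
      finally show ?case using sfix[of "Suc i"] Suc.prems by simp
    qed
    define k' where "k' = length bs"
    have k': "?k = Suc k'" "length bs = k'" by (simp_all add: k'_def)
    have "(w ^^ Suc ?k) ?v = w ((w ^^ Suc k') ?v)" by (simp add: k')
    also have "\<dots> = s (c ((c ^^ k') ?u))" using it[of k'] w cic by (simp add: k')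
    also have "\<dots> = - ?v" using IH(1) sneg by (simp add: k')
    finally show ?thesis using it cuv by (metis Suc_less_eq gr0_conv_Suc)
  next
    assume w: "\<forall>v \<in> carrier_vec n. w v = c (s v)"
    have it: "(w ^^ i) ?v = (c ^^ i) ?u" if "0 < i" "i \<le> ?k" for i
      using that
    proof (induction i)
      case (Suc i)
      show ?case
      proof (cases "i = 0")
        case True then show ?thesis using w vc refl by (simp add: s_def)
      next
        case False then show ?thesis using Suc w cic sfix[of i] by simp
      qed
    qed simp
    have "(w ^^ Suc ?k) ?v = w ((w ^^ ?k) ?v)" by simp
    also have "\<dots> = c (s (- ?u))" using it[of ?k] IH(1) w uc by simp
    also have "\<dots> = - ?v" using sneg cneg by simp
    finally show ?thesis using it cuv by (metis less_Suc_eq_le)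
  qed
  then show ?case by (simp add: w_def)
qed simp

text \<open>The prepended root is the difference of the new and the old sum, both of the form +-e_i,
  so it brings in at most one new coordinate. Equality of the cardinality comes from
  \<open>orbit_exhausts\<close>.\<close>

lemma B_chain_support:
  assumes "B_chain bs" "set bs \<subseteq> B_roots n"
  shows "\<exists>I \<subseteq> {..<n}. card I \<le> length bs \<and> (\<forall>\<gamma> \<in> set bs. supported I \<gamma>)
      \<and> supported I (vec_sum n bs)"
  using assms
proof (induction bs rule: B_chain.induct)
  case (2 \<beta>)
  then have s: "short n \<beta>" "\<beta> \<in> carrier_vec n" by (auto simp: short_def B_roots_def)
  then obtain i where "i < n" "\<beta> = unit_vec n i \<or> \<beta> = - unit_vec n i" using short_cases by metis
  then show ?case using s by (intro exI[of _ "{i}"]) (auto simp: vec_sum_simps supported_unit)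
next
  case (3 \<beta> \<gamma> bs)
  let ?u = "vec_sum n (\<gamma> # bs)" and ?v = "vec_sum n (\<beta> # \<gamma> # bs)"
  obtain I where I: "I \<subseteq> {..<n}" "card I \<le> length (\<gamma> # bs)" "\<forall>\<gamma> \<in> set (\<gamma> # bs). supported I \<gamma>"
      "supported I ?u"
    using 3 by auto
  have fin: "finite I" using I(1) finite_subset by blast
  have uc: "?u \<in> carrier_vec n" "\<beta> \<in> carrier_vec n"
    using set_roots_carrier[OF "3.prems"(2)] vec_sum_carrier[of "\<gamma> # bs" n] by auto
  have b: "\<beta> = ?v - ?u" unfolding vec_sum_simps(2)[of n \<beta> "\<gamma> # bs"] using uc
      by (auto intro!: eq_vecI)
  have sv: "short n ?v" using B_chain_sum(1)[OF "3.prems"] .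
  obtain i where i: "i < n" "?v = unit_vec n i \<or> ?v = - unit_vec n i" using sv by (rule short_cases)
  let ?I = "insert i I"
  have v: "supported ?I ?v" using i by (auto simp: supported_unit)
  have u: "supported ?I ?u" using I(4) by (rule supported_mono) auto
  have "supported ?I \<beta>"
    by (subst b) (use v u uc short_carrier[OF sv] in \<open>auto intro!: supported_diff\<close>)
  moreover have "card ?I \<le> Suc (card I)" by (rule card_insert_le_m1) (use fin in auto)
  ultimately show ?case using I i v supported_mono[of I _ ?I]
    by (intro exI[of _ ?I]) auto
qed simp

text \<open>The first k orbit members are pairwise orthogonal vectors +-e_i, so their k distinct
  indices fill I. On each of them the k-th power is -1, since it commutes with w.\<close>

lemma orbit_exhausts:
  assumes w: "linear_isometry n w" and u: "short n u" and I: "I \<subseteq> {..<n}" "card I \<le> k"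
    and orth: "\<And>i. 0 < i \<Longrightarrow> i < k \<Longrightarrow> (w ^^ i) u \<bullet> u = 0" and wk: "(w ^^ k) u = - u"
    and supp: "\<And>i. supported I ((w ^^ i) u)"
  shows "card I = k" "\<And>i. i \<in> I \<Longrightarrow> (w ^^ k) (unit_vec n i) = - unit_vec n i"
proof -
  have uc: "u \<in> carrier_vec n" using short_carrier[OF u] .
  have sh: "short n ((w ^^ i) u)" for i using linear_isometry_short[OF linear_isometry_funpow[OF w]
      u] .
  have "\<exists>j. j < n \<and> ((w ^^ i) u = unit_vec n j \<or> (w ^^ i) u = - unit_vec n j)" for i
    using short_cases[OF sh[of i]] by metis
  then obtain f where f: "\<And>i. f i < n" "\<And>i. (w ^^ i) u = unit_vec n (f i) \<or> (w ^^ i) u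
      = - unit_vec n (f i)"
    by metis
  have fI: "f i \<in> I" for i using supp[of i] f(1,2)[of i] by (auto simp: supported_unit)
  have pair: "(w ^^ b) u \<bullet> (w ^^ a) u = 0" if "a < b" "b < k" for a b
  proof -
    have wc: "(w ^^ (b - a)) u \<in> carrier_vec n" using linear_isometryD(1)[OF
        linear_isometry_funpow[OF w] uc uc] .
    have "(w ^^ b) u = (w ^^ a) ((w ^^ (b - a)) u)" using that
        by (simp flip: funpow_add comp_apply[of "w ^^ a"])
    then have "(w ^^ b) u \<bullet> (w ^^ a) u = (w ^^ (b - a)) u \<bullet> u"
      using linear_isometryD(5)[OF linear_isometry_funpow[OF w] wc uc] by simp
    then show ?thesis using orth[of "b - a"] that by simp
  qed
  have nz: "(w ^^ b) u \<bullet> (w ^^ a) u \<noteq> 0" if "f a = f b" for a b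
    using f(2)[of a] f(2)[of b] f(1)[of a] f(1)[of b] that by (auto simp: uminus_vec_scalar[of _ n])
  have "inj_on f {..<k}"
  proof (rule inj_onI)
    fix a b assume ab: "a \<in> {..<k}" "b \<in> {..<k}" "f a = f b"
    show "a = b"
      using pair[of a b] pair[of b a] nz[of a b] nz[of b a] ab
          by (cases a b rule: linorder_cases) auto
  qed
  then have card: "card (f ` {..<k}) = k" by (simp add: card_image)
  have fin: "finite I" using I(1) finite_subset by blast
  have sub: "f ` {..<k} \<subseteq> I" using fI by auto
  then show "card I = k" using card card_mono[OF fin sub] I(2) by simp
  then have eq: "f ` {..<k} = I" using card_subset_eq[OF fin sub] card by simp
  fix i assume "i \<in> I"
  then obtain a where a: "i = f a" using eq by blast
  have "(w ^^ k) ((w ^^ a) u) = (w ^^ a) ((w ^^ k) u)" by (metis add.commute comp_apply funpow_add)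
  also have "\<dots> = - (w ^^ a) u" unfolding wk using linear_isometry_funpow_uminus[OF w uc] .
  finally show "(w ^^ k) (unit_vec n i) = - unit_vec n i"
    using f(2)[of a] a f(1)[of a] linear_isometry_funpow_uminus[OF w, of "unit_vec n i" k]
    by (metis uminus_uminus_vec unit_vec_carrier)
qed

section \<open>Products of Coxeter elements\<close>

context chevalley_group
begin

definition z_commutes :: "'a \<Rightarrow> bool" where
  "z_commutes g \<longleftrightarrow> g \<in> carrier \<G> \<and> g \<otimes> z = z \<otimes> g"

text \<open>The exponent is a natural number rather than a parity, so that exchange counts add;
  reduction modulo 2 waits until \<open>h_exponent_parity\<close>.\<close>

definition commute_upto :: "nat \<Rightarrow> 'a \<Rightarrow> 'a \<Rightarrow> bool" where
  "commute_upto i a b \<longleftrightarrow> a \<otimes> b = z [^] i \<otimes> (b \<otimes> a)"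

lemma z_commutes_closed: "z_commutes g \<Longrightarrow> g \<in> carrier \<G>"
  by (simp add: z_commutes_def)

lemma z_commutes_one: "z_commutes \<one>"
  by (simp add: z_commutes_def)

lemma z_commutes_mult: "z_commutes a \<Longrightarrow> z_commutes b \<Longrightarrow> z_commutes (a \<otimes> b)"
proof -
  assume ab: "z_commutes a" "z_commutes b"
  then have c: "a \<in> carrier \<G>" "b \<in> carrier \<G>" by (auto simp: z_commutes_def)
  have "a \<otimes> b \<otimes> z = a \<otimes> z \<otimes> b" using ab(2) c by (simp add: z_commutes_def m_assoc)
  also have "\<dots> = z \<otimes> (a \<otimes> b)" using ab(1) c by (simp add: z_commutes_def m_assoc[of z a b])
  finally show "z_commutes (a \<otimes> b)" using c by (simp add: z_commutes_def)
qed

lemma z_commutes_pow: "z_commutes a \<Longrightarrow> z_commutes (a [^] (k::nat))"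
  by (induction k) (simp_all add: z_commutes_one z_commutes_mult)

lemma z_commutes_rep: "rep I g w \<Longrightarrow> z_commutes g"
  by (simp add: z_commutes_def rep_closed rep_z_commute)

lemma z_commutesD:
  assumes "z_commutes a"
  shows "a \<otimes> z [^] (i::nat) = z [^] i \<otimes> a" "b \<in> carrier \<G> \<Longrightarrow> a \<otimes> (z [^] i \<otimes> b) = z [^] i \<otimes> (a \<otimes> b)"
proof -
  show 1: "a \<otimes> z [^] i = z [^] i \<otimes> a"
    using assms by (simp add: z_commutes_def z_pow_mod)
  show "a \<otimes> (z [^] i \<otimes> b) = z [^] i \<otimes> (a \<otimes> b)" if "b \<in> carrier \<G>"
    using that 1 assms by (simp add: z_commutes_def flip: m_assoc)
qed

lemma z_pow_add_left: "b \<in> carrier \<G> \<Longrightarrow> z [^] (i::nat) \<otimes> (z [^] (j::nat) \<otimes> b) = z [^] (i + j) \<otimes> b"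
  by (simp add: z_pow_add flip: m_assoc)

lemma commute_upto_right:
  assumes "z_commutes a" "z_commutes b" "z_commutes c" "commute_upto i a b" "commute_upto j a c"
  shows "commute_upto (i + j) a (b \<otimes> c)"
proof -
  note cl = assms(1-3)[THEN z_commutes_closed]
  have "a \<otimes> (b \<otimes> c) = z [^] i \<otimes> (b \<otimes> (a \<otimes> c))"
    using assms(4) cl by (simp add: commute_upto_def flip: m_assoc)
  also have "\<dots> = z [^] i \<otimes> (z [^] j \<otimes> (b \<otimes> (c \<otimes> a)))"
    using assms(5) cl z_commutesD(2)[OF assms(2)] by (simp add: commute_upto_def)
  finally show ?thesis using cl by (simp add: commute_upto_def z_pow_add_left m_assoc)
qed

lemma commute_upto_sym:
  assumes "z_commutes a" "z_commutes b" "commute_upto i a b"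
  shows "commute_upto i b a"
  using assms by (simp add: commute_upto_def z_pow_add_left z_commutes_closed) (simp add: z_pow_mod
      z_commutes_closed)

lemma commute_upto_left:
  assumes "z_commutes a" "z_commutes b" "z_commutes c" "commute_upto i a c" "commute_upto j b c"
  shows "commute_upto (i + j) (a \<otimes> b) c"
  using commute_upto_sym[OF _ _ commute_upto_right[OF assms(3,1,2) commute_upto_sym[OF assms(1,3,4)]
    commute_upto_sym[OF assms(2,3,5)]]] assms z_commutes_mult by blast

lemma commute_upto_one: "z_commutes a \<Longrightarrow> commute_upto 0 a \<one>"
  by (simp add: commute_upto_def z_commutes_closed)

lemma commute_upto_pow:
  assumes "z_commutes a" "z_commutes b" "commute_upto i a b"
  shows "commute_upto (i * d) a (b [^] d)"
proof (induction d)
  case 0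
  then show ?case using commute_upto_one[OF assms(1)] by simp
next
  case (Suc d)
  then show ?case using commute_upto_right[OF assms(1) z_commutes_pow[OF assms(2)] assms(2) Suc
      assms(3)]
    by (simp add: add.commute)
qed

text \<open>Sorting (a b)^d moves each a past all b to its left, which makes d choose 2
  exchanges.\<close>

lemma pow_mult_upto:
  assumes "z_commutes a" "z_commutes b" "commute_upto i a b"
  shows "(a \<otimes> b) [^] d = z [^] (i * (d choose 2)) \<otimes> (a [^] d \<otimes> b [^] d)"
proof (induction d)
  case (Suc d)
  note cl = z_commutes_closed[OF assms(1)] z_commutes_closed[OF assms(2)]
  have sw: "b [^] d \<otimes> a = z [^] (i * d) \<otimes> (a \<otimes> b [^] d)"
    using commute_upto_sym[OF assms(1) z_commutes_pow[OF assms(2)] commute_upto_pow[OF assms]]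
    by (simp add: commute_upto_def)
  have "(a \<otimes> b) [^] Suc d = z [^] (i * (d choose 2)) \<otimes> (a [^] d \<otimes> (b [^] d \<otimes> a) \<otimes> b)"
    using cl by (simp add: Suc m_assoc)
  also have "\<dots> = z [^] (i * (d choose 2)) \<otimes> (z [^] (i * d) \<otimes> (a [^] d \<otimes> a \<otimes> (b [^] d \<otimes> b)))"
    unfolding sw using cl z_commutesD(2)[OF z_commutes_pow[OF assms(1)]] by (simp add: m_assoc)
  also have "\<dots> = z [^] (i * (d choose 2) + i * d) \<otimes> (a [^] Suc d \<otimes> b [^] Suc d)"
    using cl by (simp add: z_pow_add_left)
  also have "i * (d choose 2) + i * d = i * (Suc d choose 2)"
    by (simp add: numeral_2_eq_2 algebra_simps)
  finally show ?case .
qed (simp add: numeral_2_eq_2)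

definition product :: "('p \<Rightarrow> 'a) \<Rightarrow> 'p list \<Rightarrow> 'a" where
  "product F ps = foldr (\<lambda>p y. F p \<otimes> y) ps \<one>"

lemma product_simps: "product F [] = \<one>" "product F (p # ps) = F p \<otimes> product F ps"
  by (simp_all add: product_def)

lemma product_z_commutes: "\<forall>p \<in> set ps. z_commutes (F p) \<Longrightarrow> z_commutes (product F ps)"
  by (induction ps) (auto simp: product_simps z_commutes_one z_commutes_mult)

lemma product_append:
  "\<forall>p \<in> set (ps @ qs). F p \<in> carrier \<G> \<Longrightarrow>
    product F (ps @ qs) \<in> carrier \<G> \<and> product F (ps @ qs) = product F ps \<otimes> product F qs \<and>
    product F ps \<in> carrier \<G> \<and> product F qs \<in> carrier \<G>"
proof (induction ps)
  case Nil
  have "product F qs \<in> carrier \<G>" using Nil by (induction qs) (auto simp: product_simps)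
  then show ?case by (simp add: product_simps)
next
  case (Cons p ps)
  then show ?case by (auto simp: product_simps m_assoc)
qed

lemma commute_upto_product:
  assumes "z_commutes a" "\<forall>p \<in> set ps. z_commutes (F p) \<and> commute_upto (k p) a (F p)"
  shows "commute_upto (\<Sum>p\<leftarrow>ps. k p) a (product F ps)"
  using assms(2)
proof (induction ps)
  case Nil
  then show ?case using commute_upto_one[OF assms(1)] by (simp add: product_simps)
next
  case (Cons p ps)
  then show ?case using commute_upto_right[OF assms(1), of "F p"
      "product F ps"] product_z_commutes[of ps F]
    by (simp add: product_simps)
qed

text \<open>The first factor is exchanged with each of the r others, and r + (r choose 2) = (r + 1
  choose 2).\<close>

lemma product_pow:
  assumes "\<forall>p \<in> set ps. z_commutes (F p) \<and> F p [^] d = z [^] (k p :: nat)"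
    and "sorted_wrt (\<lambda>p q. commute_upto 1 (F p) (F q)) ps"
  shows "product F ps [^] d = z [^] ((length ps choose 2) * (d choose 2) + (\<Sum>p\<leftarrow>ps. k p))"
  using assms
proof (induction ps)
  case Nil
  then show ?case by (simp add: product_simps numeral_2_eq_2)
next
  case (Cons p ps)
  have zp: "z_commutes (F p)" "z_commutes (product F ps)" using Cons.prems
      by (auto intro: product_z_commutes)
  have "commute_upto (\<Sum>q\<leftarrow>ps. 1) (F p) (product F ps)"
    using Cons.prems by (intro commute_upto_product) auto
  then have c: "commute_upto (length ps) (F p) (product F ps)" by (simp add: sum_list_triv)
  have "product F (p # ps) [^] d = z [^] (length ps * (d choose 2)) \<otimes> (z [^] k p \<otimes>
      z [^] ((length ps choose 2) * (d choose 2) + (\<Sum>p\<leftarrow>ps. k p)))"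
    using pow_mult_upto[OF zp c, of d] Cons by (simp add: product_simps)
  also have "\<dots> = z [^] (length ps * (d choose 2) + (k p + ((length ps choose 2) * (d choose 2)
      + (\<Sum>p\<leftarrow>ps. k p))))"
    by (simp add: z_pow_add)
  also have "length ps * (d choose 2) + (k p + ((length ps choose 2) * (d choose 2) + (\<Sum>p\<leftarrow>ps. k p)))
     = (length (p # ps) choose 2) * (d choose 2) + (\<Sum>p\<leftarrow>p # ps. k p)"
    by (simp add: numeral_2_eq_2 algebra_simps)
  finally show ?case .
qed

section \<open>Words in the reflection lifts\<close>

abbreviation m_word :: "int vec list \<Rightarrow> 'a" where
  "m_word \<equiv> product (\<lambda>\<beta>. m \<beta> 1)"

lemma m_word_rep:
  assumes "set cs \<subseteq> B_roots n" "\<forall>\<gamma> \<in> set cs. supported I \<gamma>"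
  shows "rep I (m_word cs) (foldr reflect cs)"
  using assms
proof (induction cs)
  case Nil
  then show ?case using rep_one by (simp add: product_simps id_def)
next
  case (Cons \<alpha> cs)
  then show ?case using rep_step[of I "m_word cs" "foldr reflect cs" \<alpha> 1]
      by (simp add: product_simps o_def)
qed

lemma m_word_closed: "set cs \<subseteq> B_roots n \<Longrightarrow> z_commutes (m_word cs)"
  using z_commutes_rep[OF m_word_rep[of cs UNIV]] by (simp add: supported_def)

lemma m_z_commutes: "\<alpha> \<in> B_roots n \<Longrightarrow> z_commutes (m \<alpha> 1)"
  using m_word_closed[of "[\<alpha>]"] by (simp add: product_simps)

lemma m_word_concat:
  assumes "\<forall>cs \<in> set css. set cs \<subseteq> B_roots n"
  shows "m_word (concat css) = product m_word css"
  using assms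
proof (induction css)
  case Nil
  then show ?case by (simp add: product_simps)
next
  case (Cons cs css)
  have "\<forall>\<alpha> \<in> set (cs @ concat css). m \<alpha> 1 \<in> carrier \<G>" using Cons.prems by auto
  then show ?case using product_append[of cs "concat css" "\<lambda>\<alpha>. m \<alpha> 1"] Cons
      by (simp add: product_simps)
qed

lemma m_orthogonal:
  assumes "\<alpha> \<in> B_roots n" "\<beta> \<in> B_roots n" "\<alpha> \<bullet> \<beta> = 0"
  shows "commute_upto (of_bool (short n \<alpha>) * of_bool (short n \<beta>)) (m \<alpha> 1) (m \<beta> 1)"
proof (cases "short n \<alpha> \<and> short n \<beta>")
  case True
  then show ?thesis using m_short_anticommute[of \<alpha> \<beta> 1 1] assms by (simp add: commute_upto_def)
next
  case False
  then have "\<alpha> \<bullet> \<alpha> + \<beta> \<bullet> \<beta> > 2" using assms by (auto simp: B_roots_iff short_def long_def)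
  then show ?thesis using m_orthogonal_commute[OF assms] False assms
      by (auto simp: commute_upto_def)
qed

text \<open>Only an exchange of two short letters contributes. For Coxeter words of two components
  the count is 1, by \<open>B_chain_one_short\<close>.\<close>

lemma m_words_orthogonal:
  assumes "set xs \<subseteq> B_roots n" "set ys \<subseteq> B_roots n" "\<forall>\<alpha> \<in> set xs. \<forall>\<beta> \<in> set ys. \<alpha> \<bullet> \<beta> = 0"
  shows "commute_upto ((\<Sum>\<alpha>\<leftarrow>xs. of_bool (short n \<alpha>)) * (\<Sum>\<beta>\<leftarrow>ys. of_bool (short n \<beta>))) (m_word xs)
      (m_word ys)"
  using assms
proof (induction xs)
  case Nil
  then show ?case using commute_upto_sym[OF _ _ commute_upto_one] m_word_closed[of ys]
      z_commutes_one
    by (simp add: product_simps)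
next
  case (Cons \<alpha> xs)
  have "commute_upto (\<Sum>\<beta>\<leftarrow>ys. of_bool (short n \<alpha>) * of_bool (short n \<beta>)) (m \<alpha> 1) (m_word ys)"
    using Cons.prems by (intro commute_upto_product ballI conjI m_orthogonal) (auto simp:
        m_z_commutes)
  then show ?case
    using commute_upto_left[OF m_z_commutes m_word_closed m_word_closed _ Cons.IH, of \<alpha>] Cons.prems
    by (simp add: product_simps sum_list_const_mult distrib_right)
qed

lemma B_chain_one_short:
  assumes "B_chain bs" "set bs \<subseteq> B_roots n" "mset cs = mset bs"
  shows "(\<Sum>\<alpha>\<leftarrow>cs. of_bool (short n \<alpha>)) = (1::nat)"
proof -
  have "(\<Sum>\<alpha>\<leftarrow>bs. of_bool (short n \<alpha>)) = (1::nat)"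
    using assms(1,2) by (induction bs rule: B_chain.induct) (auto simp: short_def B_roots_def)
  moreover have "(\<Sum>\<alpha>\<leftarrow>cs. of_bool (short n \<alpha>) :: nat) = (\<Sum>\<alpha>\<leftarrow>bs. of_bool (short n \<alpha>))"
    using assms(3) by (metis mset_map sum_mset_sum_list)
  ultimately show ?thesis by simp
qed

lemma coxeter_power:
  assumes "B_chain bs" "set bs \<subseteq> B_roots n" "mset cs = mset bs"
  shows "m_word cs [^] (2 * length bs) = z [^] (length bs * (length bs + 1) div 2)"
proof -
  obtain \<gamma> bs' where bs: "bs = \<gamma> # bs'" using assms(1) by (cases bs) auto
  define u where "u = vec_sum n bs"
  obtain I where I: "I \<subseteq> {..<n}" "card I \<le> length bs" "\<forall>\<gamma> \<in> set bs. supported I \<gamma>" "supported I u"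
    using B_chain_support[OF assms(1,2)] by (auto simp: u_def)
  have su: "short n u" using B_chain_sum(1)[of \<gamma> bs' n] assms by (simp add: u_def bs)
  have set: "set cs = set bs" using assms(3) by (metis set_mset_mset)
  have rep: "rep I (m_word cs) (foldr reflect cs)"
    using assms(2) I(3) set by (intro m_word_rep) auto
  note orb = coxeter_orbit[OF assms, folded u_def]
  have supp: "supported I ((foldr reflect cs ^^ i) u)" for i
    using rep_supported[OF rep_pow[OF rep] short_carrier[OF su] I(4)] .
  have ex: "card I = length bs" "\<And>i. i \<in> I \<Longrightarrow> (foldr reflect cs ^^ length bs) (unit_vec n i)
      = - unit_vec n i"
    using orbit_exhausts[OF rep_isometry[OF rep] su I(1,2) _ _ supp] orb by blast+
  show ?thesis using half_turn_square[OF I(1) rep ex(2)] ex(1) by simp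
qed

text \<open>The images of the short root before step k are orthogonal to it, so k is the first time
  its negative appears, and the period is exactly 2k.\<close>

lemma coxeter_order_dvd:
  assumes "B_chain bs" "set bs \<subseteq> B_roots n" "mset cs = mset bs"
    and d: "(foldr reflect cs ^^ d) (vec_sum n bs) = vec_sum n bs"
  shows "2 * length bs dvd d"
proof -
  obtain \<gamma> bs' where bs: "bs = \<gamma> # bs'" using assms(1) by (cases bs) auto
  define u where "u = vec_sum n bs"
  have su: "short n u" using B_chain_sum(1)[of \<gamma> bs' n] assms by (simp add: u_def bs)
  have set: "set cs = set bs" using assms(3) by (metis set_mset_mset)
  note orb = coxeter_orbit[OF assms(1-3), folded u_def]
  have iso: "linear_isometry n (foldr reflect cs)" using assms(2) set
      by (intro foldr_reflect_isometry) auto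
  show ?thesis
  proof (rule neg_orbit_dvd[OF _ _ linear_isometry_funpow_uminus[OF iso short_carrier[OF su]]])
    show "(foldr reflect cs ^^ length bs) u = - u" using orb by blast
    show "(foldr reflect cs ^^ d) u = u" using d by (simp add: u_def)
    show "u \<noteq> - u" using root_nonzero[OF short_root[OF su]] .
    fix i assume "0 < i" "i < length bs"
    then have "(foldr reflect cs ^^ i) u \<bullet> u = 0" using orb by blast
    then show "(foldr reflect cs ^^ i) u \<noteq> - u" using su
        by (auto simp: short_def uminus_vec_scalar[of _ n])
  qed (simp add: bs)
qed

theorem carter_power:
  assumes len: "length css = length bss"
    and chain: "\<And>i. i < length bss \<Longrightarrow> B_chain (bss ! i) \<and> set (bss ! i) \<subseteq> B_roots n \<and> mset (css ! i)
        = mset (bss ! i)"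
    and orth: "\<And>i j \<beta> \<gamma>. i < length bss \<Longrightarrow> j < length bss \<Longrightarrow> i \<noteq> j \<Longrightarrow> \<beta> \<in> set (bss ! i) \<Longrightarrow>
      \<gamma> \<in> set (bss ! j) \<Longrightarrow> \<beta> \<bullet> \<gamma> = 0"
    and d: "\<And>v. v \<in> carrier_vec n \<Longrightarrow> (foldr reflect (concat css) ^^ d) v = v"
  shows "i < length bss \<Longrightarrow> 2 * length (bss ! i) dvd d"
    and "m_word (concat css) [^] d = z [^] ((length bss choose 2) * (d choose 2) +
      (\<Sum>i<length bss. (length (bss ! i) * (length (bss ! i)
          + 1) div 2) * (d div (2 * length (bss ! i)))))"
proof -
  have set: "set (css ! i) = set (bss ! i)" if "i < length bss" for i
    using chain[OF that] by (metis set_mset_mset)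
  have roots: "set (css ! i) \<subseteq> B_roots n" if "i < length bss" for i
    using chain[OF that] set[OF that] by auto
  have rootsc: "set (concat css) \<subseteq> B_roots n"
    using roots len by (auto simp: in_set_conv_nth) (metis nth_mem subsetD)
  define f where "f = foldr reflect (concat css)"
  show dvd: "2 * length (bss ! i) dvd d" if i: "i < length bss" for i
  proof -
    define w where "w = foldr reflect (css ! i)"
    define u where "u = vec_sum n (bss ! i)"
    have uc: "u \<in> carrier_vec n" using chain[OF i] set_roots_carrier
        by (auto simp: u_def intro: vec_sum_carrier)
    have wi: "linear_isometry n w" unfolding w_def using roots[OF i]
        by (rule foldr_reflect_isometry)
    have wl: "(w ^^ l) u \<in> carrier_vec n" for l using linear_isometryD(1)[OF
        linear_isometry_funpow[OF wi] uc uc] .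
    \<comment> \<open>The roots of another component are fixed by the isometry w, which therefore
      keeps the whole orbit of u orthogonal to them. On this orbit the full product acts as w
      alone.\<close>
    have perp: "(w ^^ l) u \<bullet> \<gamma> = 0" if j: "j < length bss" "j \<noteq> i" and g:
        "\<gamma> \<in> set (bss ! j)" for l j \<gamma>
    proof -
      have gc: "\<gamma> \<in> carrier_vec n" using chain[OF j(1)] g B_roots_carrier by blast
      have g0: "\<forall>\<delta> \<in> set (bss ! i). \<gamma> \<bullet> \<delta> = 0" using orth[OF j(1) i j(2) g] by blast
      have "w \<gamma> = \<gamma>" unfolding w_def
        using set[OF i] set_roots_carrier[OF roots[OF i]] gc g0
            by (intro foldr_reflect_orthogonal[of _ n]) auto
      then have "(w ^^ l) \<gamma> = \<gamma>" by (induction l) auto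
      then have "(w ^^ l) u \<bullet> \<gamma> = u \<bullet> \<gamma>"
        using linear_isometryD(5)[OF linear_isometry_funpow[OF wi] uc gc, of l] by simp
      also have "\<dots> = \<gamma> \<bullet> u" using uc gc by (simp add: comm_scalar_prod[of u n \<gamma>])
      also have "\<dots> = 0" unfolding u_def
        using g0 gc chain[OF i] set_roots_carrier by (intro vec_sum_orthogonal) auto
      finally show ?thesis .
    qed
    have fix_other: "foldr reflect (concat xs) ((w ^^ l) u) = (w ^^ l) u"
      if "\<And>cs. cs \<in> set xs \<Longrightarrow> \<exists>j < length bss. j \<noteq> i \<and> cs = css ! j" for xs l
    proof (rule foldr_reflect_orthogonal[OF _ wl])
      show "set (concat xs) \<subseteq> carrier_vec n" using that roots B_roots_carrier by fastforce
      show "\<forall>\<delta> \<in> set (concat xs). (w ^^ l) u \<bullet> \<delta> = 0" using that set perp by fastforce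
    qed
    have split: "css = take i css @ css ! i # drop (Suc i) css"
      using i len by (simp add: id_take_nth_drop)
    have t1: "\<exists>j < length bss. j \<noteq> i \<and> cs = css ! j" if "cs \<in> set (take i css)" for cs
    proof -
      have "\<exists>j < length (take i css). take i css ! j = cs" using that
          by (simp only: in_set_conv_nth)
      then obtain j where "j < i" "j < length css" "css ! j = cs" by auto
      then show ?thesis using len by (intro exI[of _ j]) simp
    qed
    have t2: "\<exists>j < length bss. j \<noteq> i \<and> cs = css ! j" if "cs \<in> set (drop (Suc i) css)" for cs
    proof -
      have "\<exists>j < length (drop (Suc i) css). drop (Suc i) css ! j = cs" using that
          by (simp only: in_set_conv_nth)
      then obtain j where "j < length css - Suc i" "css ! (Suc i + j) = cs" using i len by auto
      then show ?thesis using len by (intro exI[of _ "Suc i + j"]) simp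
    qed
    have f_eq: "f v = foldr reflect (concat (take i css)) (w (foldr reflect (concat (drop (Suc i)
        css)) v))" for v
      unfolding f_def w_def by (subst split) simp
    have "f ((w ^^ l) u) = (w ^^ Suc l) u" for l
      unfolding f_eq using fix_other[of "drop (Suc i) css" l, OF t2] fix_other[of "take i css"
          "Suc l", OF t1] by simp
    then have "(f ^^ l) u = (w ^^ l) u" for l by (induction l) auto
    then have "(w ^^ d) u = u" using d[OF uc] by (simp add: f_def)
    then show ?thesis using coxeter_order_dvd[of "bss ! i" "css ! i" d] chain[OF i]
        by (simp add: w_def u_def)
  qed
  define k where "k i = (length (bss ! i) * (length (bss ! i)
      + 1) div 2) * (d div (2 * length (bss ! i)))" for i
  have pow: "m_word (css ! i) [^] d = z [^] k i" if i: "i < length bss" for i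
  proof -
    have c: "m_word (css ! i) \<in> carrier \<G>" using z_commutes_closed[OF m_word_closed[OF roots[OF i]]]
        .
    have "m_word (css ! i) [^] d = (m_word (css ! i) [^] (2 * length (bss ! i))) [^] (d div (2 *
        length (bss ! i)))"
      using c dvd[OF i] by (simp add: nat_pow_pow)
    also have "\<dots> = z [^] k i" using coxeter_power[of "bss ! i" "css ! i"] chain[OF i]
        by (simp add: nat_pow_pow k_def)
    finally show ?thesis .
  qed
  \<comment> \<open>Indexing the factors by position lets the exponent depend on the
    component.\<close>
  have eq: "map ((!) css) [0..<length bss] = css" using map_nth[of css] len by simp
  have prod: "product m_word css = product (\<lambda>i. m_word (css ! i)) [0..<length bss]"
    by (subst eq[symmetric]) (simp only: product_def foldr_map o_def)
  have comm: "commute_upto 1 (m_word (css ! i)) (m_word (css ! j))" if "i < j"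
      "j < length bss" for i j
  proof -
    have ij: "i < length bss" "j < length bss" "i \<noteq> j" using that by auto
    have "\<forall>\<alpha> \<in> set (css ! i). \<forall>\<beta> \<in> set (css ! j). \<alpha> \<bullet> \<beta> = 0"
      using orth[OF ij] set ij by auto
    then show ?thesis using m_words_orthogonal[OF roots[OF ij(1)] roots[OF ij(2)]]
        B_chain_one_short[of "bss ! i" "css ! i"] B_chain_one_short[of "bss ! j" "css ! j"] chain ij
      by simp
  qed
  have "m_word (concat css) = product m_word css"
    using rootsc by (intro m_word_concat) auto
  also note prod
  also have "product (\<lambda>i. m_word (css ! i)) [0..<length bss] [^] d =
     z [^] ((length [0..<length bss] choose 2) * (d choose 2) + (\<Sum>i\<leftarrow>[0..<length bss]. k i))"
  proof (rule product_pow)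
    show "\<forall>i \<in> set [0..<length bss]. z_commutes (m_word (css ! i)) \<and> m_word (css ! i) [^] d
        = z [^] k i"
      using pow m_word_closed[OF roots] by auto
    show "sorted_wrt (\<lambda>i j. commute_upto 1 (m_word (css ! i)) (m_word (css ! j))) [0..<length bss]"
      using comm by (auto simp: sorted_wrt_iff_nth_less)
  qed
  finally show "m_word (concat css) [^] d = z [^] ((length bss choose 2) * (d choose 2) +
      (\<Sum>i<length bss. (length (bss ! i) * (length (bss ! i)
          + 1) div 2) * (d div (2 * length (bss ! i)))))"
    by (simp add: k_def interv_sum_list_conv_sum_set_nat lessThan_atLeast0)
qed

end

section \<open>Matrices and parities\<close>

lemma GL_group: "group (GL k :: 'a::field mat monoid)"
proof -
  interpret ring "ring_mat TYPE('a) k ()" by (rule ring_mat)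
  show ?thesis unfolding GL_def by (rule units_group)
qed

lemma GL_simps:
  "A \<otimes>\<^bsub>GL k\<^esub> B = A * (B :: 'a::field mat)" "\<one>\<^bsub>GL k\<^esub> = (1\<^sub>m k :: 'a mat)"
  by (simp_all add: GL_def units_of_mult units_of_one ring_mat_simps)

lemma GL_carrier: "A \<in> carrier (GL k) \<Longrightarrow> A \<in> carrier_mat k k"
  by (auto simp: GL_def units_of_carrier Units_def ring_mat_simps)

lemma GL_I:
  "A \<in> carrier_mat k k \<Longrightarrow> B \<in> carrier_mat k k \<Longrightarrow> A * B = 1\<^sub>m k \<Longrightarrow> B * A = 1\<^sub>m k \<Longrightarrow> A \<in> carrier (GL k)"
  by (auto simp: GL_def units_of_carrier Units_def ring_mat_simps)

text \<open>The bridge from the real matrices of \<open>weyl_group\<close> to the maps of the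
  integral lattice used so far. The matrix is determined by the map, but the map only on
  \<open>carrier_vec n\<close>.\<close>

definition acts :: "nat \<Rightarrow> real mat \<Rightarrow> (int vec \<Rightarrow> int vec) \<Rightarrow> bool" where
  "acts n W f \<longleftrightarrow> W \<in> carrier_mat n n \<and> (\<forall>v \<in> carrier_vec n. f v \<in> carrier_vec n \<and>
     W *\<^sub>v map_vec real_of_int v = map_vec real_of_int (f v))"

lemma acts_mult: "acts n V f \<Longrightarrow> acts n W g \<Longrightarrow> acts n (V * W) (\<lambda>v. f (g v))"
  by (auto simp: acts_def assoc_mult_mat_vec[of _ n n _ n])

lemma acts_one: "acts n (1\<^sub>m n) (\<lambda>v. v)"
  by (auto simp: acts_def)

lemma acts_pow: "acts n W f \<Longrightarrow> acts n (W [^]\<^bsub>GL n\<^esub> (k::nat)) (f ^^ k)"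
proof (induction k)
  case 0
  interpret GL: group "GL n :: real mat monoid" by (rule GL_group)
  show ?case using acts_one by (simp add: GL_simps id_def)
next
  case (Suc k)
  interpret GL: group "GL n :: real mat monoid" by (rule GL_group)
  show ?case using acts_mult[OF Suc.IH[OF Suc.prems] Suc.prems]
    by (simp add: GL_simps funpow_Suc_right o_def del: funpow.simps)
qed

lemma acts_fun_unique: "acts n W f \<Longrightarrow> acts n W g \<Longrightarrow> v \<in> carrier_vec n \<Longrightarrow> f v = g v"
proof -
  assume a: "acts n W f" "acts n W g" and v: "v \<in> carrier_vec n"
  then have "map_vec real_of_int (f v) = map_vec real_of_int (g v)" "f v \<in> carrier_vec n"
      "g v \<in> carrier_vec n"
    by (auto simp: acts_def)
  then have "real_of_int (f v $ i) = real_of_int (g v $ i)" if "i < n" for i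
    using that by (metis carrier_vecD index_map_vec(1))
  then show "f v = g v" using \<open>f v \<in> _\<close> \<open>g v \<in> _\<close> by (intro eq_vecI) auto
qed

lemma acts_mat_unique:
  assumes V: "acts n V f" and W: "acts n W g" and eq: "\<And>i. i < n \<Longrightarrow> f (unit_vec n i)
      = g (unit_vec n i)"
  shows "V = W"
proof (rule eq_matI)
  have c: "V \<in> carrier_mat n n" "W \<in> carrier_mat n n" using V W by (auto simp: acts_def)
  show "dim_row V = dim_row W" "dim_col V = dim_col W" using c by auto
  fix i j assume "i < dim_row W" "j < dim_col W"
  then have ij: "i < n" "j < n" using c by auto
  have u: "map_vec real_of_int (unit_vec n j) = unit_vec n j"
      by (intro eq_vecI) (auto simp: unit_vec_def)
  have "V *\<^sub>v unit_vec n j = W *\<^sub>v unit_vec n j"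
    using V W eq[OF ij(2)] u by (auto simp: acts_def) (metis unit_vec_carrier)
  then have "(V *\<^sub>v unit_vec n j) $ i = (W *\<^sub>v unit_vec n j) $ i" by simp
  then show "V $$ (i, j) = W $$ (i, j)" using c ij by simp
qed

lemma acts_reflection:
  assumes a: "\<alpha> \<in> B_roots n"
  shows "acts n (reflection n \<alpha>) (reflect \<alpha>)"
  unfolding acts_def
proof (intro conjI ballI)
  show "reflection n \<alpha> \<in> carrier_mat n n" by (simp add: reflection_def)
  fix v :: "int vec" assume v: "v \<in> carrier_vec n"
  note ac = B_roots_carrier[OF a]
  show "reflect \<alpha> v \<in> carrier_vec n" using a v by simp
  define q where "q = real_of_int (\<alpha> \<bullet> \<alpha>)"
  have q: "q \<noteq> 0" using a by (auto simp: q_def B_roots_def)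
  have k: "real_of_int (cartan v \<alpha>) = 2 * real_of_int (v \<bullet> \<alpha>) / q"
    using arg_cong[OF cartan_mult_norm[OF a, of v], of real_of_int] q
        by (simp add: q_def field_simps)
  have sp: "real_of_int (v \<bullet> \<alpha>) = (\<Sum>j<n. real_of_int (\<alpha> $ j) * real_of_int (v $ j))"
    using v ac by (auto simp: scalar_prod_def lessThan_atLeast0 mult.commute)
  show "reflection n \<alpha> *\<^sub>v map_vec real_of_int v = map_vec real_of_int (reflect \<alpha> v)"
  proof (rule eq_vecI)
    show "dim_vec (reflection n \<alpha> *\<^sub>v map_vec real_of_int v)
        = dim_vec (map_vec real_of_int (reflect \<alpha> v))"
      using v ac by (simp add: reflection_def reflect_def)
    fix i assume "i < dim_vec (map_vec real_of_int (reflect \<alpha> v))"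
    then have i: "i < n" using v ac by (simp add: reflect_def)
    have "(reflection n \<alpha> *\<^sub>v map_vec real_of_int v) $ i =
      (\<Sum>j<n. ((if i = j then 1 else 0) - 2 * real_of_int (\<alpha> $ i) * real_of_int (\<alpha> $ j) / q) *
          real_of_int (v $ j))"
      using i v by (simp add: reflection_def mult_mat_vec_def scalar_prod_def lessThan_atLeast0
          q_def)
    also have "\<dots> = (\<Sum>j<n. (if i = j then real_of_int (v $ j) else 0) -
        (2 * real_of_int (\<alpha> $ i) / q) * (real_of_int (\<alpha> $ j) * real_of_int (v $ j)))"
      by (intro sum.cong) (auto simp: algebra_simps)
    also have "\<dots> = real_of_int (v $ i) - (2 * real_of_int (\<alpha> $ i) / q) * real_of_int (v \<bullet> \<alpha>)"
      unfolding sum_subtractf sum_distrib_left[symmetric] using i by (simp add: sp)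
    also have "\<dots> = map_vec real_of_int (reflect \<alpha> v) $ i"
      using i v ac by (simp add: reflect_def k)
    finally show "(reflection n \<alpha> *\<^sub>v map_vec real_of_int v) $ i
        = map_vec real_of_int (reflect \<alpha> v) $ i" .
  qed
qed

lemma reflection_square: "\<alpha> \<in> B_roots n \<Longrightarrow> reflection n \<alpha> * reflection n \<alpha> = 1\<^sub>m n"
  by (rule acts_mat_unique[OF acts_mult[OF acts_reflection acts_reflection] acts_one])
     (auto simp: reflect_reflect)

lemma reflection_GL: "\<alpha> \<in> B_roots n \<Longrightarrow> reflection n \<alpha> \<in> carrier (GL n)"
proof -
  assume a: "\<alpha> \<in> B_roots n"
  have "reflection n \<alpha> \<in> carrier_mat n n" by (simp add: reflection_def)
  then show ?thesis using a by (intro GL_I[where B =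
      "reflection n \<alpha>"]) (simp_all add: reflection_square)
qed

lemma acts_mat_product:
  "set cs \<subseteq> B_roots n \<Longrightarrow> acts n (mat_product n (map (reflection n) cs)) (foldr reflect cs)"
proof (induction cs)
  case Nil
  then show ?case using acts_one by (simp add: mat_product_def id_def)
next
  case (Cons \<alpha> cs)
  then show ?case using acts_mult[OF acts_reflection[of \<alpha> n]] by (simp add: mat_product_def o_def)
qed

lemma acts_mat_product_concat:
  assumes "length ws = length css" "\<And>i. i < length css \<Longrightarrow> acts n (ws ! i) (foldr reflect (css ! i))"
  shows "acts n (mat_product n ws) (foldr reflect (concat css))"
  using assms
proof (induction ws css rule: list_induct2)
  case Nil
  then show ?case using acts_one by (simp add: mat_product_def id_def)
next
  case (Cons w ws cs css)
  have "acts n w (foldr reflect cs)" using Cons.prems[of 0] by simp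
  moreover have "acts n (mat_product n ws) (foldr reflect (concat css))"
    using Cons.IH Cons.prems[of "Suc _"] by simp
  ultimately show ?case using acts_mult by (simp add: mat_product_def o_def)
qed

text \<open>A nonzero integral vector fixed by the map would be a real eigenvector for the
  eigenvalue 1.\<close>

lemma elliptic_fixed:
  assumes "acts n W f" "elliptic W" "v \<in> carrier_vec n" "f v = v"
  shows "v = 0\<^sub>v n"
proof (rule ccontr)
  assume ne: "v \<noteq> 0\<^sub>v n"
  let ?v = "map_vec real_of_int v"
  have "?v \<noteq> 0\<^sub>v n"
  proof
    assume z: "?v = 0\<^sub>v n"
    have "v $ i = 0" if "i < n" for i
      using arg_cong[OF z, of "\<lambda>u. u $ i"] that assms(3) by simp
    then have "v = 0\<^sub>v n" using assms(3) by (intro eq_vecI) auto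
    with ne show False ..
  qed
  moreover have "W *\<^sub>v ?v = 1 \<cdot>\<^sub>v ?v" "W \<in> carrier_mat n n" using assms by (auto simp: acts_def)
  ultimately have "eigenvector W ?v 1" using assms(3) by (auto simp: eigenvector_def)
  with assms(2) show False by (auto simp: elliptic_def eigenvalue_def)
qed

section \<open>Parity of the exponents\<close>

lemma odd_triangle: "odd (k * (k + 1) div 2 :: nat) \<longleftrightarrow> k mod 4 \<in> {1, 2}"
proof (induction k)
  case (Suc k)
  have "Suc k * (Suc k + 1) div 2 = k * (k + 1) div 2 + Suc k" by simp
  moreover have "odd (t + Suc k) \<longleftrightarrow> (odd t \<noteq> odd (Suc k))" for t by simp
  moreover have "(Suc k mod 4 = 1 \<or> Suc k mod 4 = 2) \<longleftrightarrow> ((k mod 4 = 1 \<or> k mod 4 = 2) \<noteq> odd (Suc k))"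
    by presburger
  ultimately show ?case using Suc by (simp only: insert_iff empty_iff simp_thms) blast
qed simp

lemma odd_choose_two: "odd (k choose 2) \<longleftrightarrow> k mod 4 \<in> {2, 3}"
proof (induction k)
  case (Suc k)
  have "Suc k choose 2 = (k choose 2) + k" by (simp add: numeral_2_eq_2)
  moreover have "odd (t + k) \<longleftrightarrow> (odd t \<noteq> odd k)" for t by simp
  moreover have "(Suc k mod 4 = 2 \<or> Suc k mod 4 = 3) \<longleftrightarrow> ((k mod 4 = 2 \<or> k mod 4 = 3) \<noteq> odd k)"
    by presburger
  ultimately show ?case using Suc by (simp only: insert_iff empty_iff simp_thms) blast
qed (simp add: numeral_2_eq_2)

text \<open>With d = 2kq the 2-adic valuations of d and 2k differ by that of q, which vanishes for
  odd q.\<close>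

lemma relevant_iff:
  assumes "0 < d" "0 < k" "2 * k dvd d"
  shows "relevant d k \<longleftrightarrow> odd (d div (2 * k))"
proof -
  obtain q where q: "d = 2 * k * q" using assms(3) by (auto simp: dvd_def)
  have nz: "2 * k \<noteq> 0" "q \<noteq> 0" using assms q by auto
  have "multiplicity 2 d = multiplicity 2 (2 * k) + multiplicity 2 q"
    unfolding q using nz by (intro prime_elem_multiplicity_mult_distrib) auto
  then have "relevant d k \<longleftrightarrow> multiplicity 2 q = 0" by (auto simp: relevant_def)
  also have "\<dots> \<longleftrightarrow> odd q" using nz(2) by (auto simp: multiplicity_eq_zero_iff)
  finally show ?thesis using nz by (simp add: q)
qed

lemma h_exponent_parity:
  assumes d: "0 < d" and ns: "ns \<noteq> []" "\<forall>k \<in> set ns. 0 < k \<and> 2 * k dvd d"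
  shows "even ((length ns choose 2) * (d choose 2) + (\<Sum>i<length ns. (ns ! i * (ns ! i
      + 1) div 2) * (d div (2 * ns ! i))))
    \<longleftrightarrow> even (h_exponent d ns)"
proof -
  have "odd ((ns ! i * (ns ! i + 1) div 2) * (d div (2 * ns ! i))) \<longleftrightarrow> relevant d (ns ! i)
      \<and> ns ! i mod 4 \<in> {1, 2}"
    if "i < length ns" for i
    using odd_triangle[of "ns ! i"] relevant_iff[OF d, of "ns ! i"] ns(2) that
        by (auto simp del: One_nat_def)
  then have "{i \<in> {..<length ns}. odd ((ns ! i * (ns ! i + 1) div 2) * (d div (2 * ns ! i)))} =
    {i. i < length ns \<and> relevant d (ns ! i) \<and> ns ! i mod 4 \<in> {1, 2}}" by blast
  then have sum: "even (\<Sum>i<length ns. (ns ! i * (ns ! i + 1) div 2) * (d div (2 * ns ! i)))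
      \<longleftrightarrow> even (num_relevant_12 d ns)"
    unfolding num_relevant_12_def by (subst even_sum_iff) simp_all
  \<comment> \<open>Some 2k divides d. Hence the residue 3 modulo 4 is excluded, and
    \<open>d choose 2\<close> is odd for residue 2 only.\<close>
  have "even d" using ns by (metis dvd_mult_left list.set_sel(1))
  then have "d mod 4 = 0 \<or> d mod 4 = 2" by presburger
  then have "odd ((length ns choose 2) * (d choose 2)) \<longleftrightarrow> \<not> (d mod 4 = 0 \<or> length ns mod 4 \<in> {0, 1})"
  proof -
    have "length ns mod 4 < 4" by simp
    then have "length ns mod 4 \<in> {2, 3} \<longleftrightarrow> length ns mod 4 \<notin> {0, 1}" by auto
    then show ?thesis using \<open>d mod 4 = 0 \<or> d mod 4 = 2\<close> odd_choose_two[of d] odd_choose_two[of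
        "length ns"] by auto
  qed
  then show ?thesis using sum by (auto simp: h_exponent_def simp del: insert_iff)
qed

lemma poly_fun_sum:
  "(\<And>i. i \<in> I \<Longrightarrow> f i \<in> poly_fun N) \<Longrightarrow> (\<lambda>A. \<Sum>i\<in>I. f i A) \<in> poly_fun N"
  by (induction I rule: infinite_finite_induct) (auto intro: poly_fun.intros)

section \<open>The spin formula\<close>

text \<open>\<open>N\<close> is the size of the matrices here, not the group of
  representatives.\<close>

locale chevalley_matrix_group = chevalley_group "GL N" n x
  for N n :: nat and x :: "int vec \<Rightarrow> 'k::alg_closed_field \<Rightarrow> 'k mat"
begin

lemma m_elt_eq: "m_elt x \<alpha> c = m \<alpha> c"
  by (simp add: m_elt_def m_def GL_simps)

lemma h_elt_eq: "h_elt x \<alpha> c = h \<alpha> c"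
  by (simp add: h_elt_def h_def GL_simps m_elt_eq)

text \<open>Generators are closed under inversion, as c becomes -c and a reflection inverts itself;
  that is why the words of \<open>rep\<close> need no inverses.\<close>

lemma represents_rep:
  assumes "represents n N x g W"
  shows "\<exists>f. rep {..<n} g f \<and> acts n W f"
proof -
  have "\<exists>f. rep {..<n} (fst p) f \<and> acts n (snd p) f"
    if "p \<in> generate (GL N \<times>\<times> GL n) {(m \<alpha> c, reflection n \<alpha>) |\<alpha> c. \<alpha> \<in> B_roots n \<and> c \<noteq> 0}" for p
    using that
  proof (induction rule: generate.induct)
    case one
    then show ?case using rep_one acts_one by (auto simp: GL_simps)
  next
    case (incl p)
    then obtain \<alpha> c where p: "p = (m \<alpha> c, reflection n \<alpha>)" and a: "\<alpha> \<in> B_roots n" "c \<noteq> 0" by blast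
    then show ?case using rep_m[OF a(1) supported_all[OF B_roots_carrier[OF a(1)]] a(2), of
        "{..<n}"]
        acts_reflection[OF a(1)] by (intro exI[of _ "reflect \<alpha>"]) simp
  next
    case (inv p)
    then obtain \<alpha> c where p: "p = (m \<alpha> c, reflection n \<alpha>)" and a: "\<alpha> \<in> B_roots n" "c \<noteq> 0" by blast
    interpret W: group "GL n :: real mat monoid" by (rule GL_group)
    have "inv\<^bsub>GL n\<^esub> (reflection n \<alpha>) = reflection n \<alpha>"
      using reflection_square[OF a(1)] reflection_GL[OF a(1)]
          by (intro W.inv_equality) (auto simp: GL_simps)
    then have "inv\<^bsub>GL N \<times>\<times> GL n\<^esub> p = (m \<alpha> (- c), reflection n \<alpha>)"
      using inv_DirProd[OF GL_group GL_group m_closed[OF a(1)] reflection_GL[OF a(1)]] a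
          by (simp add: p m_minus)
    then show ?case using rep_m[OF a(1) supported_all[OF B_roots_carrier[OF a(1)]], of "{..<n}"
        "- c"] a
        acts_reflection[OF a(1)] by (intro exI[of _ "reflect \<alpha>"]) simp
  next
    case (eng p q)
    then obtain f f' where "rep {..<n} (fst p) f" "acts n (snd p) f" "rep {..<n} (fst q) f'"
        "acts n (snd q) f'" by blast
    then have "rep {..<n} (fst p \<otimes>\<^bsub>GL N\<^esub> fst q) (\<lambda>u. f (f' u))"
        "acts n (snd p * snd q) (\<lambda>u. f (f' u))"
      by (auto intro: rep_mult acts_mult)
    then show ?case by (auto simp: mult_DirProd' GL_simps)
  qed
  from this[of "(g, W)"] assms show ?thesis by (simp add: represents_def m_elt_eq)
qed

lemma weyl_group_carrier: "w \<in> weyl_group n \<Longrightarrow> w \<in> carrier (GL n)"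
proof -
  interpret W: group "GL n :: real mat monoid" by (rule GL_group)
  show "w \<in> weyl_group n \<Longrightarrow> w \<in> carrier (GL n)"
    unfolding weyl_group_def by (rule W.generate_in_carrier[OF _]) (auto simp: reflection_GL)
qed

lemma acts_pow_one_iff:
  assumes "acts n W f"
  shows "W [^]\<^bsub>GL n\<^esub> (j::nat) = 1\<^sub>m n \<longleftrightarrow> (\<forall>v \<in> carrier_vec n. (f ^^ j) v = v)"
proof
  assume "W [^]\<^bsub>GL n\<^esub> j = 1\<^sub>m n"
  then have "acts n (1\<^sub>m n) (f ^^ j)" using acts_pow[OF assms, of j] by simp
  then show "\<forall>v \<in> carrier_vec n. (f ^^ j) v = v" using acts_fun_unique acts_one by blast
next
  assume "\<forall>v \<in> carrier_vec n. (f ^^ j) v = v"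
  then show "W [^]\<^bsub>GL n\<^esub> j = 1\<^sub>m n"
    by (intro acts_mat_unique[OF acts_pow[OF assms] acts_one]) simp
qed

text \<open>By \<open>elliptic_orbit\<close> every return time of a coordinate vector, in particular
  d, is a multiple of twice its half period.\<close>

lemma elliptic_exponent_acts:
  assumes W: "acts n W f" and iso: "linear_isometry n f" and ell: "elliptic W" and d: "d > 0"
      "W [^]\<^bsub>GL n\<^esub> d = 1\<^sub>m n"
  shows "elliptic_exponent d f"
  unfolding elliptic_exponent_def
proof (intro allI impI)
  fix i assume i: "i < n"
  have fd: "(f ^^ d) (unit_vec n i) = unit_vec n i" using acts_pow_one_iff[OF W] d by simp
  obtain k where "k > 0" "(f ^^ k) (unit_vec n i) = - unit_vec n i" "\<And>j. (f ^^ j) (unit_vec n i)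
      = unit_vec n i \<Longrightarrow> 2 * k dvd j"
    using elliptic_orbit[OF iso elliptic_fixed[OF W ell] short_unit[OF i] d(1) fd] by blast
  with fd show "\<exists>k. 2 * k dvd d \<and> (f ^^ k) (unit_vec n i) = - unit_vec n i" by blast
qed

theorem spin_formula:
  assumes w: "w \<in> weyl_group n" "elliptic w" and d: "d = weyl_order n w" and carter:
      "carter_diagram n w ns"
    and g: "represents n N x g w"
  shows "g [^]\<^bsub>GL N\<^esub> d = z [^]\<^bsub>GL N\<^esub> h_exponent d ns"
proof (cases "d = 0")
  \<comment> \<open>The order is 0 if no positive power is 1. Instead of appealing to finiteness of
    the Weyl group, this case is checked directly: \<open>multiplicity 2 0\<close> is 0, so no
    component is relevant and both sides are 1.\<close>
  case True
  have "\<not> relevant 0 k" if "0 < k" for k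
  proof -
    have "multiplicity 2 (2 * k) \<noteq> 0" using that by (subst multiplicity_eq_zero_iff) auto
    then show ?thesis by (simp add: relevant_def)
  qed
  moreover have "\<forall>k \<in> set ns. 0 < k" using carter by (auto simp: carter_diagram_def)
  ultimately have "num_relevant_12 0 ns = 0" by (auto simp: num_relevant_12_def)
  then show ?thesis using True by (simp add: h_exponent_def)
next
  case False
  interpret W: group "GL n :: real mat monoid" by (rule GL_group)
  obtain f0 where f0: "rep {..<n} g f0" "acts n w f0" using represents_rep[OF g] by blast
  obtain bss ws where car: "sum_list ns = n" "\<forall>k \<in> set ns. 0 < k" "length bss = length ns"
      "length ws = length ns"
    and base: "\<And>i. i < length ns \<Longrightarrow> B_base n (bss ! i) \<and> length (bss ! i) = ns ! i
        \<and> coxeter_element n (bss ! i) (ws ! i)"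
    and orth: "\<And>i j \<beta> \<gamma>. i < length ns \<Longrightarrow> j < length ns \<Longrightarrow> i \<noteq> j \<Longrightarrow> \<beta> \<in> set (bss ! i) \<Longrightarrow>
      \<gamma> \<in> set (bss ! j) \<Longrightarrow> \<beta> \<bullet> \<gamma> = 0" and w_eq: "w = mat_product n ws"
    using carter unfolding carter_diagram_def by blast
  have "\<exists>cs. mset cs = mset (bss ! i) \<and> ws ! i = mat_product n (map (reflection n) cs)" if
      "i < length ns" for i
    using base[OF that] by (simp add: coxeter_element_def)
  then obtain c where c: "\<And>i. i < length ns \<Longrightarrow> mset (c i) = mset (bss ! i) \<and> ws ! i
      = mat_product n (map (reflection n) (c i))"
    by metis
  define css where "css = map c [0..<length ns]"
  have css: "length css = length ns" "\<And>i. i < length ns \<Longrightarrow> css ! i = c i" by (simp_all add: css_def)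
  have roots: "set (c i) \<subseteq> B_roots n" if "i < length ns" for i
    using base[OF that] c[OF that] by (metis B_base_def set_mset_mset)
  have chain: "B_chain (bss ! i) \<and> set (bss ! i) \<subseteq> B_roots n \<and> mset (css ! i) = mset (bss ! i)" if
      "i < length bss" for i
  proof -
    have i: "i < length ns" using that car by simp
    have "bss ! i \<noteq> []" using base[OF i] car(2) nth_mem[OF i] by auto
    then show ?thesis using B_base_chain base[OF i] c[OF i] css i by (auto simp: B_base_def)
  qed
  define f where "f = foldr reflect (concat css)"
  have fw: "acts n w f" unfolding f_def w_eq
    using car css c roots acts_mat_product by (intro acts_mat_product_concat) auto
  have rootsc: "set (concat css) \<subseteq> B_roots n" using roots by (simp add: css_def UN_subset_iff)
  have rep: "rep {..<n} (m_word (concat css)) f" unfolding f_def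
    using rootsc supported_all[OF B_roots_carrier] by (intro m_word_rep) auto
  have wd: "w [^]\<^bsub>GL n\<^esub> d = 1\<^sub>m n"
    using W.pow_ord_eq_1[OF weyl_group_carrier[OF w(1)]] by (simp add: d weyl_order_def GL_simps)
  have fd: "(f ^^ d) v = v" if "v \<in> carrier_vec n" for v using acts_pow_one_iff[OF fw] wd that
      by blast
  have ell: "elliptic_exponent d f"
    using elliptic_exponent_acts[OF fw rep_isometry[OF rep] w(2) _ wd] False by simp
  \<comment> \<open>From here on the given representative is replaced by the word read off from the
    Carter diagram.\<close>
  have "g [^]\<^bsub>GL N\<^esub> d = m_word (concat css) [^]\<^bsub>GL N\<^esub> d"
    using rep_pow_independent[OF f0(1) rep ell] acts_fun_unique[OF f0(2) fw] by simp
  also have "\<dots> = z [^]\<^bsub>GL N\<^esub> ((length bss choose 2) * (d choose 2) +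
      (\<Sum>i<length bss. (length (bss ! i) * (length (bss ! i)
          + 1) div 2) * (d div (2 * length (bss ! i)))))"
    using carter_power(2)[of css bss d] css car chain orth fd by (simp add: f_def)
  also have "(\<Sum>i<length bss. (length (bss ! i) * (length (bss ! i)
      + 1) div 2) * (d div (2 * length (bss ! i))))
     = (\<Sum>i<length ns. (ns ! i * (ns ! i + 1) div 2) * (d div (2 * ns ! i)))"
    using base car by (intro sum.cong) auto
  also have "length bss = length ns" using car by simp
  also have "z [^]\<^bsub>GL N\<^esub> ((length ns choose 2) * (d choose 2) + (\<Sum>i<length ns. (ns ! i * (ns ! i
      + 1) div 2) * (d div (2 * ns ! i))))
    = z [^]\<^bsub>GL N\<^esub> h_exponent d ns"
  proof -
    have "2 * ns ! i dvd d" if "i < length ns" for i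
      using carter_power(1)[of css bss d i] css car chain orth fd base that by (simp add: f_def)
    then have "\<forall>k \<in> set ns. 0 < k \<and> 2 * k dvd d" using car(2) by (auto simp: in_set_conv_nth)
    moreover have "ns \<noteq> []" using car(1) rank by auto
    ultimately show ?thesis using h_exponent_parity False unfolding z_pow_mod by auto
  qed
  finally show ?thesis .
qed

text \<open>\<open>g [^] k\<close> leads to the opposite root subgroup with a factor \<eta> and back
  with its inverse, so the 2k-th power centralises. This is where the inverse scalar in
  \<open>x_equivariant\<close> pays off.\<close>

lemma rep_pow_x:
  assumes g: "rep I g f" and b: "\<beta> \<in> B_roots n" and k: "(f ^^ k) \<beta> = - \<beta>" and j: "2 * k dvd j"
  shows "cj (g [^]\<^bsub>GL N\<^esub> j) (x \<beta> c) = x \<beta> c"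
proof -
  have gc: "g \<in> carrier (GL N)" using rep_closed[OF g] .
  have "x_equivariant (g [^]\<^bsub>GL N\<^esub> k) (f ^^ k)" using rep_equivariant[OF rep_pow[OF g]] .
  then obtain \<eta> where e: "\<eta> \<noteq> 0" "\<And>c. cj (g [^]\<^bsub>GL N\<^esub> k) (x \<beta> c) = x (- \<beta>) (\<eta> * c)"
    "\<And>c. cj (g [^]\<^bsub>GL N\<^esub> k) (x (- \<beta>) c) = x \<beta> (inverse \<eta> * c)"
    using b k unfolding x_equivariant_def by (metis uminus_uminus_vec)
  have "g [^]\<^bsub>GL N\<^esub> (2 * k) = g [^]\<^bsub>GL N\<^esub> k \<otimes>\<^bsub>GL N\<^esub> g [^]\<^bsub>GL N\<^esub> k" using gc
      by (simp add: nat_pow_mult mult_2)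
  then have 2: "cj (g [^]\<^bsub>GL N\<^esub> (2 * k)) (x \<beta> c) = x \<beta> c"
    using gc b e by (simp add: cj_cj mult.assoc[symmetric])
  obtain q where q: "j = 2 * k * q" using j by (auto simp: dvd_def)
  have "cj (g [^]\<^bsub>GL N\<^esub> (2 * k * q)) (x \<beta> c) = x \<beta> c"
  proof (induction q)
    case (Suc q)
    have "g [^]\<^bsub>GL N\<^esub> (2 * k * Suc q) = g [^]\<^bsub>GL N\<^esub> (2 * k * q) \<otimes>\<^bsub>GL N\<^esub> g [^]\<^bsub>GL N\<^esub> (2 * k)"
      using gc by (simp add: nat_pow_mult algebra_simps)
    then show ?case using Suc 2 gc b by (simp add: cj_cj)
  qed (use b in simp)
  then show ?thesis by (simp add: q)
qed

lemma T_subset_chev_T: "T {..<n} \<subseteq> chev_T n N x"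
  unfolding T_def chev_T_def
  by (intro mono_generate) (auto simp: T_gens_def h_elt_eq intro: short_root short_unit)

text \<open>The powers of g and w that are trivial are shown to be the same. If w^j = 1 with j > 0,
  then g^j lies in the torus and centralises the short root subgroups, so \<open>trivial\<close>
  applies; conversely the action of g^j on these subgroups determines w^j.\<close>

lemma adjoint_spin:
  assumes trivial: "\<And>t. t \<in> chev_T n N x \<Longrightarrow> (\<And>i. i < n \<Longrightarrow> cj t (x (unit_vec n i) 1)
      = x (unit_vec n i) 1) \<Longrightarrow> t = 1\<^sub>m N"
    and w: "w \<in> weyl_group n" "elliptic w"
  shows "has_spin_1 n N x w"
  unfolding has_spin_1_def
proof (intro allI impI)
  fix g assume "represents n N x g w"
  then obtain f where f: "rep {..<n} g f" "acts n w f" using represents_rep by blast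
  interpret W: group "GL n :: real mat monoid" by (rule GL_group)
  have wc: "w \<in> carrier (GL n)" using weyl_group_carrier[OF w(1)] .
  have gc: "g \<in> carrier (GL N)" using rep_closed[OF f(1)] .
  note iso = rep_isometry[OF f(1)]
  have "g [^]\<^bsub>GL N\<^esub> j = \<one>\<^bsub>GL N\<^esub> \<longleftrightarrow> w [^]\<^bsub>GL n\<^esub> j = \<one>\<^bsub>GL n\<^esub>" for j :: nat
  proof
    assume gj: "g [^]\<^bsub>GL N\<^esub> j = \<one>\<^bsub>GL N\<^esub>"
    then have eq: "x_equivariant \<one>\<^bsub>GL N\<^esub> (f ^^ j)" using rep_equivariant[OF rep_pow[OF f(1), of j]]
        by simp
    have "(f ^^ j) (unit_vec n i) = unit_vec n i" if "i < n" for i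
      using x_equivariant_unique[OF eq x_equivariant_one, of "unit_vec n i"] short_unit[OF that]
        linear_isometry_short[OF linear_isometry_funpow[OF iso]] by (simp add: short_root)
    then show "w [^]\<^bsub>GL n\<^esub> j = \<one>\<^bsub>GL n\<^esub>"
      unfolding GL_simps by (intro acts_mat_unique[OF acts_pow[OF f(2)] acts_one]) simp
  next
    assume wj: "w [^]\<^bsub>GL n\<^esub> j = \<one>\<^bsub>GL n\<^esub>"
    show "g [^]\<^bsub>GL N\<^esub> j = \<one>\<^bsub>GL N\<^esub>"
    proof (cases "j = 0")
      case False
      have fj: "(f ^^ j) (unit_vec n i) = unit_vec n i" for i
        using acts_pow_one_iff[OF f(2), of j] wj by (simp add: GL_simps)
      have "elliptic_exponent j f"
        using elliptic_exponent_acts[OF f(2) iso w(2)] False wj by (simp add: GL_simps)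
      then have "cj (g [^]\<^bsub>GL N\<^esub> j) (x (unit_vec n i) 1) = x (unit_vec n i) 1" if "i < n" for i
        using rep_pow_x[OF f(1) short_root[OF short_unit[OF that]]] that
            unfolding elliptic_exponent_def by blast
      moreover have "g [^]\<^bsub>GL N\<^esub> j \<in> T {..<n}"
        using rep_kernel[OF _ _ rep_pow[OF f(1)]] fj by blast
      ultimately show ?thesis using trivial T_subset_chev_T by (simp add: GL_simps subset_iff)
    qed simp
  qed
  then show "group.ord (GL N) g = weyl_order n w"
    unfolding weyl_order_def using ord_unique[OF gc] W.pow_eq_id[OF wc] by blast
qed

end

section \<open>Torus characters in the adjoint group\<close>

lemma diagonal_mult_entry:
  assumes "A \<in> carrier_mat k k" "B \<in> carrier_mat k k" "diagonal_mat A" "j < k"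
  shows "(A * B :: 'a::comm_ring_1 mat) $$ (j, j) = A $$ (j, j) * B $$ (j, j)"
proof -
  have "(A * B) $$ (j, j) = (\<Sum>l<k. A $$ (j, l) * B $$ (l, j))"
    using assms by (auto simp: scalar_prod_def lessThan_atLeast0)
  also have "\<dots> = (\<Sum>l<k. if l = j then A $$ (j, j) * B $$ (j, j) else 0)"
    using assms by (intro sum.cong) (auto simp: diagonal_mat_def)
  finally show ?thesis using assms by simp
qed

text \<open>After simultaneous diagonalisation the diagonal entries are characters of T, hence of
  the form \<open>\<phi> v\<close> in the adjoint case. As \<phi> is trivial at t on the coordinate
  vectors, which generate the lattice, all entries of t are 1.\<close>

lemma adjoint_trivial:
  fixes T :: "'k::alg_closed_field mat set"
  assumes torus: "torus N T" and iso: "root_system_iso n N G T \<phi>" and adj: "adjoint_type n N T \<phi>"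
    and t: "t \<in> T" and triv: "\<And>i. i < n \<Longrightarrow> \<phi> (unit_vec n i) t = 1"
  shows "t = 1\<^sub>m N"
proof -
  interpret GL: group "GL N :: 'k mat monoid" by (rule GL_group)
  have sub: "subgroup T (GL N)" using torus by (simp add: torus_def algebraic_group_def)
  have Tc: "s \<in> carrier (GL N)" if "s \<in> T" for s using subgroup.mem_carrier[OF sub that] .
  have Tm: "s \<in> carrier_mat N N" if "s \<in> T" for s using GL_carrier[OF Tc[OF that]] .
  have ch: "\<phi> v \<in> characters N T" if "v \<in> carrier_vec n" for v using iso that
      by (auto simp: root_system_iso_def)
  have add: "\<phi> (u + v) t = \<phi> u t * \<phi> v t" if "u \<in> carrier_vec n" "v \<in> carrier_vec n" for u v
    using iso that t by (auto simp: root_system_iso_def)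
  have nz: "\<phi> v t \<noteq> 0" if "v \<in> carrier_vec n" for v using ch[OF that] t
      by (auto simp: characters_def)
  have zero: "\<phi> (0\<^sub>v n) t = 1" using add[of "0\<^sub>v n" "0\<^sub>v n"] nz[of "0\<^sub>v n"] by simp
  have mult: "\<phi> (c \<cdot>\<^sub>v unit_vec n i) t = 1" if i: "i < n" for c i
  proof (induction c rule: int_induct[where k = 0])
    case base
    have "(0::int) \<cdot>\<^sub>v unit_vec n i = 0\<^sub>v n" by (intro eq_vecI) auto
    then show ?case using zero by simp
  next
    case (step1 c)
    have "(c + 1) \<cdot>\<^sub>v unit_vec n i = c \<cdot>\<^sub>v unit_vec n i + unit_vec n i"
        by (intro eq_vecI) (auto simp: algebra_simps)
    then show ?case using add[of "c \<cdot>\<^sub>v unit_vec n i" "unit_vec n i"] step1 triv[OF i] by simp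
  next
    case (step2 c)
    have "c \<cdot>\<^sub>v unit_vec n i = (c - 1) \<cdot>\<^sub>v unit_vec n i + unit_vec n i"
        by (intro eq_vecI) (auto simp: algebra_simps)
    then show ?case using add[of "(c - 1) \<cdot>\<^sub>v unit_vec n i" "unit_vec n i"] step2 triv[OF i] by simp
  qed
  \<comment> \<open>Induction on a bound k from which on all coordinates vanish; the step splits off
    the coordinate k.\<close>
  have "\<phi> v t = 1" if "v \<in> carrier_vec n" "\<forall>j<n. k \<le> j \<longrightarrow> v $ j = 0" for v k
    using that
  proof (induction k arbitrary: v)
    case 0
    then have "v = 0\<^sub>v n" by (intro eq_vecI) auto
    then show ?case using zero by simp
  next
    case (Suc k)
    show ?case
    proof (cases "k < n")
      case True
      define u where "u = v - (v $ k) \<cdot>\<^sub>v unit_vec n k"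
      have u: "u \<in> carrier_vec n" "v = u + (v $ k) \<cdot>\<^sub>v unit_vec n k" using Suc.prems True
          by (auto simp: u_def intro!: eq_vecI)
      have "u $ j = 0" if "j < n" "k \<le> j" for j using that Suc.prems True by (cases "j
          = k") (auto simp: u_def)
      then have "\<phi> u t = 1" using Suc.IH[of u] u by blast
      then show ?thesis using add[of u "(v $ k) \<cdot>\<^sub>v unit_vec n k"] mult[OF True] u by simp
    next
      case False
      then show ?thesis using Suc by auto
    qed
  qed
  then have all: "\<phi> v t = 1" if "v \<in> carrier_vec n" for v using that[of ]
      by (metis carrier_vecD not_le that)
  obtain P where P: "P \<in> carrier (GL N)" "\<And>s. s \<in> T \<Longrightarrow> diagonal_mat (P * s * inv\<^bsub>GL N\<^esub> P)"
    using torus by (auto simp: torus_def)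
  define Q where "Q = inv\<^bsub>GL N\<^esub> P"
  have Q: "Q \<in> carrier (GL N)" "P * Q = 1\<^sub>m N" "Q * P = 1\<^sub>m N"
    using P(1) GL.r_inv[OF P(1)] GL.l_inv[OF P(1)] by (auto simp: Q_def GL_simps)
  have PQm: "P \<in> carrier_mat N N" "Q \<in> carrier_mat N N" using GL_carrier P(1) Q(1) by auto
  have diag: "diagonal_mat (P * s * Q)" if "s \<in> T" for s using P(2)[OF that] by (simp add: Q_def)
  have c: "P * s * Q \<in> carrier_mat N N" if "s \<in> T" for s using PQm Tm[OF that] by simp
  have hom: "P * (s * r) * Q = (P * s * Q) * (P * r * Q)" if "s \<in> T" "r \<in> T" for s r
  proof -
    have "(P \<otimes>\<^bsub>GL N\<^esub> s \<otimes>\<^bsub>GL N\<^esub> inv\<^bsub>GL N\<^esub> P) \<otimes>\<^bsub>GL N\<^esub> (P \<otimes>\<^bsub>GL N\<^esub> r \<otimes>\<^bsub>GL N\<^esub> inv\<^bsub>GL N\<^esub> P)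
      = P \<otimes>\<^bsub>GL N\<^esub> (s \<otimes>\<^bsub>GL N\<^esub> r) \<otimes>\<^bsub>GL N\<^esub> inv\<^bsub>GL N\<^esub> P"
      using P(1) Tc that by (simp add: GL.m_assoc)
    then show ?thesis by (simp add: GL_simps Q_def)
  qed
  have diag1: "(P * t * Q) $$ (j, j) = 1" if j: "j < N" for j
  proof -
    define \<chi> where "\<chi> = restrict (\<lambda>s. (P * s * Q) $$ (j, j)) T"
    have mul: "\<chi> (s * r) = \<chi> s * \<chi> r" if "s \<in> T" "r \<in> T" for s r
      using that subgroup.m_closed[OF sub that] diagonal_mult_entry[OF c c diag j] hom[OF that]
      by (simp add: \<chi>_def GL_simps)
    have one: "1\<^sub>m N \<in> T" using subgroup.one_closed[OF sub] by (simp add: GL_simps)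
    have "\<chi> s \<noteq> 0" if s: "s \<in> T" for s
    proof -
      have si: "inv\<^bsub>GL N\<^esub> s \<in> T" using subgroup.m_inv_closed[OF sub s] .
      have "s * inv\<^bsub>GL N\<^esub> s = 1\<^sub>m N" using GL.r_inv[OF Tc[OF s]] by (simp add: GL_simps)
      then have "\<chi> s * \<chi> (inv\<^bsub>GL N\<^esub> s) = \<chi> (1\<^sub>m N)" using mul[OF s si] by simp
      also have "\<dots> = (P * 1\<^sub>m N * Q) $$ (j, j)" using one by (simp add: \<chi>_def)
      also have "P * 1\<^sub>m N * Q = 1\<^sub>m N" using PQm Q(2) by simp
      also have "1\<^sub>m N $$ (j, j) = (1 :: 'k)" using j by simp
      finally show ?thesis by auto
    qed
    \<comment> \<open>A diagonal entry of the conjugate is linear in the entries of s, so the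
      exponent of the determinant can be 0.\<close>
    moreover have "\<exists>f \<in> poly_fun N. \<exists>k::nat. \<forall>s\<in>T. \<chi> s = f s / det s ^ k"
    proof (intro bexI exI ballI)
      show "(\<lambda>A. \<Sum>b\<in>{..<N}. (\<Sum>a\<in>{..<N}. P $$ (j, a) * A $$ (a, b)) * Q $$ (b, j)) \<in> poly_fun N"
        by (intro poly_fun_sum poly_fun.mult poly_fun.const poly_fun.entry) auto
      fix s assume s: "s \<in> T"
      show "\<chi> s = (\<Sum>b\<in>{..<N}. (\<Sum>a\<in>{..<N}. P $$ (j, a) * s $$ (a, b)) * Q $$ (b, j)) / det s ^ 0"
        using s j PQm Tm[OF s] by (simp add: \<chi>_def scalar_prod_def lessThan_atLeast0)
    qed
    ultimately have "\<chi> \<in> characters N T" using mul by (auto simp: characters_def \<chi>_def)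
    then obtain v where "v \<in> carrier_vec n" "\<chi> = \<phi> v" using adj by (auto simp: adjoint_type_def)
    then have "\<chi> t = 1" using all by simp
    then show ?thesis using t by (simp add: \<chi>_def)
  qed
  define D where "D = P * t * Q"
  have D: "D \<in> carrier_mat N N" "diagonal_mat D" "\<And>j. j < N \<Longrightarrow> D $$ (j, j) = 1"
    using c[OF t] diag[OF t] diag1 by (simp_all add: D_def)
  then have "D = 1\<^sub>m N" by (intro eq_matI) (auto simp: diagonal_mat_def)
  then have D1: "P \<otimes>\<^bsub>GL N\<^esub> t \<otimes>\<^bsub>GL N\<^esub> inv\<^bsub>GL N\<^esub> P = \<one>\<^bsub>GL N\<^esub>" by (simp add: GL_simps Q_def D_def)
  have "t = inv\<^bsub>GL N\<^esub> P \<otimes>\<^bsub>GL N\<^esub> (P \<otimes>\<^bsub>GL N\<^esub> t \<otimes>\<^bsub>GL N\<^esub> inv\<^bsub>GL N\<^esub> P) \<otimes>\<^bsub>GL N\<^esub> P"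
    using P(1) Tc[OF t] by (simp add: GL.m_assoc)
  also have "\<dots> = \<one>\<^bsub>GL N\<^esub>" unfolding D1 using P(1) by simp
  finally have "t = \<one>\<^bsub>GL N\<^esub>" .
  then show ?thesis by (simp add: GL_simps)
qed

lemma chevalley_matrix_groupI:
  fixes x :: "int vec \<Rightarrow> 'k::alg_closed_field \<Rightarrow> 'k mat"
  assumes char: "CHAR('k) \<noteq> 2" and n: "n > 1" and sub: "subgroup G (GL N)"
    and gens: "chevalley_generators n N G \<phi> x"
  shows "chevalley_matrix_group N n x"
proof -
  note chev = gens[unfolded chevalley_generators_def]
  interpret GL: group "GL N :: 'k mat monoid" by (rule GL_group)
  have hom: "root_hom N G (chev_T n N x) (\<phi> \<alpha>) (x \<alpha>)" if "\<alpha> \<in> B_roots n" for \<alpha> using chev that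
      by blast
  interpret root_maps "GL N" n x
  proof
    fix \<alpha> and c :: 'k assume "\<alpha> \<in> B_roots n"
    then have "range (x \<alpha>) \<subseteq> G" using hom by (simp add: root_hom_def)
    then have "x \<alpha> c \<in> G" by blast
    then show "x \<alpha> c \<in> carrier (GL N)" by (rule subgroup.mem_carrier[OF sub])
  qed
  have m_eq: "m_elt x \<alpha> c = m \<alpha> c" for \<alpha> c
    by (simp add: m_elt_def m_def GL_simps)
  have h_eq: "h_elt x \<alpha> c = h \<alpha> c" for \<alpha> c
    by (simp add: h_elt_def h_def GL_simps m_eq)
  have rf: "root_factor n N x \<gamma> c = x_or_one \<gamma> c" for \<gamma> c
    by (simp add: root_factor_def x_or_one_def GL_simps)
  show ?thesis
  proof
    \<comment> \<open>If 2 were 0, the characteristic would divide 2; it is never 1, and not 2 by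
      assumption.\<close>
    have "CHAR('k) \<noteq> 1" by simp
    then have "\<not> CHAR('k) dvd 2" using char two_is_prime_nat unfolding prime_nat_iff by blast
    then show "(2::'k) \<noteq> 0" using of_nat_eq_0_iff_char_dvd[of 2, where 'a = 'k] by simp
    show "n > 1" by fact
    fix \<alpha> and b c :: 'k assume a: "\<alpha> \<in> B_roots n"
    show "x \<alpha> (b + c) = x \<alpha> b \<otimes>\<^bsub>GL N\<^esub> x \<alpha> c" using hom[OF a] by (simp add: root_hom_def GL_simps)
    \<comment> \<open>The regular left inverse in \<open>root_hom\<close> recovers the
      parameter.\<close>
    show "b = c" if "x \<alpha> b = x \<alpha> c" using hom[OF a] that unfolding root_hom_def by metis
    show "h \<alpha> (b * c) = h \<alpha> b \<otimes>\<^bsub>GL N\<^esub> h \<alpha> c" if "b \<noteq> 0" "c \<noteq> 0"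
    proof -
      have "h_elt x \<alpha> (b * c) = h_elt x \<alpha> b * h_elt x \<alpha> c" using chev a that by blast
      then show ?thesis by (simp only: h_eq GL_simps)
    qed
    fix \<beta> assume b: "\<beta> \<in> B_roots n"
    show "h \<alpha> b \<otimes>\<^bsub>GL N\<^esub> x \<beta> c \<otimes>\<^bsub>GL N\<^esub> inv\<^bsub>GL N\<^esub> h \<alpha> b = x \<beta> (b powi cartan \<beta> \<alpha> * c)" if "b \<noteq> 0"
    proof -
      have "h_elt x \<alpha> b * x \<beta> c * inv\<^bsub>GL N\<^esub> (h_elt x \<alpha> b) = x \<beta> (b powi cartan \<beta> \<alpha> * c)"
        using chev a b that by blast
      then show ?thesis by (simp only: h_eq GL_simps)
    qed
    show "\<exists>\<epsilon>\<in>{1, - 1}. \<forall>c. m \<alpha> 1 \<otimes>\<^bsub>GL N\<^esub> x \<beta> c \<otimes>\<^bsub>GL N\<^esub> inv\<^bsub>GL N\<^esub> m \<alpha> 1 = x (reflect \<alpha> \<beta>) (\<epsilon> * c)"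
    proof -
      have "\<exists>\<epsilon> \<in> {1, - 1}. \<forall>c. m_elt x \<alpha> 1 * x \<beta> c * inv\<^bsub>GL N\<^esub> (m_elt x \<alpha> 1)
          = x (reflect \<alpha> \<beta>) (\<epsilon> * c)"
        using chev a b by blast
      then show ?thesis by (simp only: m_eq GL_simps)
    qed
    assume "\<beta> \<noteq> \<alpha>" "\<beta> \<noteq> - \<alpha>"
    then have "commutator_formula n N x \<alpha> \<beta>" using chev a b by blast
    then show "\<exists>c11 c12 c21 :: int. \<bar>c11\<bar> = int (string_len n \<alpha> \<beta>) + 1 \<and>
       (\<forall>a b. x \<alpha> a \<otimes>\<^bsub>GL N\<^esub> x \<beta> b \<otimes>\<^bsub>GL N\<^esub> inv\<^bsub>GL N\<^esub> (x \<alpha> a) \<otimes>\<^bsub>GL N\<^esub> inv\<^bsub>GL N\<^esub> (x \<beta> b) =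
          x_or_one (\<alpha> + \<beta>) (of_int c11 * a * b) \<otimes>\<^bsub>GL N\<^esub>
          x_or_one (\<alpha> + 2 \<cdot>\<^sub>v \<beta>) (of_int c12 * a * b\<^sup>2) \<otimes>\<^bsub>GL N\<^esub>
          x_or_one (2 \<cdot>\<^sub>v \<alpha> + \<beta>) (of_int c21 * a\<^sup>2 * b))"
      by (simp only: commutator_formula_def rf GL_simps)
  qed
qed

theorem theorem4p1:
  fixes G :: "'k::alg_closed_field mat set"
    and x :: "int vec \<Rightarrow> 'k \<Rightarrow> 'k mat"
    and \<phi> :: "int vec \<Rightarrow> 'k mat \<Rightarrow> 'k"
    and n m :: nat
  assumes "CHAR('k) \<noteq> 2"
    and "n > 1"
    and "semisimple_group m G"
    and "maximal_torus m G (chev_T n m x)"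
    and "root_system_iso n m G (chev_T n m x) \<phi>"
    and "chevalley_generators n m G \<phi> x"
  shows "(\<forall>w g\<^sub>0 ns d. w \<in> weyl_group n \<longrightarrow> elliptic w \<longrightarrow> d = weyl_order n w \<longrightarrow>
            carter_diagram n w ns \<longrightarrow> g\<^sub>0 \<in> chev_N0 n m x \<longrightarrow> represents n m x g\<^sub>0 w \<longrightarrow>
            g\<^sub>0 [^]\<^bsub>GL m\<^esub> d = h_elt x (simple_root n (n - 1)) (- 1) [^]\<^bsub>GL m\<^esub> h_exponent d ns)
       \<and> (adjoint_type n m (chev_T n m x) \<phi> \<longrightarrow>
            (\<forall>w \<in> weyl_group n. elliptic w \<longrightarrow> has_spin_1 n m x w))"
proof -
  have sub: "subgroup G (GL m)" using assms(3) by (simp add: semisimple_group_def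
      algebraic_group_def)
  interpret chevalley_matrix_group m n x using chevalley_matrix_groupI[OF assms(1,2) sub assms(6)] .
  have hom: "root_hom m G (chev_T n m x) (\<phi> \<alpha>) (x \<alpha>)" if "\<alpha> \<in> B_roots n" for \<alpha>
    using assms(6) that unfolding chevalley_generators_def by blast
  have z: "h_elt x (simple_root n (n - 1)) (- 1) = z"
    using assms(2) by (simp add: h_elt_eq z_def simple_root_def)
  have spin: "has_spin_1 n m x w"
    if adj: "adjoint_type n m (chev_T n m x) \<phi>" and w: "w \<in> weyl_group n" "elliptic w" for w
  proof (rule adjoint_spin[OF _ w])
    fix t assume t: "t \<in> chev_T n m x" and fixed: "\<And>i. i < n \<Longrightarrow> cj t (x (unit_vec n i) 1)
        = x (unit_vec n i) 1"
    have "\<phi> (unit_vec n i) t = 1" if i: "i < n" for i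
    proof -
      have r: "unit_vec n i \<in> B_roots n" using short_root[OF short_unit[OF i]] .
      \<comment> \<open>The torus acts on this subgroup through \<phi>, so fixing the element of
        parameter 1 forces the character value 1.\<close>
      have "cj t (x (unit_vec n i) 1) = x (unit_vec n i) (\<phi> (unit_vec n i) t * 1)"
        using hom[OF r] t unfolding root_hom_def cj_def GL_simps by blast
      then show ?thesis using x_inj[OF r] fixed[OF i] by simp
    qed
    then show "t = 1\<^sub>m m"
      using adjoint_trivial[OF _ assms(5) adj t] assms(4) by (simp add: maximal_torus_def)
  qed
  show ?thesis unfolding z using spin_formula spin by blast
qed

end
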